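(* For every integer $k\ge 1$, the following decision problem is solvable in polynomial time: given a flow network ${\cal N}=(D,s,t,c)$, decide whether there exists an $(s,t)$-flow $x$ on ${\cal N}$ of value at least $k+1$ such that $\Delta^+(D_x)\le k$.
   Context: A flow network ${\cal N}=(D,s,t,c)$ consists of a digraph $D$, a source $s$, a sink $t$ and non-negative integer arc capacities $c$. All flows are integer valued: an $(s,t)$-flow $x$ assigns to each arc $uv$ an integer $0\le x(uv)\le c(uv)$ with flow conservation at every vertex other than $s,t$; its value $|x|$ is the net amount of flow leaving $s$. The support digraph $D_x$ is the subdigraph of $D$ with arc set $\{uv\in A(D): x(uv)>0\}$. $\Delta^+(H)$ denotes the maximum out-degree of a digraph $H$. *)

theory Defs
  imports
    "HOL-Library.Discrete_Functions"
    "HOL-Computational_Algebra.Polynomial"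
    "Graph_Theory.Graph_Theory"
begin

section \<open>Flow networks\<close>

text \<open>
  Digraphs are finite, without loops and without parallel arcs (opposite arcs are allowed),
  so that an arc is a pair of vertices.  The capacity function is only meaningful on arcs.
\<close>

record 'a flow_network =
  dgraph :: "'a pair_pre_digraph"
  src :: 'a
  snk :: 'a
  capacity :: "'a \<times> 'a \<Rightarrow> nat"

definition flow_network :: "'a flow_network \<Rightarrow> bool" where
  "flow_network N \<longleftrightarrow>
     pair_digraph (dgraph N) \<and> src N \<in> pverts (dgraph N) \<and> snk N \<in> pverts (dgraph N) \<and>
     src N \<noteq> snk N"

definition outflow :: "'a flow_network \<Rightarrow> ('a \<times> 'a \<Rightarrow> nat) \<Rightarrow> 'a \<Rightarrow> nat" where
  "outflow N x v = (\<Sum>e\<in>out_arcs (with_proj (dgraph N)) v. x e)"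

definition inflow :: "'a flow_network \<Rightarrow> ('a \<times> 'a \<Rightarrow> nat) \<Rightarrow> 'a \<Rightarrow> nat" where
  "inflow N x v = (\<Sum>e\<in>in_arcs (with_proj (dgraph N)) v. x e)"

definition st_flow :: "'a flow_network \<Rightarrow> ('a \<times> 'a \<Rightarrow> nat) \<Rightarrow> bool" where
  "st_flow N x \<longleftrightarrow>
     (\<forall>e\<in>parcs (dgraph N). x e \<le> capacity N e) \<and>
     (\<forall>v\<in>pverts (dgraph N) - {src N, snk N}. inflow N x v = outflow N x v)"

text \<open>Arcs entering the source are allowed, hence the value is a difference of integers.\<close>

definition flow_value :: "'a flow_network \<Rightarrow> ('a \<times> 'a \<Rightarrow> nat) \<Rightarrow> int" where
  "flow_value N x = int (outflow N x (src N)) - int (inflow N x (src N))"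

definition support_digraph :: "'a flow_network \<Rightarrow> ('a \<times> 'a \<Rightarrow> nat) \<Rightarrow> 'a pair_pre_digraph" where
  "support_digraph N x =
     \<lparr>pverts = pverts (dgraph N), parcs = {e \<in> parcs (dgraph N). x e > 0}\<rparr>"

definition max_out_degree :: "('a, 'b) pre_digraph \<Rightarrow> nat" where
  "max_out_degree G = Max (out_degree G ` verts G)"


section \<open>Polynomial time\<close>

text \<open>
  The machine model is the random access machine with logarithmic cost (Aho, Hopcroft, Ullman,
  The Design and Analysis of Computer Algorithms, 1974), which simulates and is simulated by
  Turing machines with polynomial overhead.  A problem is a set of finite sequences of natural
  numbers; the size of a sequence is the total number of bits of its entries.  The only
  arithmetic instructions are addition and truncated subtraction.  The input is read-only,
  separate from the registers and can be accessed at any position.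
\<close>

definition nbits :: "nat \<Rightarrow> nat" where
  "nbits n = floor_log n + 1"

definition input_size :: "nat list \<Rightarrow> nat" where
  "input_size xs = (\<Sum>a\<leftarrow>xs. nbits a)"

type_synonym reg = nat
type_synonym memory = "nat \<Rightarrow> nat"

datatype instr =
    Const reg nat       (* r := n *)
  | Copy reg reg        (* r := s *)
  | Add reg reg reg     (* r := s + t *)
  | Sub reg reg reg     (* r := s - t, truncated *)
  | Load reg reg        (* r := contents of the register whose address is in s *)
  | Store reg reg       (* the register whose address is in r := s *)
  | Read reg reg        (* r := input entry whose position is in s *)
  | Length reg          (* r := number of input entries *)
  | Jump nat
  | JumpZero reg nat

definition input_at :: "nat list \<Rightarrow> nat \<Rightarrow> nat" where
  "input_at xs i = (if i < length xs then xs ! i else 0)"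

fun exec_instr :: "nat list \<Rightarrow> instr \<Rightarrow> nat \<times> memory \<Rightarrow> nat \<times> memory" where
  "exec_instr xs (Const r n) (pc, m) = (pc + 1, m(r := n))"
| "exec_instr xs (Copy r s) (pc, m) = (pc + 1, m(r := m s))"
| "exec_instr xs (Add r s t) (pc, m) = (pc + 1, m(r := m s + m t))"
| "exec_instr xs (Sub r s t) (pc, m) = (pc + 1, m(r := m s - m t))"
| "exec_instr xs (Load r s) (pc, m) = (pc + 1, m(r := m (m s)))"
| "exec_instr xs (Store r s) (pc, m) = (pc + 1, m(m r := m s))"
| "exec_instr xs (Read r s) (pc, m) = (pc + 1, m(r := input_at xs (m s)))"
| "exec_instr xs (Length r) (pc, m) = (pc + 1, m(r := length xs))"
| "exec_instr xs (Jump l) (pc, m) = (l, m)"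
| "exec_instr xs (JumpZero r l) (pc, m) = (if m r = 0 then l else pc + 1, m)"

text \<open>Each instruction is charged the bit lengths of all addresses and values it handles.\<close>

fun instr_cost :: "nat list \<Rightarrow> instr \<Rightarrow> memory \<Rightarrow> nat" where
  "instr_cost xs (Const r n) m = nbits r + nbits n"
| "instr_cost xs (Copy r s) m = nbits r + nbits s + nbits (m s)"
| "instr_cost xs (Add r s t) m = nbits r + nbits s + nbits (m s) + nbits t + nbits (m t)"
| "instr_cost xs (Sub r s t) m = nbits r + nbits s + nbits (m s) + nbits t + nbits (m t)"
| "instr_cost xs (Load r s) m = nbits r + nbits s + nbits (m s) + nbits (m (m s))"
| "instr_cost xs (Store r s) m = nbits r + nbits (m r) + nbits s + nbits (m s)"
| "instr_cost xs (Read r s) m = nbits r + nbits s + nbits (m s) + nbits (input_at xs (m s))"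
| "instr_cost xs (Length r) m = nbits r + nbits (length xs)"
| "instr_cost xs (Jump l) m = nbits l"
| "instr_cost xs (JumpZero r l) m = nbits r + nbits (m r) + nbits l"

text \<open>
  \<open>runs P xs c T m\<close>: program \<open>P\<close> on input \<open>xs\<close>, started in configuration \<open>c\<close> (program counter and
  memory), halts after total cost \<open>T\<close> with memory \<open>m\<close>.  It halts when the program counter leaves
  the program.
\<close>

inductive runs :: "instr list \<Rightarrow> nat list \<Rightarrow> nat \<times> memory \<Rightarrow> nat \<Rightarrow> memory \<Rightarrow> bool"
  for P :: "instr list" and xs :: "nat list" where
  halt: "pc \<ge> length P \<Longrightarrow> runs P xs (pc, m) 0 m"
| step: "pc < length P \<Longrightarrow> runs P xs (exec_instr xs (P ! pc) (pc, m)) T m' \<Longrightarrow>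
         runs P xs (pc, m) (instr_cost xs (P ! pc) m + T) m'"

lemma runs_deterministic:
  assumes "runs P xs c T m" and "runs P xs c T' m'"
  shows "T = T' \<and> m = m'"
  using assms
proof (induction arbitrary: T' m' rule: runs.induct)
  case (halt pc m)
  from halt.prems show ?case by (cases rule: runs.cases) (use halt.hyps in simp_all)
next
  case (step pc m T m1)
  from step.prems show ?case
  proof (cases rule: runs.cases)
    case halt
    with step.hyps show ?thesis by simp
  next
    case (step T1)
    with step.IH[of T1 m'] show ?thesis by simp
  qed
qed

text \<open>
  The machine starts with all registers 0 and accepts iff register 0 is nonzero in the end.
  It has to halt within the time bound on every sequence, whether or not it is the code of
  an instance.
\<close>

definition polynomial_time_decidable :: "nat list set \<Rightarrow> bool" where
  "polynomial_time_decidable L \<longleftrightarrow>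
     (\<exists>(P :: instr list) (p :: nat poly). \<forall>xs. \<exists>T m.
        runs P xs (0, \<lambda>_. 0) T m \<and> T \<le> poly p (input_size xs) \<and> (m 0 \<noteq> 0 \<longleftrightarrow> xs \<in> L))"


section \<open>Flow networks as inputs\<close>

text \<open>
  As an input, a network has the vertices \<open>0, \<dots>, n - 1\<close> and is coded by \<open>n\<close>, the source, the
  sink and its adjacency matrix row by row.  An entry is 0 if there is no arc and \<open>c + 1\<close> if
  there is an arc of capacity \<open>c\<close>, so that arcs of capacity 0 are represented as well.
\<close>

definition input_network :: "nat flow_network \<Rightarrow> bool" where
  "input_network N \<longleftrightarrow>
     flow_network N \<and> pverts (dgraph N) = {..<card (pverts (dgraph N))}"

definition arc_code :: "nat flow_network \<Rightarrow> nat \<times> nat \<Rightarrow> nat" where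
  "arc_code N e = (if e \<in> parcs (dgraph N) then capacity N e + 1 else 0)"

definition encode_network :: "nat flow_network \<Rightarrow> nat list" where
  "encode_network N =
     (let n = card (pverts (dgraph N)) in
      [n, src N, snk N] @ [arc_code N (u, v). u \<leftarrow> [0..<n], v \<leftarrow> [0..<n]])"

lemma concat_map_eq_same_length:
  assumes "concat (map f us) = concat (map g us)" "\<And>u. length (f u) = length (g u)" "u \<in> set us"
  shows "f u = g u"
  using assms(1,3) by (induction us) (auto simp: assms(2))

text \<open>The code determines the network, except for irrelevant capacities of non-arcs.\<close>

lemma encode_network_determines:
  assumes N: "input_network N" and M: "input_network M"
    and eq: "encode_network N = encode_network M"
  shows "dgraph N = dgraph M" "src N = src M" "snk N = snk M"
    "\<forall>e\<in>parcs (dgraph N). capacity N e = capacity M e"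
proof -
  define n where "n = card (pverts (dgraph N))"
  have n: "n = card (pverts (dgraph M))" and s: "src N = src M" and t: "snk N = snk M"
    using eq unfolding encode_network_def Let_def n_def by simp_all
  have mat: "concat (map (\<lambda>u. map (\<lambda>v. arc_code N (u, v)) [0..<n]) [0..<n]) =
             concat (map (\<lambda>u. map (\<lambda>v. arc_code M (u, v)) [0..<n]) [0..<n])"
    using eq unfolding encode_network_def Let_def n[symmetric] n_def[symmetric] by simp
  have verts: "pverts (dgraph N) = {..<n}" "pverts (dgraph M) = {..<n}"
    using N M unfolding input_network_def n[symmetric] n_def[symmetric] by blast+
  have code: "arc_code N (u, v) = arc_code M (u, v)" if "u < n" "v < n" for u v
    using concat_map_eq_same_length[OF mat, of u] that by auto
  have wf: "e \<in> {..<n} \<times> {..<n}" if "e \<in> parcs (dgraph N) \<union> parcs (dgraph M)" for e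
  proof -
    have "pair_wf_digraph (dgraph N)" "pair_wf_digraph (dgraph M)"
      using N M
      unfolding input_network_def flow_network_def pair_digraph_def pair_fin_digraph_def by blast+
    then have "fst e \<in> {..<n} \<and> snd e \<in> {..<n}"
      using that pair_wf_digraph.arc_fst_in_verts[of "dgraph N" e]
        pair_wf_digraph.arc_snd_in_verts[of "dgraph N" e]
        pair_wf_digraph.arc_fst_in_verts[of "dgraph M" e]
        pair_wf_digraph.arc_snd_in_verts[of "dgraph M" e]
      unfolding verts by blast
    then show ?thesis by (simp add: mem_Times_iff)
  qed
  have code': "arc_code N e = arc_code M e" if "e \<in> parcs (dgraph N) \<union> parcs (dgraph M)" for e
    using wf[OF that] code by (cases e) auto
  have arcs: "parcs (dgraph N) = parcs (dgraph M)"
  proof (rule set_eqI)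
    fix e
    show "e \<in> parcs (dgraph N) \<longleftrightarrow> e \<in> parcs (dgraph M)"
      using code'[of e] by (auto simp: arc_code_def split: if_splits)
  qed
  show "dgraph N = dgraph M"
    using verts arcs by (intro pair_pre_digraph.equality) auto
  show "src N = src M" "snk N = snk M" by (fact s t)+
  show "\<forall>e\<in>parcs (dgraph N). capacity N e = capacity M e"
    using code' arcs by (auto simp: arc_code_def)
qed

end

theory Submission
  imports Defs "HOL-Library.Transitive_Closure_Table"
begin

text \<open>
  Call \<open>v \<noteq> t\<close> a cut vertex if every path from \<open>s\<close> to \<open>t\<close> contains it.  For \<open>k \<ge> 2\<close> the flow exists iff
  every \<open>s\<close>-\<open>t\<close>-cut has capacity at least \<open>k + 1\<close> and each cut vertex \<open>v\<close> has an arc \<open>vw\<close> of capacity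
  at least 2 such that two units can be sent from \<open>w\<close> to \<open>t\<close> without using \<open>v\<close>.  Sufficiency comes from
  the max-flow min-cut theorem in a network where each vertex that is not a cut vertex can carry only
  \<open>k\<close> units, whereas a cut vertex \<open>v\<close> passes two units directly to \<open>w\<close> and \<open>k - 1\<close> to its other arcs:
  each vertex left by a cut of this network through its own capacity contributes at least \<open>k - 1\<close>, and
  the conditions supply the missing two units.  For \<open>k = 1\<close> the flow exists iff \<open>t\<close> can be reached
  along arcs of capacity at least 2.

  For constant \<open>k\<close>, a cut has capacity more than \<open>k\<close> iff no deletion of \<open>k\<close> units of capacity
  disconnects it, and there are only polynomially many ways to choose \<open>k\<close> arcs.  Hence the criterion is
  a formula made of boolean connectives, quantifiers bounded by the length of the input, and
  reachability queries, and such formulas can be evaluated in polynomial time.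
\<close>

section \<open>Structured programs\<close>

text \<open>The obstacle is that an out-degree is not a capacity. A vertex that carries at most
  \<open>k\<close> units uses at most \<open>k\<close> arcs and is harmless. At a vertex that can be
  bypassed, one of the \<open>k + 1\<close> units may go around it; at a cut vertex all of them
  pass, so two must share an arc. Reserving one arc for such a pair and allowing
  \<open>k - 1\<close> further units turns the degree bound into ordinary capacities, to which the
  integrality of maximum flows applies. That all bypasses can be chosen simultaneously is what the
  estimate of the cuts shows. It needs \<open>k \<ge> 2\<close>: two cut vertices and one further
  unit give \<open>2 * (k - 1) + 1\<close>, which reaches \<open>k + 1\<close> only then.

  The procedure never computes a flow. Its cut conditions have the thresholds 1 and
  \<open>k\<close>, which do not depend on the input, so capacities written in binary are only
  compared with small numbers. Since it must also halt quickly on sequences that code no network,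
  its quantifiers range over positions of the input instead of vertices.\<close>

datatype cmd = Do instr | Seq cmd cmd (infixr ";;" 60) | If reg cmd cmd | While reg cmd

fun is_jump :: "instr \<Rightarrow> bool" where
  "is_jump (Jump _) = True"
| "is_jump (JumpZero _ _) = True"
| "is_jump _ = False"

text \<open>The number counts the instructions executed by the compiled code, whatever their cost. A
  taken branch adds the test and the jump over the other branch; a round of a loop adds the test and
  the jump back.\<close>

inductive big_step :: "nat list \<Rightarrow> cmd \<Rightarrow> memory \<Rightarrow> nat \<Rightarrow> memory \<Rightarrow> bool" for xs where
  Do: "\<not> is_jump i \<Longrightarrow> snd (exec_instr xs i (0, m)) = m' \<Longrightarrow> big_step xs (Do i) m 1 m'"
| Seq: "big_step xs c1 m T1 m1 \<Longrightarrow> big_step xs c2 m1 T2 m2 \<Longrightarrow> big_step xs (c1 ;; c2) m (T1 + T2) m2"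
| IfTrue: "m r \<noteq> 0 \<Longrightarrow> big_step xs c1 m T m' \<Longrightarrow> big_step xs (If r c1 c2) m (T + 2) m'"
| IfFalse: "m r = 0 \<Longrightarrow> big_step xs c2 m T m' \<Longrightarrow> big_step xs (If r c1 c2) m (T + 1) m'"
| WhileFalse: "m r = 0 \<Longrightarrow> big_step xs (While r c) m 1 m"
| WhileTrue: "m r \<noteq> 0 \<Longrightarrow> big_step xs c m T1 m1 \<Longrightarrow> big_step xs (While r c) m1 T2 m2 \<Longrightarrow>
    big_step xs (While r c) m (T1 + T2 + 2) m2"

text \<open>Jump targets are absolute, so compilation carries the address \<open>p\<close> at which
  the code will be placed.\<close>

fun code :: "nat \<Rightarrow> cmd \<Rightarrow> instr list" where
  "code p (Do i) = [i]"
| "code p (c1 ;; c2) = (let P1 = code p c1 in P1 @ code (p + length P1) c2)"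
| "code p (If r c1 c2) =
    (let P1 = code (p + 1) c1; q = p + length P1 + 2; P2 = code q c2
     in JumpZero r q # P1 @ Jump (q + length P2) # P2)"
| "code p (While r c) =
    (let P1 = code (p + 1) c in JumpZero r (p + length P1 + 2) # P1 @ [Jump p])"

text \<open>Unlike \<open>runs\<close>, such a run may stop anywhere, which makes runs composable,
  and it counts steps instead of costs.\<close>

inductive reaches :: "instr list \<Rightarrow> nat list \<Rightarrow> nat \<times> memory \<Rightarrow> nat \<Rightarrow> nat \<times> memory \<Rightarrow> bool"
  for P xs where
  stop: "reaches P xs c 0 c"
| continue: "pc < length P \<Longrightarrow> reaches P xs (exec_instr xs (P ! pc) (pc, m)) T c \<Longrightarrow>
    reaches P xs (pc, m) (Suc T) c"

lemma reaches_trans: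
  "reaches P xs c T c' \<Longrightarrow> reaches P xs c' T' c'' \<Longrightarrow> reaches P xs c (T + T') c''"
  by (induction rule: reaches.induct) (auto intro: reaches.continue)

lemma reaches_1:
  assumes "P ! pc = i" "pc < length P" "exec_instr xs i (pc, m) = c"
  shows "reaches P xs (pc, m) 1 c"
  using reaches.continue[of pc P xs m 0 c] reaches.stop[of P xs c] assms by simp

lemma exec_instr_not_jump:
  "\<not> is_jump i \<Longrightarrow> exec_instr xs i (pc, m) = (pc + 1, snd (exec_instr xs i (0, m)))"
  by (cases i) auto

text \<open>The surrounding code \<open>pre\<close> and \<open>post\<close> is arbitrary because the
  induction meets the code of a subcommand in the middle of the code of its command.\<close>

lemma big_step_reaches:
  assumes "big_step xs c m T m'" "P = pre @ code (length pre) c @ post"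
  shows "reaches P xs (length pre, m) T (length pre + length (code (length pre) c), m')"
  using assms
proof (induction arbitrary: pre post rule: big_step.induct)
  case (Do i m m')
  have P: "P = pre @ [i] @ post" using Do.prems unfolding code.simps .
  have "P ! length pre = i" unfolding P by simp
  have "length pre < length P" unfolding P by simp
  moreover have "exec_instr xs i (length pre, m) = (length pre + 1, m')"
    using Do.hyps exec_instr_not_jump by metis
  ultimately have "reaches P xs (length pre, m) 1 (length pre + 1, m')"
    using \<open>P ! length pre = i\<close> by (intro reaches_1)
  then show ?case unfolding code.simps by simp
next
  case (Seq c1 m T1 m1 c2 T2 m2)
  let ?P1 = "code (length pre) c1"
  let ?P2 = "code (length pre + length ?P1) c2"
  have "reaches P xs (length pre, m) T1 (length pre + length ?P1, m1)"
    by (rule Seq.IH(1)[of pre "?P2 @ post"]) (simp add: Seq.prems Let_def)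
  moreover have "reaches P xs (length pre + length ?P1, m1) T2
      (length pre + length ?P1 + length ?P2, m2)"
    by (rule Seq.IH(2)[of "pre @ ?P1" post, unfolded length_append]) (simp add: Seq.prems Let_def)
  ultimately have "reaches P xs (length pre, m) (T1 + T2) (length pre + length ?P1 + length ?P2, m2)"
    by (rule reaches_trans)
  then show ?case by (simp add: Let_def add.assoc)
next
  case (IfTrue m r c1 T m' c2)
  let ?P1 = "code (length pre + 1) c1"
  let ?q = "length pre + length ?P1 + 2"
  let ?P2 = "code ?q c2"
  have P: "P = (pre @ [JumpZero r ?q]) @ ?P1 @ (Jump (?q + length ?P2) # ?P2 @ post)"
    using IfTrue.prems by (simp add: Let_def)
  have 1: "reaches P xs (length pre, m) 1 (length pre + 1, m)"
    by (rule reaches_1[where i = "JumpZero r ?q"]) (use P IfTrue.hyps in \<open>auto simp: nth_append\<close>)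
  have l: "length (pre @ [JumpZero r ?q]) = length pre + 1" by simp
  have 2: "reaches P xs (length pre + 1, m) T (length pre + 1 + length ?P1, m')"
    using IfTrue.IH[of "pre @ [JumpZero r ?q]" "Jump (?q + length ?P2) # ?P2 @ post", unfolded l, OF P] .
  have 3: "reaches P xs (length pre + 1 + length ?P1, m') 1 (?q + length ?P2, m')"
    by (rule reaches_1[where i = "Jump (?q + length ?P2)"]) (use P in \<open>auto simp: nth_append\<close>)
  from reaches_trans[OF reaches_trans[OF 1 2] 3] show ?case
    by (simp add: Let_def add.assoc)
next
  case (IfFalse m r c2 T m' c1)
  let ?P1 = "code (length pre + 1) c1"
  let ?q = "length pre + length ?P1 + 2"
  let ?P2 = "code ?q c2"
  let ?pre = "pre @ JumpZero r ?q # ?P1 @ [Jump (?q + length ?P2)]"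
  have P: "P = ?pre @ ?P2 @ post"
    using IfFalse.prems by (simp add: Let_def)
  have 1: "reaches P xs (length pre, m) 1 (?q, m)"
    by (rule reaches_1[where i = "JumpZero r ?q"]) (use P IfFalse.hyps in \<open>auto simp: nth_append\<close>)
  have l: "length ?pre = ?q" by simp
  have 2: "reaches P xs (?q, m) T (?q + length ?P2, m')"
    using IfFalse.IH[of ?pre post, unfolded l, OF P] .
  from reaches_trans[OF 1 2] show ?case by (simp add: Let_def add.assoc)
next
  case (WhileFalse m r c)
  let ?q = "length pre + length (code (length pre + 1) c) + 2"
  have "reaches P xs (length pre, m) 1 (?q, m)"
    by (rule reaches_1[where i = "JumpZero r ?q"])
      (use WhileFalse in \<open>simp_all add: Let_def\<close>)
  then show ?case by (simp add: Let_def)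
next
  case (WhileTrue m r c T1 m1 T2 m2)
  let ?P1 = "code (length pre + 1) c"
  let ?q = "length pre + length ?P1 + 2"
  have P: "P = (pre @ [JumpZero r ?q]) @ ?P1 @ (Jump (length pre) # post)"
    using WhileTrue.prems by (simp add: Let_def)
  have 1: "reaches P xs (length pre, m) 1 (length pre + 1, m)"
    by (rule reaches_1[where i = "JumpZero r ?q"]) (use P WhileTrue.hyps in \<open>auto simp: nth_append\<close>)
  have l: "length (pre @ [JumpZero r ?q]) = length pre + 1" by simp
  have 2: "reaches P xs (length pre + 1, m) T1 (length pre + 1 + length ?P1, m1)"
    using WhileTrue.IH(1)[of "pre @ [JumpZero r ?q]" "Jump (length pre) # post", unfolded l, OF P] .
  have 3: "reaches P xs (length pre + 1 + length ?P1, m1) 1 (length pre, m1)"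
    by (rule reaches_1[where i = "Jump (length pre)"]) (use P in \<open>auto simp: nth_append\<close>)
  have 4: "reaches P xs (length pre, m1) T2 (length pre + length (code (length pre) (While r c)), m2)"
    using WhileTrue.IH(2)[OF WhileTrue.prems] .
  have "1 + T1 + 1 + T2 = T1 + T2 + 2" by simp
  with reaches_trans[OF reaches_trans[OF reaches_trans[OF 1 2] 3] 4] show ?case by metis
qed

subsection \<open>From the number of steps to the logarithmic cost\<close>

lemma nbits_le_iff: "b \<ge> 1 \<Longrightarrow> nbits v \<le> b \<longleftrightarrow> v < 2 ^ b"
proof -
  assume "b \<ge> 1"
  show ?thesis
  proof (cases "v = 0")
    case False
    have "2 ^ floor_log v \<le> v" "v < 2 ^ Suc (floor_log v)"
      using False floor_log_exp2_le floor_log_exp2_gt[of v] by auto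
    show ?thesis
    proof
      assume "nbits v \<le> b"
      then have "(2::nat) ^ Suc (floor_log v) \<le> 2 ^ b" by (intro power_increasing) (auto simp: nbits_def)
      with \<open>v < _\<close> show "v < 2 ^ b" by linarith
    next
      assume "v < 2 ^ b"
      with \<open>_ \<le> v\<close> have "(2::nat) ^ floor_log v < 2 ^ b" by linarith
      then show "nbits v \<le> b" by (simp add: nbits_def)
    qed
  qed (use \<open>b \<ge> 1\<close> in \<open>auto simp: nbits_def\<close>)
qed

fun operands :: "instr \<Rightarrow> nat list" where
  "operands (Const r n) = [r, n]"
| "operands (Copy r s) = [r, s]"
| "operands (Add r s t) = [r, s, t]"
| "operands (Sub r s t) = [r, s, t]"
| "operands (Load r s) = [r, s]"
| "operands (Store r s) = [r, s]"
| "operands (Read r s) = [r, s]"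
| "operands (Length r) = [r]"
| "operands (Jump l) = [l]"
| "operands (JumpZero r l) = [r, l]"

lemma instr_cost_le:
  assumes "b \<ge> 1" "\<And>i. m i < 2 ^ b" "\<And>n. n \<in> set (operands i) \<Longrightarrow> n < 2 ^ b"
    "\<And>i. input_at xs i < 2 ^ b" "length xs < 2 ^ b"
  shows "instr_cost xs i m \<le> 5 * b"
proof -
  have m: "nbits (m i) \<le> b" and x: "nbits (input_at xs i) \<le> b" and l: "nbits (length xs) \<le> b" for i
    using assms by (simp_all add: nbits_le_iff)
  have o: "nbits n \<le> b" if "n \<in> set (operands i)" for n
    using assms that by (simp add: nbits_le_iff)
  show ?thesis
  proof (cases i)
    case (Const r n) with o[of r] o[of n] show ?thesis by simp
  next
    case (Copy r s) with o[of r] o[of s] m[of s] show ?thesis by simp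
  next
    case (Add r s t) with o[of r] o[of s] o[of t] m[of s] m[of t] show ?thesis by simp
  next
    case (Sub r s t) with o[of r] o[of s] o[of t] m[of s] m[of t] show ?thesis by simp
  next
    case (Load r s) with o[of r] o[of s] m[of s] m[of "m s"] show ?thesis by simp
  next
    case (Store r s) with o[of r] o[of s] m[of s] m[of r] show ?thesis by simp
  next
    case (Read r s) with o[of r] o[of s] m[of s] x[of "m s"] show ?thesis by simp
  next
    case (Length r) with o[of r] l show ?thesis by simp
  next
    case (Jump l) with o[of l] show ?thesis by simp
  next
    case (JumpZero r l) with o[of l] o[of r] m[of r] show ?thesis by simp
  qed
qed

lemma exec_instr_bound:
  assumes "\<And>i. m i < 2 ^ b" "\<And>n. n \<in> set (operands i) \<Longrightarrow> n < 2 ^ b"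
    "\<And>i. input_at xs i < 2 ^ b" "length xs < 2 ^ b"
  shows "snd (exec_instr xs i (pc, m)) j < 2 ^ Suc b"
proof -
  have m: "m i < 2 * 2 ^ b" and x: "input_at xs i < 2 * 2 ^ b" and l: "length xs < 2 * 2 ^ b" for i
    using assms(1)[of i] assms(3)[of i] assms(4) by simp_all
  have o: "n < 2 * 2 ^ b" if "n \<in> set (operands i)" for n
    using assms(2)[OF that] by simp
  have a: "m i + m k < 2 * 2 ^ b" "m i - m k < 2 * 2 ^ b" for i k
    using assms(1)[of i] assms(1)[of k] by linarith+
  show ?thesis using m x l o a by (cases i) auto
qed

text \<open>Numbers below \<open>2 ^ b\<close> at the start are below \<open>2 ^ (b + i)\<close>
  after \<open>i\<close> steps, and a step then costs at most \<open>5 * (b + i)\<close>, as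
  \<open>instr_cost\<close> has at most five summands. Generalising over \<open>b\<close> absorbs
  the growth.\<close>

lemma reaches_runs:
  assumes "reaches P xs c T c'" "fst c' = length P"
    and "b \<ge> 1" "\<And>j. snd c j < 2 ^ b" "\<And>i n. i \<in> set P \<Longrightarrow> n \<in> set (operands i) \<Longrightarrow> n < 2 ^ b"
    "\<And>i. input_at xs i < 2 ^ b" "length xs < 2 ^ b"
  shows "\<exists>C. runs P xs c C (snd c') \<and> C \<le> T * (5 * (b + T))"
  using assms
proof (induction arbitrary: b rule: reaches.induct)
  case (stop c)
  then show ?case by (cases c) (auto intro: runs.halt)
next
  case (continue pc m T c)
  have m: "m j < 2 ^ b" for j using continue.prems(3)[of j] by simp
  have P: "n < 2 ^ b" if "n \<in> set (operands (P ! pc))" for n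
    using continue.prems(4)[OF nth_mem[OF continue.hyps(1)] that] .
  have lift: "(n::nat) < 2 ^ Suc b" if "n < 2 ^ b" for n using that by simp
  obtain C where C: "runs P xs (exec_instr xs (P ! pc) (pc, m)) C (snd c)"
    "C \<le> T * (5 * (Suc b + T))"
  proof -
    have "snd (exec_instr xs (P ! pc) (pc, m)) j < 2 ^ Suc b" for j
      by (rule exec_instr_bound) (use m P continue.prems(5,6) in auto)
    then have
      "\<exists>C. runs P xs (exec_instr xs (P ! pc) (pc, m)) C (snd c) \<and> C \<le> T * (5 * (Suc b + T))"
      using continue.prems lift by (intro continue.IH) (blast | simp)+
    with that show ?thesis by blast
  qed
  have "instr_cost xs (P ! pc) m \<le> 5 * b"
    by (rule instr_cost_le) (use continue.prems m P in auto)
  then have "instr_cost xs (P ! pc) m + C \<le> 5 * (Suc b + T) + T * (5 * (Suc b + T))"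
    using C(2) by (intro add_mono) simp_all
  also have "\<dots> = Suc T * (5 * (b + Suc T))" by simp
  finally show ?case using runs.step[OF continue.hyps(1) C(1)] by auto
qed

lemma nbits_ge_1: "nbits n \<ge> 1"
  by (simp add: nbits_def)

lemma length_le_input_size: "length xs \<le> input_size xs"
proof (induction xs)
  case (Cons a xs)
  then show ?case using nbits_ge_1[of a] by (simp add: input_size_def)
qed (simp add: input_size_def)

lemma nbits_le_input_size: "a \<in> set xs \<Longrightarrow> nbits a \<le> input_size xs"
  by (induction xs) (auto simp: input_size_def)

lemma input_at_less: "b \<ge> 1 \<Longrightarrow> b \<ge> input_size xs \<Longrightarrow> input_at xs i < 2 ^ b"
  using nbits_le_input_size[of "xs ! i" xs] nbits_le_iff[of b "xs ! i"]
  by (auto simp: input_at_def)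

text \<open>
  An instruction lengthens the largest number in memory by at most one bit, so a polynomial bound
  on the number of steps gives a polynomial bound on the cost.
\<close>

lemma polynomial_time_decidableI:
  assumes "\<And>xs. \<exists>T m. big_step xs c (\<lambda>_. 0) T m \<and> T \<le> (length xs + 2) ^ K \<and> (m 0 \<noteq> 0 \<longleftrightarrow> xs \<in> L)"
  shows "polynomial_time_decidable L"
proof -
  let ?P = "code 0 c"
  \<comment> \<open>The program is fixed, so the bit length of its operands is a constant; the sum
    of all operands serves as exponent because \<open>n < 2 ^ n\<close>.\<close>
  obtain B where B: "n < 2 ^ B" if "i \<in> set ?P" "n \<in> set (operands i)" for i n
  proof -
    have "n < 2 ^ (\<Sum>i\<in>set ?P. \<Sum>n\<in>set (operands i). n)"
      if "i \<in> set ?P" "n \<in> set (operands i)" for i n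
    proof -
      have "n \<le> (\<Sum>n\<in>set (operands i). n)" using that by (intro member_le_sum) auto
      also have "(\<Sum>n\<in>set (operands i). n) \<le> (\<Sum>i\<in>set ?P. \<Sum>n\<in>set (operands i). n)"
        using that(1) member_le_sum[of i "set ?P" "\<lambda>i. \<Sum>n\<in>set (operands i). n"] by simp
      finally show ?thesis using less_exp order_le_less_trans by blast
    qed
    then show ?thesis using that by blast
  qed
  define t :: "nat poly" where "t = [:2, 1:] ^ K"
  define p :: "nat poly" where "p = t * (5 * ([:1 + B, 1:] + t))"
  have "\<exists>T m. runs ?P xs (0, \<lambda>_. 0) T m \<and> T \<le> poly p (input_size xs) \<and> (m 0 \<noteq> 0 \<longleftrightarrow> xs \<in> L)" for xs
  proof -
    let ?n = "input_size xs"
    obtain T m where T: "big_step xs c (\<lambda>_. 0) T m" "T \<le> (length xs + 2) ^ K" "m 0 \<noteq> 0 \<longleftrightarrow> xs \<in> L"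
      using assms by blast
    define b where "b = 1 + B + ?n"
    have r: "reaches ?P xs (0, \<lambda>_. 0) T (length ?P, m)"
      using big_step_reaches[OF T(1), of ?P "[]" "[]"] by simp
    have "length xs < 2 ^ ?n" using length_le_input_size[of xs] less_exp[of ?n] by linarith
    moreover have "(2::nat) ^ ?n \<le> 2 ^ b" "(2::nat) ^ B \<le> 2 ^ b" by (rule power_increasing; simp add: b_def)+
    ultimately obtain C where C: "runs ?P xs (0, \<lambda>_. 0) C m" "C \<le> T * (5 * (b + T))"
      using reaches_runs[OF r, of b] B input_at_less[of b xs]
      by (fastforce simp: b_def dest: order_less_le_trans)
    have "T \<le> (?n + 2) ^ K"
      using T(2) length_le_input_size[of xs] power_mono[of "length xs + 2" "?n + 2" K] by linarith
    then have "T \<le> poly t ?n" by (simp add: t_def add.commute)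
    then have "T * (5 * (b + T)) \<le> poly t ?n * (5 * (b + poly t ?n))"
      by (intro mult_mono add_mono) auto
    also have "\<dots> = poly p ?n" by (simp add: p_def b_def algebra_simps)
    finally show ?thesis using C T(3) by (meson order_trans)
  qed
  then show ?thesis unfolding polynomial_time_decidable_def by blast
qed

section \<open>Functions computable in polynomially many steps\<close>

definition runs_to :: "nat list \<Rightarrow> cmd \<Rightarrow> memory \<Rightarrow> nat \<Rightarrow> (memory \<Rightarrow> bool) \<Rightarrow> bool" where
  "runs_to xs c m B Q \<longleftrightarrow> (\<exists>T m'. big_step xs c m T m' \<and> T \<le> B \<and> Q m')"

lemma runs_to_Do: "\<not> is_jump i \<Longrightarrow> Q (snd (exec_instr xs i (0, m))) \<Longrightarrow> runs_to xs (Do i) m 1 Q"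
  unfolding runs_to_def by (blast intro: big_step.Do)

lemma runs_to_Seq:
  assumes "runs_to xs c1 m B1 R" "\<And>m'. R m' \<Longrightarrow> runs_to xs c2 m' B2 Q"
  shows "runs_to xs (c1 ;; c2) m (B1 + B2) Q"
proof -
  obtain T1 m1 where 1: "big_step xs c1 m T1 m1" "T1 \<le> B1" "R m1"
    using assms(1) unfolding runs_to_def by blast
  obtain T2 m2 where 2: "big_step xs c2 m1 T2 m2" "T2 \<le> B2" "Q m2"
    using assms(2)[OF 1(3)] unfolding runs_to_def by blast
  show ?thesis unfolding runs_to_def
    using big_step.Seq[OF 1(1) 2(1)] 1(2) 2(2,3) add_mono by blast
qed

lemma runs_to_If:
  assumes "m r \<noteq> 0 \<Longrightarrow> runs_to xs c1 m B Q" "m r = 0 \<Longrightarrow> runs_to xs c2 m B Q"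
  shows "runs_to xs (If r c1 c2) m (B + 2) Q"
proof (cases "m r = 0")
  case True
  with assms(2) obtain T m' where "big_step xs c2 m T m'" "T \<le> B" "Q m'"
    unfolding runs_to_def by blast
  with big_step.IfFalse[OF True this(1), of c1] show ?thesis
    unfolding runs_to_def by (meson add_mono one_le_numeral)
next
  case False
  with assms(1) obtain T m' where "big_step xs c1 m T m'" "T \<le> B" "Q m'"
    unfolding runs_to_def by blast
  with big_step.IfTrue[OF False this(1), of c2] show ?thesis
    unfolding runs_to_def by (meson add_mono order_refl)
qed

lemma runs_to_weaken:
  "runs_to xs c m B Q \<Longrightarrow> B \<le> B' \<Longrightarrow> (\<And>m'. Q m' \<Longrightarrow> Q' m') \<Longrightarrow> runs_to xs c m B' Q'"
  unfolding runs_to_def by (meson order_trans)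

text \<open>The zero test is the only conditional of the machine, hence the loop counts down and the
  body sees the values from the length minus 1 to 0. Register \<open>2 * r + 2\<close> supplies the
  constant 1, so a loop occupies the variables \<open>r\<close> and \<open>r + 1\<close>.\<close>

definition For :: "nat \<Rightarrow> cmd \<Rightarrow> cmd" where
  "For r c = Do (Length (2 * r)) ;;
     While (2 * r) (Do (Const (2 * r + 2) 1) ;; Do (Sub (2 * r) (2 * r) (2 * r + 2)) ;; c)"

text \<open>\<open>I j\<close> is the invariant at counter value \<open>j\<close>;
  \<open>frame\<close> lets the loop use its own two registers. A round adds two instructions and
  two jumps to the body.\<close>

lemma runs_to_For:
  fixes I :: "nat \<Rightarrow> memory \<Rightarrow> bool"
  assumes start: "I (length xs) m0"
    and frame: "\<And>j m m'. I j m \<Longrightarrow> (\<And>a. a \<noteq> 2 * r \<Longrightarrow> a \<noteq> 2 * r + 2 \<Longrightarrow> m' a = m a) \<Longrightarrow> I j m'"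
    and body: "\<And>j m. j < length xs \<Longrightarrow> I (Suc j) m \<Longrightarrow> m (2 * r) = j \<Longrightarrow>
      runs_to xs c m B (\<lambda>m'. I j m' \<and> m' (2 * r) = j)"
  shows "runs_to xs (For r c) m0 (length xs * (B + 4) + 2) (I 0)"
proof -
  let ?b = "Do (Const (2 * r + 2) 1) ;; Do (Sub (2 * r) (2 * r) (2 * r + 2)) ;; c"
  have loop: "runs_to xs (While (2 * r) ?b) m (j * (B + 4) + 1) (I 0)"
    if "I j m" "m (2 * r) = j" "j \<le> length xs" for j m
    using that
  proof (induction j arbitrary: m)
    case 0
    then show ?case
      using big_step.WhileFalse[of m "2 * r" xs ?b] unfolding runs_to_def by force
  next
    case (Suc j)
    have "runs_to xs ?b m (1 + (1 + B)) (\<lambda>m'. I j m' \<and> m' (2 * r) = j)"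
    proof (intro runs_to_Seq runs_to_Do)
      fix m1 m2
      assume "m1 = snd (exec_instr xs (Const (2 * r + 2) 1) (0, m))"
        and "m2 = snd (exec_instr xs (Sub (2 * r) (2 * r) (2 * r + 2)) (0, m1))"
      then have m2: "m2 = m(2 * r + 2 := 1, 2 * r := j)" using Suc.prems(2) by auto
      show "runs_to xs c m2 B (\<lambda>m'. I j m' \<and> m' (2 * r) = j)"
        by (rule body) (use Suc.prems in \<open>auto simp: m2 intro: frame\<close>)
    qed auto
    then obtain T1 m1 where 1: "big_step xs ?b m T1 m1" "T1 \<le> B + 2" "I j m1" "m1 (2 * r) = j"
      unfolding runs_to_def by auto
    obtain T2 m2 where 2: "big_step xs (While (2 * r) ?b) m1 T2 m2" "T2 \<le> j * (B + 4) + 1" "I 0 m2"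
      using Suc.IH[OF 1(3,4)] Suc.prems(3) unfolding runs_to_def by auto
    have "big_step xs (While (2 * r) ?b) m (T1 + T2 + 2) m2"
      using big_step.WhileTrue[OF _ 1(1) 2(1)] Suc.prems(2) by simp
    moreover have "T1 + T2 + 2 \<le> Suc j * (B + 4) + 1" using 1(2) 2(2) by simp
    ultimately show ?case using 2(3) unfolding runs_to_def by blast
  qed
  have "runs_to xs (For r c) m0 (1 + (length xs * (B + 4) + 1)) (I 0)"
    unfolding For_def
  proof (rule runs_to_Seq[OF runs_to_Do])
    fix m assume "m = snd (exec_instr xs (Length (2 * r)) (0, m0))"
    then show "runs_to xs (While (2 * r) ?b) m (length xs * (B + 4) + 1) (I 0)"
      by (intro loop) (auto intro: frame[OF start])
  qed auto
  then show ?thesis by (rule runs_to_weaken) auto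
qed

text \<open>The base is at least 2 even on the empty input, so a single power absorbs constants, and
  a sum costs just one more factor.\<close>

definition poly_bounded :: "(nat \<Rightarrow> nat) \<Rightarrow> bool" where
  "poly_bounded B \<longleftrightarrow> (\<exists>K. \<forall>n. B n \<le> (n + 2) ^ K)"

lemma poly_bounded_const: "poly_bounded (\<lambda>_. c)"
proof -
  have "c \<le> (n + 2) ^ c" for n :: nat
  proof -
    have "c < 2 ^ c" by (rule less_exp)
    also have "\<dots> \<le> (n + 2) ^ c" by (rule power_mono) auto
    finally show ?thesis by simp
  qed
  then show ?thesis unfolding poly_bounded_def by blast
qed

lemma poly_bounded_id: "poly_bounded (\<lambda>n. n)"
  unfolding poly_bounded_def by (intro exI[of _ 1]) auto

lemma poly_bounded_mult: "poly_bounded A \<Longrightarrow> poly_bounded B \<Longrightarrow> poly_bounded (\<lambda>n. A n * B n)"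
  unfolding poly_bounded_def by (metis mult_le_mono power_add)

lemma poly_bounded_add:
  assumes "poly_bounded A" "poly_bounded B"
  shows "poly_bounded (\<lambda>n. A n + B n)"
proof -
  obtain i j where A: "A n \<le> (n + 2) ^ i" and B: "B n \<le> (n + 2) ^ j" for n
    using assms unfolding poly_bounded_def by blast
  have "A n + B n \<le> (n + 2) ^ (i + j + 1)" for n
  proof -
    have "(n + 2) ^ i \<le> (n + 2) ^ (i + j)" "(n + 2) ^ j \<le> (n + 2) ^ (i + j)"
      by (intro power_increasing; simp)+
    then have "A n + B n \<le> 2 * (n + 2) ^ (i + j)" using A[of n] B[of n] by linarith
    also have "\<dots> \<le> (n + 2) * (n + 2) ^ (i + j)" by (intro mult_right_mono) auto
    finally show ?thesis by simp
  qed
  then show ?thesis unfolding poly_bounded_def by blast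
qed

lemmas poly_bounded_intros =
  poly_bounded_const poly_bounded_id poly_bounded_add poly_bounded_mult

section \<open>Expressions and formulas evaluated in polynomial time\<close>

text \<open>
  Variable \<open>i\<close> is kept in the register with address \<open>2 * i\<close>; the odd addresses hold an array, which
  only \<open>computable_pred_reachable\<close> uses.  Code of depth \<open>d\<close> must preserve the variables below \<open>d\<close> and
  leaves its result in variable \<open>d\<close>; the flag \<open>b\<close> says whether it may change the array.
\<close>

definition agree :: "bool \<Rightarrow> nat \<Rightarrow> memory \<Rightarrow> memory \<Rightarrow> bool" where
  "agree b d m m' \<longleftrightarrow> (\<forall>i<d. m' (2 * i) = m (2 * i)) \<and> (b \<or> (\<forall>i. m' (2 * i + 1) = m (2 * i + 1)))"

definition computes ::
  "bool \<Rightarrow> nat \<Rightarrow> (nat list \<Rightarrow> (nat \<Rightarrow> nat) \<Rightarrow> nat) \<Rightarrow> cmd \<Rightarrow> (nat \<Rightarrow> nat) \<Rightarrow> bool" where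
  "computes b d f c B \<longleftrightarrow> (\<forall>xs m. runs_to xs c m (B (length xs))
     (\<lambda>m'. agree b d m m' \<and> m' (2 * d) = f xs (\<lambda>i. m (2 * i))))"

text \<open>\<open>d0\<close> bounds the variables that \<open>f\<close> reads. Demanding code at
  every depth from \<open>d0\<close> on allows subexpressions to be evaluated above the intermediate
  results of the enclosing expression.\<close>

definition computable :: "bool \<Rightarrow> (nat list \<Rightarrow> (nat \<Rightarrow> nat) \<Rightarrow> nat) \<Rightarrow> bool" where
  "computable b f \<longleftrightarrow> (\<exists>d0. (\<forall>xs e e'. (\<forall>i<d0. e i = e' i) \<longrightarrow> f xs e = f xs e') \<and>
     (\<forall>d\<ge>d0. \<exists>c B. poly_bounded B \<and> computes b d f c B))"

abbreviation computable_pred :: "bool \<Rightarrow> (nat list \<Rightarrow> (nat \<Rightarrow> nat) \<Rightarrow> bool) \<Rightarrow> bool" where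
  "computable_pred b P \<equiv> computable b (\<lambda>xs e. of_bool (P xs e))"

lemma odd_neq_even [simp]: "Suc (2 * i) \<noteq> 2 * j" "2 * j \<noteq> Suc (2 * i)"
  by presburger+

lemma agree_refl: "agree b d m m"
  by (simp add: agree_def)

lemma agree_trans: "agree b d m m' \<Longrightarrow> agree b d' m' m'' \<Longrightarrow> d \<le> d' \<Longrightarrow> agree b d m m''"
  by (auto simp: agree_def)

lemma agree_upd: "agree b d m m' \<Longrightarrow> agree b d m (m'(2 * d := x))"
  by (auto simp: agree_def)

lemma computesD:
  "computes b d f c B \<Longrightarrow> runs_to xs c m (B (length xs))
     (\<lambda>m'. agree b d m m' \<and> m' (2 * d) = f xs (\<lambda>i. m (2 * i)))"
  by (simp add: computes_def)

lemma computable_simple: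
  assumes "\<And>xs e e'. (\<And>i. i < d0 \<Longrightarrow> e i = e' i) \<Longrightarrow> f xs e = f xs e'"
    and "\<And>d. \<not> is_jump (ins d)"
    and "\<And>xs d m. snd (exec_instr xs (ins d) (0, m)) = m(2 * d := f xs (\<lambda>i. m (2 * i)))"
  shows "computable b f"
  unfolding computable_def
proof (intro exI[of _ d0] conjI allI impI)
  fix d
  have "computes b d f (Do (ins d)) (\<lambda>_. 1)"
    unfolding computes_def
    by (intro allI runs_to_Do assms(2)) (simp add: assms(3) agree_upd[OF agree_refl])
  then show "\<exists>c B. poly_bounded B \<and> computes b d f c B"
    using poly_bounded_const by blast
next
  fix xs and e e' :: "nat \<Rightarrow> nat"
  assume "\<forall>i<d0. e i = e' i"
  then show "f xs e = f xs e'" by (intro assms(1)) simp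
qed

lemma computable_const: "computable b (\<lambda>xs e. n)"
  by (rule computable_simple[of 0 _ "\<lambda>d. Const (2 * d) n"]) auto

lemma computable_var: "computable b (\<lambda>xs e. e v)"
  by (rule computable_simple[of "Suc v" _ "\<lambda>d. Copy (2 * d) (2 * v)"]) auto

lemma computable_length: "computable b (\<lambda>xs e. length xs)"
  by (rule computable_simple[of 0 _ "\<lambda>d. Length (2 * d)"]) auto

lemma computable_read:
  assumes "computable b f"
  shows "computable b (\<lambda>xs e. input_at xs (f xs e))"
proof -
  obtain d0 where d0: "\<And>xs e e'. (\<forall>i<d0. e i = e' i) \<Longrightarrow> f xs e = f xs e'"
    "\<And>d. d \<ge> d0 \<Longrightarrow> \<exists>c B. poly_bounded B \<and> computes b d f c B"
    using assms unfolding computable_def by blast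
  have "\<exists>c B. poly_bounded B \<and> computes b d (\<lambda>xs e. input_at xs (f xs e)) c B" if "d \<ge> d0" for d
  proof -
    obtain c B where c: "poly_bounded B" "computes b d f c B" using d0(2) \<open>d \<ge> d0\<close> by blast
    have "computes b d (\<lambda>xs e. input_at xs (f xs e)) (c ;; Do (Read (2 * d) (2 * d))) (\<lambda>n. B n + 1)"
      unfolding computes_def
      by (intro allI, rule runs_to_Seq[OF computesD[OF c(2)]], rule runs_to_Do)
        (auto intro: agree_upd)
    then show ?thesis using c(1) poly_bounded_intros by blast
  qed
  moreover have "input_at xs (f xs e) = input_at xs (f xs e')" if "\<forall>i<d0. e i = e' i" for xs e e'
    using d0(1)[OF that] by simp
  ultimately show ?thesis unfolding computable_def by blast
qed

lemma computable_binary: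
  assumes f: "computable b f" and g: "computable b g"
    and ins: "\<And>x y z. \<not> is_jump (ins x y z)"
      "\<And>xs x y z m. snd (exec_instr xs (ins x y z) (0, m)) = m(x := h (m y) (m z))"
  shows "computable b (\<lambda>xs e. h (f xs e) (g xs e))"
proof -
  obtain d1 where d1: "\<And>xs e e'. (\<forall>i<d1. e i = e' i) \<Longrightarrow> f xs e = f xs e'"
    "\<And>d. d \<ge> d1 \<Longrightarrow> \<exists>c B. poly_bounded B \<and> computes b d f c B"
    using f unfolding computable_def by blast
  obtain d2 where d2: "\<And>xs e e'. (\<forall>i<d2. e i = e' i) \<Longrightarrow> g xs e = g xs e'"
    "\<And>d. d \<ge> d2 \<Longrightarrow> \<exists>c B. poly_bounded B \<and> computes b d g c B"
    using g unfolding computable_def by blast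
  define d0 where "d0 = max d1 d2"
  have "\<exists>c B. poly_bounded B \<and> computes b d (\<lambda>xs e. h (f xs e) (g xs e)) c B" if "d \<ge> d0" for d
  proof -
    have d: "d1 \<le> d" "d2 \<le> d" "d2 \<le> Suc d" using that by (auto simp: d0_def)
    obtain c1 B1 where 1: "poly_bounded B1" "computes b d f c1 B1" using d1(2) d by blast
    \<comment> \<open>Depth \<open>Suc d\<close> makes \<open>c2\<close> preserve the value of
      \<open>f\<close> in variable \<open>d\<close>.\<close>
    obtain c2 B2 where 2: "poly_bounded B2" "computes b (Suc d) g c2 B2" using d2(2) d by blast
    have "computes b d (\<lambda>xs e. h (f xs e) (g xs e))
        (c1 ;; c2 ;; Do (ins (2 * d) (2 * d) (2 * Suc d))) (\<lambda>n. B1 n + (B2 n + 1))"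
      unfolding computes_def
    proof (intro allI, rule runs_to_Seq[OF computesD[OF 1(2)]],
        rule runs_to_Seq[OF computesD[OF 2(2)]], rule runs_to_Do[OF ins(1)])
      fix xs m m1 m2
      assume m1: "agree b d m m1 \<and> m1 (2 * d) = f xs (\<lambda>i. m (2 * i))"
        and m2: "agree b (Suc d) m1 m2 \<and> m2 (2 * Suc d) = g xs (\<lambda>i. m1 (2 * i))"
      have "g xs (\<lambda>i. m1 (2 * i)) = g xs (\<lambda>i. m (2 * i))"
        using m1 d by (intro d2(1)) (auto simp: agree_def)
      moreover have "m2 (2 * d) = m1 (2 * d)" using m2 by (auto simp: agree_def)
      moreover have "agree b d m m2" using m1 m2 by (auto intro: agree_trans)
      ultimately show "agree b d m (snd (exec_instr xs (ins (2 * d) (2 * d) (2 * Suc d)) (0, m2))) \<and>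
          snd (exec_instr xs (ins (2 * d) (2 * d) (2 * Suc d)) (0, m2)) (2 * d) =
          h (f xs (\<lambda>i. m (2 * i))) (g xs (\<lambda>i. m (2 * i)))"
        using m1 m2 by (auto simp: ins(2) intro: agree_upd)
    qed
    moreover have "poly_bounded (\<lambda>n. B1 n + (B2 n + 1))" using 1 2 by (intro poly_bounded_intros)
    ultimately show ?thesis by blast
  qed
  moreover have "h (f xs e) (g xs e) = h (f xs e') (g xs e')" if "\<forall>i<d0. e i = e' i" for xs e e'
    using d1(1)[of e e' xs] d2(1)[of e e' xs] that by (auto simp: d0_def)
  ultimately show ?thesis unfolding computable_def by blast
qed

lemma computable_add: "computable b f \<Longrightarrow> computable b g \<Longrightarrow> computable b (\<lambda>xs e. f xs e + g xs e)"
  by (rule computable_binary[where ins = Add]) auto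

lemma computable_diff: "computable b f \<Longrightarrow> computable b g \<Longrightarrow> computable b (\<lambda>xs e. f xs e - g xs e)"
  by (rule computable_binary[where ins = Sub]) auto

lemma computable_if:
  assumes p: "computable b p" and f: "computable b f" and g: "computable b g"
  shows "computable b (\<lambda>xs e. if p xs e \<noteq> 0 then f xs e else g xs e)"
proof -
  obtain d1 where d1: "\<And>xs e e'. (\<forall>i<d1. e i = e' i) \<Longrightarrow> f xs e = f xs e'"
    "\<And>d. d \<ge> d1 \<Longrightarrow> \<exists>c B. poly_bounded B \<and> computes b d f c B"
    using f unfolding computable_def by blast
  obtain d2 where d2: "\<And>xs e e'. (\<forall>i<d2. e i = e' i) \<Longrightarrow> g xs e = g xs e'"
    "\<And>d. d \<ge> d2 \<Longrightarrow> \<exists>c B. poly_bounded B \<and> computes b d g c B"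
    using g unfolding computable_def by blast
  obtain d3 where d3: "\<And>xs e e'. (\<forall>i<d3. e i = e' i) \<Longrightarrow> p xs e = p xs e'"
    "\<And>d. d \<ge> d3 \<Longrightarrow> \<exists>c B. poly_bounded B \<and> computes b d p c B"
    using p unfolding computable_def by blast
  define d0 where "d0 = max d1 (max d2 d3)"
  let ?h = "\<lambda>xs e. if p xs e \<noteq> 0 then f xs e else g xs e"
  have "\<exists>c B. poly_bounded B \<and> computes b d ?h c B" if "d \<ge> d0" for d
  proof -
    have d: "d1 \<le> d" "d2 \<le> d" "d3 \<le> d" using that by (auto simp: d0_def)
    obtain c1 B1 where 1: "poly_bounded B1" "computes b d f c1 B1" using d1(2) d by blast
    obtain c2 B2 where 2: "poly_bounded B2" "computes b d g c2 B2" using d2(2) d by blast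
    obtain c3 B3 where 3: "poly_bounded B3" "computes b d p c3 B3" using d3(2) d by blast
    have "computes b d ?h (c3 ;; If (2 * d) c1 c2) (\<lambda>n. B3 n + (B1 n + B2 n + 2))"
      unfolding computes_def
    proof (intro allI, rule runs_to_Seq[OF computesD[OF 3(2)]], rule runs_to_If)
      fix xs m m1
      assume m1: "agree b d m m1 \<and> m1 (2 * d) = p xs (\<lambda>i. m (2 * i))"
      have eq: "f xs (\<lambda>i. m1 (2 * i)) = f xs (\<lambda>i. m (2 * i))"
        "g xs (\<lambda>i. m1 (2 * i)) = g xs (\<lambda>i. m (2 * i))"
        using m1 d by (auto simp: agree_def intro!: d1(1) d2(1))
      let ?Q = "\<lambda>m'. agree b d m m' \<and> m' (2 * d) = ?h xs (\<lambda>i. m (2 * i))"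
      show "runs_to xs c1 m1 (B1 (length xs) + B2 (length xs)) ?Q" if "m1 (2 * d) \<noteq> 0"
        by (rule runs_to_weaken[OF computesD[OF 1(2)]])
          (use m1 that eq in \<open>auto intro: agree_trans\<close>)
      show "runs_to xs c2 m1 (B1 (length xs) + B2 (length xs)) ?Q" if "m1 (2 * d) = 0"
        by (rule runs_to_weaken[OF computesD[OF 2(2)]])
          (use m1 that eq in \<open>auto intro: agree_trans\<close>)
    qed
    moreover have "poly_bounded (\<lambda>n. B3 n + (B1 n + B2 n + 2))" using 1 2 3 by (intro poly_bounded_intros)
    ultimately show ?thesis by blast
  qed
  moreover have "?h xs e = ?h xs e'" if "\<forall>i<d0. e i = e' i" for xs e e'
    using d1(1)[of e e' xs] d2(1)[of e e' xs] d3(1)[of e e' xs] that by (auto simp: d0_def)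
  ultimately show ?thesis unfolding computable_def by blast
qed

text \<open>The loop overwrites variable \<open>v\<close>, whose value is kept in variable
  \<open>d + 1\<close> and restored at the end. Variable \<open>d\<close> accumulates the sum,
  \<open>d + 2\<close> is the counter, and \<open>f\<close> is evaluated at depth
  \<open>d + 3\<close>, where the loop has only its scratch register.\<close>

lemma computable_sum:
  assumes "computable b f"
  shows "computable b (\<lambda>xs e. \<Sum>i<length xs. f xs (e(v := i)))"
proof -
  obtain d1 where d1: "\<And>xs e e'. (\<forall>i<d1. e i = e' i) \<Longrightarrow> f xs e = f xs e'"
    "\<And>d. d \<ge> d1 \<Longrightarrow> \<exists>c B. poly_bounded B \<and> computes b d f c B"
    using assms unfolding computable_def by blast
  define d0 where "d0 = max d1 (Suc v)"
  let ?h = "\<lambda>xs e. \<Sum>i<length xs. f xs (e(v := i))"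
  have "\<exists>c B. poly_bounded B \<and> computes b d ?h c B" if "d \<ge> d0" for d
  proof -
    have d: "d1 \<le> d" "d1 \<le> d + 3" "v < d" using that by (auto simp: d0_def)
    obtain c1 B1 where 1: "poly_bounded B1" "computes b (d + 3) f c1 B1" using d1(2) d by blast
    let ?body = "Do (Copy (2 * v) (2 * (d + 2))) ;; c1 ;; Do (Add (2 * d) (2 * d) (2 * (d + 3)))"
    let ?c = "Do (Const (2 * d) 0) ;; Do (Copy (2 * (d + 1)) (2 * v)) ;; For (d + 2) ?body ;;
      Do (Copy (2 * v) (2 * (d + 1)))"
    let ?B = "\<lambda>n. 1 + (1 + (n * (1 + (B1 n + 1) + 4) + 2 + 1))"
    have "computes b d ?h ?c ?B"
      unfolding computes_def
    proof (intro allI)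
      fix xs and m :: memory
      let ?e = "\<lambda>i. m (2 * i)"
      \<comment> \<open>As the counter runs down, the summands from \<open>j\<close> on have been
        added.\<close>
      define I where "I j m' \<longleftrightarrow> (\<forall>i<d. i \<noteq> v \<longrightarrow> m' (2 * i) = m (2 * i)) \<and>
        (b \<or> (\<forall>i. m' (2 * i + 1) = m (2 * i + 1))) \<and> m' (2 * (d + 1)) = m (2 * v) \<and>
        m' (2 * d) = (\<Sum>i\<in>{j..<length xs}. f xs (?e(v := i)))" for j and m' :: memory
      have loop: "runs_to xs (For (d + 2) ?body) m0 (length xs * (1 + (B1 (length xs) + 1) + 4) + 2) (I 0)"
        if "I (length xs) m0" for m0
      proof (rule runs_to_For[where I = I])
        show "I (length xs) m0" by (fact that)
      next
        fix j m1 m2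
        assume I: "I j m1" and eq: "\<And>a. a \<noteq> 2 * (d + 2) \<Longrightarrow> a \<noteq> 2 * (d + 2) + 2 \<Longrightarrow> m2 a = m1 a"
        have "m2 (2 * i) = m1 (2 * i)" if "i < d" for i using that by (intro eq) auto
        moreover have "m2 (2 * i + 1) = m1 (2 * i + 1)" for i by (intro eq) presburger+
        moreover have "m2 (2 * d) = m1 (2 * d)" "m2 (2 * (d + 1)) = m1 (2 * (d + 1))" by (intro eq; simp)+
        ultimately show "I j m2" using I unfolding I_def by simp
      next
        fix j m1
        assume j: "j < length xs" and I: "I (Suc j) m1" and r: "m1 (2 * (d + 2)) = j"
        show "runs_to xs ?body m1 (1 + (B1 (length xs) + 1)) (\<lambda>m'. I j m' \<and> m' (2 * (d + 2)) = j)"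
        proof (rule runs_to_Seq[OF runs_to_Do[where Q = "\<lambda>m'. m' = m1(2 * v := j)"]],
            simp, use r in simp, rule runs_to_Seq[OF computesD[OF 1(2)]], rule runs_to_Do, simp)
          fix m2 m3
          assume m2: "m2 = m1(2 * v := j)"
            and m3: "agree b (d + 3) m2 m3 \<and> m3 (2 * (d + 3)) = f xs (\<lambda>i. m2 (2 * i))"
          have "f xs (\<lambda>i. m2 (2 * i)) = f xs (?e(v := j))"
            using I d by (intro d1(1)) (auto simp: m2 I_def)
          then have f: "m3 (2 * (d + 3)) = f xs (?e(v := j))" using m3 by simp
          have low: "m3 (2 * i) = m2 (2 * i)" if "i < d + 3" for i
            using m3 that by (auto simp: agree_def)
          have regs: "m3 (2 * d) = m1 (2 * d)" "m3 (2 * (d + 1)) = m1 (2 * (d + 1))" "m3 (2 * (d + 2)) = j"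
            using low[of d] low[of "d + 1"] low[of "d + 2"] \<open>v < d\<close> r by (simp_all add: m2)
          have vars: "m3 (2 * i) = m (2 * i)" if "i < d" "i \<noteq> v" for i
            using low[of i] that I by (simp add: m2 I_def)
          have arr: "b \<or> (\<forall>i. m3 (2 * i + 1) = m (2 * i + 1))"
          proof -
            have "m2 (2 * i + 1) = m1 (2 * i + 1)" for i by (simp add: m2)
            then show ?thesis using m3 I by (auto simp: agree_def I_def)
          qed
          have "{j..<length xs} = insert j {Suc j..<length xs}" using j by auto
          then have "m3 (2 * d) + m3 (2 * (d + 3)) = (\<Sum>i\<in>{j..<length xs}. f xs (?e(v := i)))"
            using I f regs(1) by (simp add: I_def)
          then show "(\<lambda>m'. I j m' \<and> m' (2 * (d + 2)) = j)
              (snd (exec_instr xs (Add (2 * d) (2 * d) (2 * (d + 3))) (0, m3)))"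
            using I regs vars arr by (simp add: I_def)
        qed
      qed
      let ?Q = "\<lambda>m'. agree b d m m' \<and> m' (2 * d) = ?h xs ?e"
      have fin: "runs_to xs (Do (Copy (2 * v) (2 * (d + 1)))) m1 1 ?Q" if "I 0 m1" for m1
        by (rule runs_to_Do)
          (use that \<open>v < d\<close> in \<open>auto simp: I_def agree_def lessThan_atLeast0\<close>)
      show "runs_to xs ?c m (?B (length xs)) ?Q"
      proof (rule runs_to_Seq[OF runs_to_Do[where Q = "\<lambda>m'. m' = m(2 * d := 0)"]])
        fix m1 assume m1: "m1 = m(2 * d := 0)"
        let ?L = "length xs * (1 + (B1 (length xs) + 1) + 4) + 2"
        show "runs_to xs (Do (Copy (2 * (d + 1)) (2 * v)) ;; For (d + 2) ?body ;;
            Do (Copy (2 * v) (2 * (d + 1)))) m1 (1 + (?L + 1)) ?Q"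
        proof (rule runs_to_Seq[OF runs_to_Do[where Q = "I (length xs)"]])
          show "I (length xs) (snd (exec_instr xs (Copy (2 * (d + 1)) (2 * v)) (0, m1)))"
            using \<open>v < d\<close> by (auto simp: I_def m1)
          fix m2 assume "I (length xs) m2"
          then show "runs_to xs (For (d + 2) ?body ;; Do (Copy (2 * v) (2 * (d + 1)))) m2 (?L + 1) ?Q"
            by (intro runs_to_Seq[OF loop fin])
        qed simp
      qed simp_all
    qed
    moreover have "poly_bounded ?B" using 1 by (intro poly_bounded_intros)
    ultimately show ?thesis by blast
  qed
  moreover have "?h xs e = ?h xs e'" if "\<forall>i<d0. e i = e' i" for xs e e'
    using that by (intro sum.cong refl d1(1)) (auto simp: d0_def)
  ultimately show ?thesis unfolding computable_def by blast
qed

lemma computable_cong: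
  assumes "computable b f" "\<And>xs e. f xs e = g xs e"
  shows "computable b g"
proof -
  have "f = g" using assms(2) by (intro ext)
  with assms(1) show ?thesis by simp
qed

lemma computable_pred_not: "computable_pred b P \<Longrightarrow> computable_pred b (\<lambda>xs e. \<not> P xs e)"
  by (rule computable_cong[OF computable_diff[OF computable_const[of b 1]]]) auto

lemma computable_pred_and:
  assumes "computable_pred b P" "computable_pred b Q"
  shows "computable_pred b (\<lambda>xs e. P xs e \<and> Q xs e)"
  by (rule computable_cong[OF computable_if[OF assms computable_const[of b 0]]]) auto

lemma computable_pred_imp:
  assumes "computable_pred b P" "computable_pred b Q"
  shows "computable_pred b (\<lambda>xs e. P xs e \<longrightarrow> Q xs e)"
  by (rule computable_cong[OF computable_if[OF assms computable_const[of b 1]]]) auto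

text \<open>The witnesses are counted, and the count is tested for zero.\<close>

lemma computable_pred_ex:
  assumes "computable_pred b P"
  shows "computable_pred b (\<lambda>xs e. \<exists>i<length xs. P xs (e(v := i)))"
  by (rule computable_cong[OF computable_if[OF computable_sum[OF assms] computable_const[of b 1]
      computable_const[of b 0]]]) auto

lemma computable_pred_all:
  assumes "computable_pred b P"
  shows "computable_pred b (\<lambda>xs e. \<forall>i<length xs. P xs (e(v := i)))"
  by (rule computable_cong[OF computable_pred_not[OF computable_pred_ex[OF
      computable_pred_not[OF assms]]]]) auto

text \<open>The truncated difference \<open>g - f\<close> is nonzero exactly in this case.\<close>

lemma computable_pred_less:
  assumes "computable b f" "computable b g"
  shows "computable_pred b (\<lambda>xs e. f xs e < g xs e)"
  by (rule computable_cong[OF computable_if[OF computable_diff[OF assms(2,1)] computable_const[of b 1]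
      computable_const[of b 0]]]) auto

lemma computable_pred_eq:
  assumes "computable b f" "computable b g"
  shows "computable_pred b (\<lambda>xs e. f xs e = g xs e)"
  by (rule computable_cong[OF computable_pred_and[OF
      computable_pred_not[OF computable_pred_less[OF assms]]
      computable_pred_not[OF computable_pred_less[OF assms(2,1)]]]]) auto

text \<open>Multiplication by repeated addition; the number of rounds cannot exceed the length of the input.\<close>

lemma computable_mult:
  assumes "computable b f" "computable b g"
  shows "computable b (\<lambda>xs e. min (length xs) (f xs e) * g xs e)"
proof -
  obtain d1 d2 where d: "\<And>xs e e'. (\<forall>i<d1. e i = e' i) \<Longrightarrow> f xs e = f xs e'"
    "\<And>xs e e'. (\<forall>i<d2. e i = e' i) \<Longrightarrow> g xs e = g xs e'"
    using assms unfolding computable_def by metis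
  \<comment> \<open>Neither \<open>f\<close> nor \<open>g\<close> reads \<open>v\<close>, so it can
    serve as loop variable.\<close>
  define v where "v = max d1 d2"
  have v: "f xs (e(v := i)) = f xs e" "g xs (e(v := i)) = g xs e" for xs e i
    by (rule d; simp add: v_def)+
  have "computable b (\<lambda>xs e. \<Sum>i<length xs.
      if of_bool ((e(v := i)) v < f xs (e(v := i))) \<noteq> (0::nat) then g xs (e(v := i)) else 0)"
    by (intro computable_sum computable_if computable_pred_less computable_var computable_const assms)
  moreover have "(\<Sum>i<L. if of_bool (i < a) \<noteq> (0::nat) then c else 0) = min L a * c" for L a c :: nat
    by (induction L) (auto simp: min_def)
  ultimately show ?thesis by (simp add: v cong: if_cong)
qed

section \<open>Graph search with an array of marks\<close>

definition array_set :: "nat \<Rightarrow> nat \<Rightarrow> nat \<Rightarrow> cmd" where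
  "array_set x n s = Do (Add (2 * s) (2 * x) (2 * x)) ;; Do (Const (2 * s + 2) 1) ;;
     Do (Add (2 * s) (2 * s) (2 * s + 2)) ;; Do (Const (2 * s + 2) n) ;; Do (Store (2 * s) (2 * s + 2))"

definition array_get :: "nat \<Rightarrow> nat \<Rightarrow> cmd" where
  "array_get x s = Do (Add (2 * s) (2 * x) (2 * x)) ;; Do (Const (2 * s + 2) 1) ;;
     Do (Add (2 * s) (2 * s) (2 * s + 2)) ;; Do (Load (2 * s) (2 * s))"

lemma runs_to_chain:
  assumes "\<not> is_jump i" "runs_to xs c (snd (exec_instr xs i (0, m))) B Q"
  shows "runs_to xs (Do i ;; c) m (1 + B) Q"
  by (rule runs_to_Seq[OF runs_to_Do[where Q = "\<lambda>m'. m' = snd (exec_instr xs i (0, m))"]])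
    (use assms in auto)

lemma runs_to_array_set:
  assumes "x < s" "Q (m(2 * s := 2 * m (2 * x) + 1, 2 * s + 2 := n, 2 * m (2 * x) + 1 := n))"
  shows "runs_to xs (array_set x n s) m 5 Q"
proof -
  have "runs_to xs (array_set x n s) m (1 + (1 + (1 + (1 + 1)))) Q"
    unfolding array_set_def
    by (intro runs_to_chain runs_to_Do) (use assms in \<open>auto simp: mult_2[symmetric] fun_upd_twist\<close>)
  then show ?thesis by (rule runs_to_weaken) auto
qed

lemma runs_to_array_get:
  assumes "x < s" "Q (m(2 * s + 2 := 1, 2 * s := m (2 * m (2 * x) + 1)))"
  shows "runs_to xs (array_get x s) m 4 Q"
proof -
  have "runs_to xs (array_get x s) m (1 + (1 + (1 + 1))) Q"
    unfolding array_get_def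
    by (intro runs_to_chain runs_to_Do) (use assms in \<open>auto simp: mult_2[symmetric] fun_upd_twist\<close>)
  then show ?thesis by (rule runs_to_weaken) auto
qed

definition marks :: "memory \<Rightarrow> nat set" where
  "marks m = {i. m (2 * i + 1) \<noteq> 0}"

text \<open>The inner two loops form a sweep over all pairs, which marks the head of each arc of
  \<open>R\<close> whose tail is marked; the outer two loops merely repeat it \<open>L * L\<close>
  times. Marks set during a sweep may be used at once: this can only speed up the search, and no
  mark leaves the closed set \<open>U\<close>. The loop variables are two apart because each loop
  occupies two. \<open>St\<close> is whatever else the caller needs to preserve.\<close>

lemma runs_to_sweeps:
  fixes xs :: "nat list" and d :: nat and R :: "(nat \<times> nat) set" and St :: "memory \<Rightarrow> bool"
  defines "r1 \<equiv> d + 3" and "r2 \<equiv> d + 5" and "r3 \<equiv> d + 7" and "r4 \<equiv> d + 9" and "L \<equiv> length xs"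
  assumes St: "\<And>m m' r. r \<ge> d + 3 \<Longrightarrow> St m \<Longrightarrow> (\<And>a. a \<noteq> 2 * r \<Longrightarrow> a \<noteq> 2 * r + 2 \<Longrightarrow> m' a = m a) \<Longrightarrow> St m'"
    and body: "\<And>m. St m \<Longrightarrow> m (2 * r3) < L \<Longrightarrow> m (2 * r4) < L \<Longrightarrow>
      runs_to xs c m B (\<lambda>m'. St m' \<and> marks m' = marks m \<union>
        {y. y = m (2 * r4) \<and> m (2 * r3) \<in> marks m \<and> (m (2 * r3), y) \<in> R} \<and>
        m' (2 * r1) = m (2 * r1) \<and> m' (2 * r2) = m (2 * r2) \<and> m' (2 * r3) = m (2 * r3) \<and>
        m' (2 * r4) = m (2 * r4))"
    and R: "R \<subseteq> {..<L} \<times> {..<L}"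
    and U: "R `` U \<subseteq> U" "marks m0 \<subseteq> U" and a: "a \<in> marks m0" and m0: "St m0"
  shows "runs_to xs (For r1 (For r2 (For r3 (For r4 c)))) m0
    (L * ((L * ((L * ((L * (B + 4) + 2) + 4) + 2) + 4) + 2) + 4) + 2)
    (\<lambda>m'. St m' \<and> R\<^sup>* `` {a} \<subseteq> marks m' \<and> marks m' \<subseteq> U)"
proof -
  \<comment> \<open>These vertices are within \<open>N\<close> arcs of \<open>a\<close>; each sweep
    raises the guaranteed \<open>N\<close> by one.\<close>
  define S where "S N = {y. \<exists>n\<le>N. (a, y) \<in> R ^^ n}" for N
  have S_Suc: "S (Suc N) \<subseteq> S N \<union> R `` S N" for N
  proof
    fix y assume "y \<in> S (Suc N)"
    then obtain n where n: "n \<le> Suc N" "(a, y) \<in> R ^^ n" by (auto simp: S_def)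
    show "y \<in> S N \<union> R `` S N"
    proof (cases n)
      case 0
      with n(2) have "(a, y) \<in> R ^^ 0" by simp
      then show ?thesis unfolding S_def by blast
    next
      case (Suc n')
      with n obtain z where "(a, z) \<in> R ^^ n'" "(z, y) \<in> R" "n' \<le> N" by auto
      then show ?thesis unfolding S_def by blast
    qed
  qed
  have frame: "marks m' = marks m" "x \<noteq> r \<Longrightarrow> x \<noteq> r + 1 \<Longrightarrow> m' (2 * x) = m (2 * x)"
    if eq: "\<And>a. a \<noteq> 2 * r \<Longrightarrow> a \<noteq> 2 * r + 2 \<Longrightarrow> m' a = m a" for m m' :: memory and r x
  proof -
    have "m' (2 * i + 1) = m (2 * i + 1)" for i by (rule eq) presburger+
    then show "marks m' = marks m" by (simp add: marks_def)
    show "m' (2 * x) = m (2 * x)" if "x \<noteq> r" "x \<noteq> r + 1" using that by (intro eq) auto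
  qed
  \<comment> \<open>\<open>S0\<close> holds marks from before the loop concerned. Since counters run
    down, the arcs leaving \<open>S0\<close> that have been treated are those with head at least
    \<open>j\<close>, or in \<open>I3\<close> with tail at least \<open>i\<close>.\<close>
  define I4 where "I4 x1 x2 i S0 j m \<longleftrightarrow> St m \<and> m (2 * r1) = x1 \<and> m (2 * r2) = x2 \<and> m (2 * r3) = i \<and>
    S0 \<subseteq> marks m \<and> marks m \<subseteq> U \<and> (\<forall>y. j \<le> y \<and> i \<in> S0 \<and> (i, y) \<in> R \<longrightarrow> y \<in> marks m)"
    for x1 x2 i S0 j and m :: memory
  define I3 where "I3 x1 x2 S0 i m \<longleftrightarrow> St m \<and> m (2 * r1) = x1 \<and> m (2 * r2) = x2 \<and>
    S0 \<subseteq> marks m \<and> marks m \<subseteq> U \<and> (\<forall>z y. i \<le> z \<and> z \<in> S0 \<and> (z, y) \<in> R \<longrightarrow> y \<in> marks m)"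
    for x1 x2 S0 i and m :: memory
  define I2 where "I2 x1 x2 m \<longleftrightarrow> St m \<and> m (2 * r1) = x1 \<and>
    S (L * (L - Suc x1) + (L - x2)) \<subseteq> marks m \<and> marks m \<subseteq> U" for x1 x2 and m :: memory
  define I1 where "I1 x1 m \<longleftrightarrow> St m \<and> S (L * (L - x1)) \<subseteq> marks m \<and> marks m \<subseteq> U"
    for x1 and m :: memory
  have loop4: "runs_to xs (For r4 c) m (L * (B + 4) + 2) (I4 x1 x2 i S0 0)"
    if m: "I4 x1 x2 i S0 L m" and i: "i < L" for x1 x2 i S0 m
    unfolding L_def
  proof (rule runs_to_For[where I = "I4 x1 x2 i S0"])
    show "I4 x1 x2 i S0 (length xs) m" using m by (simp add: L_def)
  next
    fix j and m1 m2 :: memory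
    assume I: "I4 x1 x2 i S0 j m1"
      and eq: "\<And>a. a \<noteq> 2 * r4 \<Longrightarrow> a \<noteq> 2 * r4 + 2 \<Longrightarrow> m2 a = m1 a"
    have "St m2" by (rule St[of r4 m1]) (use I eq in \<open>auto simp: I4_def r4_def\<close>)
    moreover have "m2 (2 * x) = m1 (2 * x)" if "x \<in> {r1, r2, r3}" for x
      using that by (intro frame(2)[OF eq]) (auto simp: r1_def r2_def r3_def r4_def)
    ultimately show "I4 x1 x2 i S0 j m2" using I frame(1)[OF eq] by (simp add: I4_def)
  next
    fix j and m1 :: memory
    assume j: "j < length xs" and I: "I4 x1 x2 i S0 (Suc j) m1" and r: "m1 (2 * r4) = j"
    show "runs_to xs c m1 B (\<lambda>m'. I4 x1 x2 i S0 j m' \<and> m' (2 * r4) = j)"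
    proof (rule runs_to_weaken[OF body order_refl])
      show "St m1" "m1 (2 * r3) < L" "m1 (2 * r4) < L"
        using I i j r by (auto simp: I4_def L_def)
    next
      fix m'
      let ?Y = "{y. y = m1 (2 * r4) \<and> m1 (2 * r3) \<in> marks m1 \<and> (m1 (2 * r3), y) \<in> R}"
      assume m': "St m' \<and> marks m' = marks m1 \<union> ?Y \<and>
        m' (2 * r1) = m1 (2 * r1) \<and> m' (2 * r2) = m1 (2 * r2) \<and> m' (2 * r3) = m1 (2 * r3) \<and>
        m' (2 * r4) = m1 (2 * r4)"
      have "?Y \<subseteq> U" using I U(1) by (auto simp: I4_def)
      moreover have "y \<in> marks m'" if "j \<le> y" "i \<in> S0" "(i, y) \<in> R" for y
      proof (cases "y = j")
        case True
        then show ?thesis using that I r m' by (auto simp: I4_def)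
      next
        case False
        then show ?thesis using that I m' by (auto simp: I4_def)
      qed
      ultimately show "I4 x1 x2 i S0 j m' \<and> m' (2 * r4) = j"
        using m' I r by (auto simp: I4_def)
    qed
  qed
  let ?B3 = "L * ((L * (B + 4) + 2) + 4) + 2"
  have loop3: "runs_to xs (For r3 (For r4 c)) m ?B3 (I3 x1 x2 S0 0)"
    if m: "I3 x1 x2 S0 L m" for x1 x2 S0 m
  proof (rule runs_to_For[where xs = xs and I = "I3 x1 x2 S0", folded L_def])
    show "I3 x1 x2 S0 L m" by (fact m)
  next
    fix j and m1 m2 :: memory
    assume I: "I3 x1 x2 S0 j m1"
      and eq: "\<And>a. a \<noteq> 2 * r3 \<Longrightarrow> a \<noteq> 2 * r3 + 2 \<Longrightarrow> m2 a = m1 a"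
    have "St m2" by (rule St[of r3 m1]) (use I eq in \<open>auto simp: I3_def r3_def\<close>)
    moreover have "m2 (2 * x) = m1 (2 * x)" if "x \<in> {r1, r2}" for x
      using that by (intro frame(2)[OF eq]) (auto simp: r1_def r2_def r3_def)
    ultimately show "I3 x1 x2 S0 j m2" using I frame(1)[OF eq] by (simp add: I3_def)
  next
    fix i and m1 :: memory
    assume i: "i < L" and I: "I3 x1 x2 S0 (Suc i) m1" and r: "m1 (2 * r3) = i"
    have "I4 x1 x2 i (marks m1) L m1"
      using I r R by (auto simp: I4_def I3_def)
    then have "runs_to xs (For r4 c) m1 (L * (B + 4) + 2) (I4 x1 x2 i (marks m1) 0)"
      using i by (rule loop4)
    then show "runs_to xs (For r4 c) m1 (L * (B + 4) + 2) (\<lambda>m'. I3 x1 x2 S0 i m' \<and> m' (2 * r3) = i)"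
    proof (rule runs_to_weaken)
      fix m' assume m': "I4 x1 x2 i (marks m1) 0 m'"
      have "y \<in> marks m'" if "i \<le> z" "z \<in> S0" "(z, y) \<in> R" for z y
      proof (cases "z = i")
        case True
        then show ?thesis using that I m' by (auto simp: I4_def I3_def)
      next
        case False
        then have "Suc i \<le> z" using that by simp
        then have "y \<in> marks m1" using that I by (auto simp: I3_def)
        then show ?thesis using m' by (auto simp: I4_def)
      qed
      then show "I3 x1 x2 S0 i m' \<and> m' (2 * r3) = i"
        using m' I by (auto simp: I4_def I3_def)
    qed simp
  qed
  let ?B2 = "L * (?B3 + 4) + 2"
  have loop2: "runs_to xs (For r2 (For r3 (For r4 c))) m ?B2 (I2 x1 0)"
    if m: "I2 x1 L m" for x1 m
  proof (rule runs_to_For[where xs = xs and I = "I2 x1", folded L_def])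
    show "I2 x1 L m" by (fact m)
  next
    fix j and m1 m2 :: memory
    assume I: "I2 x1 j m1"
      and eq: "\<And>a. a \<noteq> 2 * r2 \<Longrightarrow> a \<noteq> 2 * r2 + 2 \<Longrightarrow> m2 a = m1 a"
    have "St m2" by (rule St[of r2 m1]) (use I eq in \<open>auto simp: I2_def r2_def\<close>)
    moreover have "m2 (2 * r1) = m1 (2 * r1)"
      by (intro frame(2)[OF eq]) (auto simp: r1_def r2_def)
    ultimately show "I2 x1 j m2" using I frame(1)[OF eq] by (simp add: I2_def)
  next
    fix x2 and m1 :: memory
    assume x2: "x2 < L" and I: "I2 x1 (Suc x2) m1" and r: "m1 (2 * r2) = x2"
    have "I3 x1 x2 (marks m1) L m1"
      using I r R by (auto simp: I2_def I3_def)
    then have "runs_to xs (For r3 (For r4 c)) m1 ?B3 (I3 x1 x2 (marks m1) 0)"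
      by (rule loop3)
    then show "runs_to xs (For r3 (For r4 c)) m1 ?B3 (\<lambda>m'. I2 x1 x2 m' \<and> m' (2 * r2) = x2)"
    proof (rule runs_to_weaken)
      fix m' assume m': "I3 x1 x2 (marks m1) 0 m'"
      have "L - x2 = Suc (L - Suc x2)" using x2 by simp
      then have "S (L * (L - Suc x1) + (L - x2)) \<subseteq> marks m1 \<union> R `` marks m1"
        using S_Suc[of "L * (L - Suc x1) + (L - Suc x2)"] I unfolding I2_def by auto
      also have "\<dots> \<subseteq> marks m'" using m' by (auto simp: I3_def)
      finally show "I2 x1 x2 m' \<and> m' (2 * r2) = x2"
        using m' by (auto simp: I2_def I3_def)
    qed simp
  qed
  let ?B1 = "L * (?B2 + 4) + 2"
  have loop1: "runs_to xs (For r1 (For r2 (For r3 (For r4 c)))) m0 ?B1 (I1 0)"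
  proof (rule runs_to_For[where xs = xs and I = "I1", folded L_def])
    show "I1 L m0" using m0 a U(2) by (auto simp: I1_def S_def)
  next
    fix j and m1 m2 :: memory
    assume I: "I1 j m1"
      and eq: "\<And>a. a \<noteq> 2 * r1 \<Longrightarrow> a \<noteq> 2 * r1 + 2 \<Longrightarrow> m2 a = m1 a"
    have "St m2" by (rule St[of r1 m1]) (use I eq in \<open>auto simp: I1_def r1_def\<close>)
    then show "I1 j m2" using I frame(1)[OF eq] by (simp add: I1_def)
  next
    fix x1 and m1 :: memory
    assume x1: "x1 < L" and I: "I1 (Suc x1) m1" and r: "m1 (2 * r1) = x1"
    have "I2 x1 L m1" using I r by (auto simp: I1_def I2_def)
    then have "runs_to xs (For r2 (For r3 (For r4 c))) m1 ?B2 (I2 x1 0)" by (rule loop2)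
    then show "runs_to xs (For r2 (For r3 (For r4 c))) m1 ?B2 (\<lambda>m'. I1 x1 m' \<and> m' (2 * r1) = x1)"
    proof (rule runs_to_weaken)
      fix m' assume m': "I2 x1 0 m'"
      have "L - x1 = Suc (L - Suc x1)" using x1 by simp
      then have "L * (L - x1) = L * (L - Suc x1) + (L - 0)" by simp
      then show "I1 x1 m' \<and> m' (2 * r1) = x1" using m' by (simp add: I1_def I2_def)
    qed simp
  qed
  \<comment> \<open>Connections in a finite relation need at most as many arcs as the relation has,
    and \<open>L * L\<close> bounds this number.\<close>
  have "R\<^sup>* `` {a} \<subseteq> S (L * L)"
  proof -
    have "finite R" using R finite_subset by blast
    moreover have "card R \<le> L * L" using card_mono[OF _ R] by (simp add: card_cartesian_product)
    ultimately show ?thesis unfolding S_def rtrancl_finite_eq_relpow[OF \<open>finite R\<close>]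
      using order_trans by blast
  qed
  with loop1 show ?thesis by (elim runs_to_weaken) (auto simp: I1_def)
qed

definition skip :: cmd where
  "skip = Do (Copy 0 0)"

lemma runs_to_skip: "Q m \<Longrightarrow> 1 \<le> B \<Longrightarrow> runs_to xs skip m B Q"
  unfolding skip_def by (rule runs_to_weaken[OF runs_to_Do[where Q = Q]]) auto

text \<open>The arc relation and both ends have flag \<open>False\<close>, because their evaluation
  must not disturb the marks; the query itself changes the array. Hence queries may be combined by
  connectives and quantifiers, but not nested in the arc relation of another query.\<close>

lemma computable_pred_reachable:
  assumes P: "computable_pred False P" and f: "computable False f" and g: "computable False g"
    and pq: "p \<noteq> q"
  shows "computable_pred True (\<lambda>xs e. (f xs e, g xs e) \<in>
    {(i, j). i < length xs \<and> j < length xs \<and> P xs (e(p := i, q := j))}\<^sup>*)"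
proof -
  let ?R = "\<lambda>xs e. {(i, j). i < length xs \<and> j < length xs \<and> P xs (e(p := i, q := j))}"
  let ?h = "\<lambda>xs e. of_bool ((f xs e, g xs e) \<in> (?R xs e)\<^sup>*) :: nat"
  obtain d1 where d1: "\<And>xs e e'. (\<forall>i<d1. e i = e' i) \<Longrightarrow> of_bool (P xs e) = (of_bool (P xs e') :: nat)"
    "\<And>d. d \<ge> d1 \<Longrightarrow> \<exists>c B. poly_bounded B \<and> computes False d (\<lambda>xs e. of_bool (P xs e)) c B"
    using P unfolding computable_def by blast
  obtain d2 where d2: "\<And>xs e e'. (\<forall>i<d2. e i = e' i) \<Longrightarrow> f xs e = f xs e'"
    "\<And>d. d \<ge> d2 \<Longrightarrow> \<exists>c B. poly_bounded B \<and> computes False d f c B"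
    using f unfolding computable_def by blast
  obtain d3 where d3: "\<And>xs e e'. (\<forall>i<d3. e i = e' i) \<Longrightarrow> g xs e = g xs e'"
    "\<And>d. d \<ge> d3 \<Longrightarrow> \<exists>c B. poly_bounded B \<and> computes False d g c B"
    using g unfolding computable_def by blast
  have dP: "P xs e = P xs e'" if "\<forall>i<d1. e i = e' i" for xs e e'
    using d1(1)[OF that] by (simp add: of_bool_eq_iff)
  define d0 where "d0 = Max {d1, d2, d3, Suc p, Suc q}"
  have "\<exists>c B. poly_bounded B \<and> computes True d ?h c B" if "d \<ge> d0" for d
  proof -
    have d: "d1 \<le> d" "d2 \<le> d" "d3 \<le> d" "p < d" "q < d" using that by (auto simp: d0_def)
    obtain c1 B1 where 1: "poly_bounded B1" "computes False (d + 11) (\<lambda>xs e. of_bool (P xs e)) c1 B1"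
      using d1(2)[of "d + 11"] d by auto
    obtain c2 B2 where 2: "poly_bounded B2" "computes False (d + 3) f c2 B2"
      using d2(2)[of "d + 3"] d by auto
    obtain c3 B3 where 3: "poly_bounded B3" "computes False (d + 3) g c3 B3"
      using d3(2)[of "d + 3"] d by auto
    let ?body = "Do (Copy (2 * p) (2 * (d + 7))) ;; Do (Copy (2 * q) (2 * (d + 9))) ;;
      array_get (d + 7) (d + 11) ;;
      If (2 * (d + 11)) (c1 ;; If (2 * (d + 11)) (array_set (d + 9) 1 (d + 11)) skip) skip"
    let ?Bb = "\<lambda>n. 1 + (1 + (4 + ((B1 n + (5 + 2)) + 2)))"
    let ?clear = "For (d + 3) (array_set (d + 3) 0 (d + 5))"
    let ?Bc = "\<lambda>n. n * (5 + 4) + 2 :: nat"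
    let ?sweeps = "For (d + 3) (For (d + 5) (For (d + 7) (For (d + 9) ?body)))"
    let ?Bs = "\<lambda>n. n * ((n * ((n * ((n * (?Bb n + 4) + 2) + 4) + 2) + 4) + 2) + 4) + 2"
    let ?output = "If (2 * (d + 5)) (Do (Const (2 * d) 1)) (Do (Const (2 * d) 0))"
    \<comment> \<open>The target may lie outside the range covered by \<open>?clear\<close>, so its
      cell is cleared separately. The start is marked only afterwards, which gives the right answer
      when start and target coincide.\<close>
    let ?c = "Do (Copy (2 * (d + 1)) (2 * p)) ;; Do (Copy (2 * (d + 2)) (2 * q)) ;; ?clear ;;
      c3 ;; array_set (d + 3) 0 (d + 5) ;; c2 ;; array_set (d + 3) 1 (d + 5) ;; ?sweeps ;;
      Do (Copy (2 * p) (2 * (d + 1))) ;; Do (Copy (2 * q) (2 * (d + 2))) ;;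
      c3 ;; array_get (d + 3) (d + 5) ;; ?output"
    let ?B = "\<lambda>n. 1 + (1 + (?Bc n + (B3 n + (5 + (B2 n + (5 + (?Bs n + (1 + (1 + (B3 n + (4 + (1 + 2))))))))))))"
    have "computes True d ?h ?c ?B"
      unfolding computes_def
    proof (intro allI)
      fix xs :: "nat list" and m :: memory
      define e where "e = (\<lambda>i. m (2 * i))"
      define L where "L = length xs"
      define a where "a = f xs e"
      define t where "t = g xs e"
      define R where "R = ?R xs e"
      let ?Q = "\<lambda>m'. agree True d m m' \<and> m' (2 * d) = ?h xs (\<lambda>i. m (2 * i))"
      \<comment> \<open>\<open>St\<close> holds during the sweeps, while \<open>p\<close> and
        \<open>q\<close> contain the pair under test and their values are saved in
        \<open>d + 1\<close> and \<open>d + 2\<close>; \<open>A\<close> holds before, with all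
        variables intact.\<close>
      define St where "St m' \<longleftrightarrow> (\<forall>i<d. i \<noteq> p \<longrightarrow> i \<noteq> q \<longrightarrow> m' (2 * i) = m (2 * i)) \<and>
        m' (2 * (d + 1)) = m (2 * p) \<and> m' (2 * (d + 2)) = m (2 * q)" for m' :: memory
      define A where "A m' \<longleftrightarrow> (\<forall>i<d. m' (2 * i) = m (2 * i)) \<and>
        m' (2 * (d + 1)) = m (2 * p) \<and> m' (2 * (d + 2)) = m (2 * q)" for m' :: memory
      have RL: "R \<subseteq> {..<L} \<times> {..<L}" by (auto simp: R_def L_def)
      have St_upd: "St (m'(x := y))" if "St m'" "odd x \<or> x \<ge> 2 * (d + 3)" for m' x y
        using that by (auto simp: St_def)
      have A_upd: "A (m'(x := y))" if "A m'" "odd x \<or> x \<ge> 2 * (d + 3)" for m' x y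
        using that by (auto simp: A_def)
      have St_frame: "St m''" if "r \<ge> d + 3" "St m'" "\<And>a. a \<noteq> 2 * r \<Longrightarrow> a \<noteq> 2 * r + 2 \<Longrightarrow> m'' a = m' a"
        for m' m'' :: memory and r
      proof -
        have "m'' (2 * i) = m' (2 * i)" if "i < d + 3" for i
          using \<open>r \<ge> d + 3\<close> that by (intro \<open>\<And>a. _ \<Longrightarrow> _ \<Longrightarrow> m'' a = m' a\<close>) auto
        from this this[of "d + 1"] this[of "d + 2"] show ?thesis using \<open>St m'\<close> by (simp add: St_def)
      qed
      have A_frame: "A m''" if "r \<ge> d + 3" "A m'" "\<And>a. a \<noteq> 2 * r \<Longrightarrow> a \<noteq> 2 * r + 2 \<Longrightarrow> m'' a = m' a"
        for m' m'' :: memory and r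
      proof -
        have "m'' (2 * i) = m' (2 * i)" if "i < d + 3" for i
          using \<open>r \<ge> d + 3\<close> that by (intro \<open>\<And>a. _ \<Longrightarrow> _ \<Longrightarrow> m'' a = m' a\<close>) auto
        from this this[of "d + 1"] this[of "d + 2"] show ?thesis using \<open>A m'\<close> by (simp add: A_def)
      qed
      have A_agree: "A m'' \<and> marks m'' = marks m'" if "A m'" "agree False (d + 3) m' m''" for m' m''
      proof -
        have "m'' (2 * i) = m' (2 * i)" if "i < d + 3" for i
          using \<open>agree False (d + 3) m' m''\<close> that by (auto simp: agree_def)
        from this this[of "d + 1"] this[of "d + 2"] have "A m''" using \<open>A m'\<close> by (simp add: A_def)
        moreover have "marks m'' = marks m'" using that(2) by (auto simp: agree_def marks_def)
        ultimately show ?thesis by simp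
      qed
      have at: "f xs (\<lambda>i. m' (2 * i)) = a" "g xs (\<lambda>i. m' (2 * i)) = t"
        if "\<forall>i<d. m' (2 * i) = m (2 * i)" for m' :: memory
        using that d by (auto simp: a_def t_def e_def intro!: d2(1) d3(1))
      have marks_even: "marks (m'(2 * i := y)) = marks m'" for m' :: memory and i y
        by (auto simp: marks_def)
      have marks_odd: "marks (m'(2 * i + 1 := y)) = (if y = 0 then marks m' - {i} else insert i (marks m'))"
        for m' :: memory and i y
        by (auto simp: marks_def)
      have clear: "runs_to xs ?clear m1 (?Bc (length xs)) (\<lambda>m'. A m' \<and> marks m' \<inter> {..<L} = {})"
        if "A m1" for m1
      proof -
        define I where "I j m' \<longleftrightarrow> A m' \<and> marks m' \<inter> {j..<L} = {}" for j :: nat and m' :: memory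
        have "runs_to xs ?clear m1 (?Bc (length xs)) (I 0)"
        proof (rule runs_to_For[where I = I])
          show "I (length xs) m1" using that by (simp add: I_def L_def)
        next
          fix j and m2 m3 :: memory
          assume I: "I j m2" and eq: "\<And>a. a \<noteq> 2 * (d + 3) \<Longrightarrow> a \<noteq> 2 * (d + 3) + 2 \<Longrightarrow> m3 a = m2 a"
          have "A m3" by (rule A_frame[of "d + 3" m2]) (use I eq in \<open>auto simp: I_def\<close>)
          moreover have "m3 (2 * i + 1) = m2 (2 * i + 1)" for i by (rule eq) presburger+
          then have "marks m3 = marks m2" by (simp add: marks_def)
          ultimately show "I j m3" using I by (simp add: I_def)
        next
          fix j and m2 :: memory
          assume j: "j < length xs" and I: "I (Suc j) m2" and r: "m2 (2 * (d + 3)) = j"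
          let ?m = "m2(2 * (d + 5) := 2 * j + 1, 2 * (d + 6) := 0, 2 * j + 1 := 0)"
          have "A ?m" using I by (intro A_upd) (auto simp: I_def)
          moreover have "marks ?m = marks m2 - {j}" unfolding marks_odd marks_even by simp
          moreover have "marks m2 \<inter> {Suc j..<L} = {}" using I by (simp add: I_def)
          then have "(marks m2 - {j}) \<inter> {j..<L} = {}" by (auto simp: disjoint_iff Suc_le_eq)
          moreover have "2 * (d + 3) \<noteq> 2 * j + 1" by presburger
          then have "?m (2 * (d + 3)) = j" unfolding fun_upd_apply using r by simp
          ultimately have "I j ?m \<and> ?m (2 * (d + 3)) = j" by (simp add: I_def)
          then show "runs_to xs (array_set (d + 3) 0 (d + 5)) m2 5 (\<lambda>m'. I j m' \<and> m' (2 * (d + 3)) = j)"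
            by (intro runs_to_array_set) (use r in \<open>simp_all add: algebra_simps\<close>)
        qed
        then show ?thesis by (rule runs_to_weaken) (auto simp: I_def lessThan_atLeast0)
      qed
      have set: "runs_to xs (array_set (d + 3) n (d + 5)) m1 5 (\<lambda>m'. A m' \<and>
          marks m' = (if n = 0 then marks m1 - {m1 (2 * (d + 3))} else insert (m1 (2 * (d + 3))) (marks m1)))"
        if "A m1" for m1 n
      proof -
        let ?i = "m1 (2 * (d + 3))"
        let ?m = "m1(2 * (d + 5) := 2 * ?i + 1, 2 * (d + 6) := n, 2 * ?i + 1 := n)"
        have "A ?m" using that by (intro A_upd) auto
        moreover have "marks ?m = (if n = 0 then marks m1 - {?i} else insert ?i (marks m1))"
          unfolding marks_odd marks_even by simp
        ultimately show ?thesis by (intro runs_to_array_set) (simp_all add: algebra_simps)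
      qed
      have body: "runs_to xs ?body m1 (?Bb (length xs)) (\<lambda>m'. St m' \<and> marks m' = marks m1 \<union>
          {y. y = m1 (2 * (d + 9)) \<and> m1 (2 * (d + 7)) \<in> marks m1 \<and> (m1 (2 * (d + 7)), y) \<in> R} \<and>
          m' (2 * (d + 3)) = m1 (2 * (d + 3)) \<and> m' (2 * (d + 5)) = m1 (2 * (d + 5)) \<and>
          m' (2 * (d + 7)) = m1 (2 * (d + 7)) \<and> m' (2 * (d + 9)) = m1 (2 * (d + 9)))"
        (is "runs_to _ _ _ _ ?Q'")
        if m1: "St m1" "m1 (2 * (d + 7)) < length xs" "m1 (2 * (d + 9)) < length xs" for m1
      proof -
        define i where "i = m1 (2 * (d + 7))"
        define j where "j = m1 (2 * (d + 9))"
        define m2 where "m2 = m1(2 * p := i, 2 * q := j,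
          2 * (d + 11) + 2 := 1, 2 * (d + 11) := m1 (2 * i + 1))"
        have low: "m2 (2 * (d + k)) = m1 (2 * (d + k))" if "k < 11" for k
          using that d by (simp add: m2_def)
        have St2: "St m2" using m1(1) d by (simp add: m2_def St_def)
        have "2 * (d + 11) + 2 = 2 * (d + 12)" by simp
        then have marks2: "marks m2 = marks m1" unfolding m2_def by (simp only: marks_even)
        have m2_11: "m2 (2 * (d + 11)) = m1 (2 * i + 1)" by (simp add: m2_def)
        have P2: "P xs (\<lambda>i. m2 (2 * i)) \<longleftrightarrow> (i, j) \<in> R"
        proof -
          have "P xs (\<lambda>i. m2 (2 * i)) \<longleftrightarrow> P xs (e(p := i, q := j))"
            by (rule dP) (use m1(1) d pq in \<open>auto simp: m2_def e_def St_def\<close>)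
          then show ?thesis using m1(2,3) by (simp add: R_def i_def j_def)
        qed
        have regs: "?Q' m'" if "St m'" "marks m' = marks m1 \<union> (if i \<in> marks m1 \<and> (i, j) \<in> R then {j} else {})"
          "\<And>k. k < 11 \<Longrightarrow> m' (2 * (d + k)) = m1 (2 * (d + k))" for m'
          using that(1,2) that(3)[of 3] that(3)[of 5] that(3)[of 7] that(3)[of 9]
          by (auto simp: i_def j_def)
        have inner: "runs_to xs (If (2 * (d + 11)) (c1 ;; If (2 * (d + 11)) (array_set (d + 9) 1 (d + 11)) skip) skip)
            m2 ((B1 (length xs) + (5 + 2)) + 2) ?Q'"
        proof (intro runs_to_If)
          assume "m2 (2 * (d + 11)) = 0"
          then have "i \<notin> marks m1" unfolding m2_11 by (simp add: marks_def)
          then show "runs_to xs skip m2 (B1 (length xs) + (5 + 2)) ?Q'"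
            by (intro runs_to_skip regs) (use St2 marks2 low in auto)
        next
          assume "m2 (2 * (d + 11)) \<noteq> 0"
          then have i: "i \<in> marks m1" unfolding m2_11 by (simp add: marks_def)
          show "runs_to xs (c1 ;; If (2 * (d + 11)) (array_set (d + 9) 1 (d + 11)) skip) m2
              (B1 (length xs) + (5 + 2)) ?Q'"
          proof (intro runs_to_Seq[OF computesD[OF 1(2)]] runs_to_If)
            fix m3 assume m3: "agree False (d + 11) m2 m3 \<and>
              m3 (2 * (d + 11)) = of_bool (P xs (\<lambda>i. m2 (2 * i)))"
            have low3': "m3 (2 * k) = m2 (2 * k)" if "k < d + 11" for k
              using m3 that by (simp add: agree_def)
            have low3: "m3 (2 * (d + k)) = m1 (2 * (d + k))" if "k < 11" for k
              using low3'[of "d + k"] low[OF that] that by simp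
            have St3: "St m3"
              using St2 low3' low3'[of "d + 1"] low3'[of "d + 2"] by (simp add: St_def)
            have marks3: "marks m3 = marks m1" using m3 marks2 by (simp add: agree_def marks_def)
            {
              assume "m3 (2 * (d + 11)) = 0"
              then have "(i, j) \<notin> R" using m3 P2 by simp
              then show "runs_to xs skip m3 5 ?Q'"
                by (intro runs_to_skip regs) (use St3 marks3 low3 in auto)
            next
              assume "m3 (2 * (d + 11)) \<noteq> 0"
              then have ij: "(i, j) \<in> R" using m3 P2 by (auto split: if_splits)
              let ?m = "m3(2 * (d + 11) := 2 * j + 1, 2 * (d + 12) := 1, 2 * j + 1 := 1)"
              have "St ?m" using St3 by (intro St_upd) auto
              moreover have "marks ?m = insert j (marks m1)"
                unfolding marks_odd marks_even marks3 by simp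
              moreover have "?m (2 * (d + k)) = m1 (2 * (d + k))" if "k < 11" for k
              proof -
                have "2 * (d + k) \<noteq> 2 * j + 1" by presburger
                then show ?thesis unfolding fun_upd_apply using low3[OF that] that by simp
              qed
              ultimately have "?Q' ?m" using i ij by (intro regs) auto
              moreover have "m3 (2 * (d + 9)) = j" using low3[of 9] by (simp add: j_def)
              ultimately show "runs_to xs (array_set (d + 9) 1 (d + 11)) m3 5 ?Q'"
                by (intro runs_to_array_set) (simp_all add: algebra_simps)
            }
          qed
        qed
        show ?thesis
        proof (intro runs_to_chain)
          let ?m = "snd (exec_instr xs (Copy (2 * q) (2 * (d + 9)))
            (0, snd (exec_instr xs (Copy (2 * p) (2 * (d + 7))) (0, m1))))"
          have m: "?m = m1(2 * p := i, 2 * q := j)" using d by (simp add: i_def j_def)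
          have "?m(2 * (d + 11) + 2 := 1, 2 * (d + 11) := ?m (2 * ?m (2 * (d + 7)) + 1)) = m2"
            unfolding m using d by (simp add: m2_def i_def)
          then have "runs_to xs (array_get (d + 7) (d + 11)) ?m 4 (\<lambda>m'. m' = m2)"
            by (intro runs_to_array_get) simp_all
          then show "runs_to xs (array_get (d + 7) (d + 11) ;;
            If (2 * (d + 11)) (c1 ;; If (2 * (d + 11)) (array_set (d + 9) 1 (d + 11)) skip) skip)
            ?m (4 + ((B1 (length xs) + (5 + 2)) + 2)) ?Q'"
            by (rule runs_to_Seq) (use inner in simp)
        qed simp_all
      qed
      \<comment> \<open>Cells from \<open>L\<close> on other than those of \<open>a\<close> and
        \<open>t\<close> may contain marks left by earlier queries. No arc of \<open>R\<close>
        starts there, so they do not influence the search.\<close>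
      define M where "M m' \<longleftrightarrow> a \<in> marks m' \<and> (marks m' - {a}) \<inter> {..<L} = {} \<and> (t \<noteq> a \<longrightarrow> t \<notin> marks m')"
        for m' :: memory
      have sweeps: "runs_to xs ?sweeps m1 (?Bs (length xs)) (\<lambda>m'. St m' \<and> (t \<in> marks m' \<longleftrightarrow> (a, t) \<in> R\<^sup>*))"
        if "A m1" "M m1" for m1
      proof -
        let ?U = "marks m1 \<union> R\<^sup>* `` {a}"
        have "runs_to xs ?sweeps m1 (?Bs (length xs)) (\<lambda>m'. St m' \<and> R\<^sup>* `` {a} \<subseteq> marks m' \<and> marks m' \<subseteq> ?U)"
        proof (rule runs_to_sweeps)
          show "R `` ?U \<subseteq> ?U"
          proof
            fix y assume "y \<in> R `` ?U"
            then obtain z where z: "z \<in> ?U" "(z, y) \<in> R" by blast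
            then have "z < L" using RL by blast
            then have "z \<in> R\<^sup>* `` {a}" using z(1) that(2) by (auto simp: M_def)
            then show "y \<in> ?U" using z(2) by (auto intro: rtrancl_into_rtrancl)
          qed
          show "St m1" using that(1) by (simp add: A_def St_def)
        qed (use that RL St_frame body in \<open>simp_all add: M_def L_def\<close>)
        then show ?thesis
          by (rule runs_to_weaken) (use that(2) in \<open>auto simp: M_def\<close>)
      qed
      have answer: "runs_to xs (c3 ;; array_get (d + 3) (d + 5) ;; ?output) m1
          (B3 (length xs) + (4 + (1 + 2))) ?Q"
        if m1: "\<forall>i<d. m1 (2 * i) = m (2 * i)" "t \<in> marks m1 \<longleftrightarrow> (a, t) \<in> R\<^sup>*" for m1
      proof (intro runs_to_Seq[OF computesD[OF 3(2)]])
        fix m2 assume m2: "agree False (d + 3) m1 m2 \<and> m2 (2 * (d + 3)) = g xs (\<lambda>i. m1 (2 * i))"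
        then have t: "m2 (2 * (d + 3)) = t" using at(2)[OF m1(1)] by simp
        have 2: "\<forall>i<d. m2 (2 * i) = m (2 * i)" "m2 (2 * t + 1) \<noteq> 0 \<longleftrightarrow> (a, t) \<in> R\<^sup>*"
          using m1 m2 by (auto simp: agree_def marks_def)
        show "runs_to xs (array_get (d + 3) (d + 5) ;; ?output) m2 (4 + (1 + 2)) ?Q"
        proof (rule runs_to_Seq)
          show "runs_to xs (array_get (d + 3) (d + 5)) m2 4
            (\<lambda>m'. (\<forall>i<d. m' (2 * i) = m (2 * i)) \<and> (m' (2 * (d + 5)) \<noteq> 0 \<longleftrightarrow> (a, t) \<in> R\<^sup>*))"
            by (rule runs_to_array_get) (use 2 t in auto)
        next
          fix m3 assume m3: "(\<forall>i<d. m3 (2 * i) = m (2 * i)) \<and> (m3 (2 * (d + 5)) \<noteq> 0 \<longleftrightarrow> (a, t) \<in> R\<^sup>*)"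
          show "runs_to xs ?output m3 (1 + 2) ?Q"
            by (intro runs_to_If runs_to_Do)
              (use m3 in \<open>auto simp: agree_def a_def t_def R_def e_def\<close>)
        qed
      qed
      show "runs_to xs ?c m (?B (length xs)) ?Q"
      proof (intro runs_to_chain)
        let ?m = "snd (exec_instr xs (Copy (2 * (d + 2)) (2 * q))
            (0, snd (exec_instr xs (Copy (2 * (d + 1)) (2 * p)) (0, m))))"
        have "A ?m" using d by (simp add: A_def)
        from clear[OF this] show "runs_to xs (?clear ;;
          c3 ;; array_set (d + 3) 0 (d + 5) ;; c2 ;; array_set (d + 3) 1 (d + 5) ;; ?sweeps ;;
          Do (Copy (2 * p) (2 * (d + 1))) ;; Do (Copy (2 * q) (2 * (d + 2))) ;;
          c3 ;; array_get (d + 3) (d + 5) ;; ?output) ?m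
          (?Bc (length xs) + (B3 (length xs) + (5 + (B2 (length xs) + (5 + (?Bs (length xs) +
            (1 + (1 + (B3 (length xs) + (4 + (1 + 2))))))))))) ?Q"
        proof (rule runs_to_Seq, intro runs_to_Seq[OF computesD[OF 3(2)]])
          fix m1 m2
          assume m1: "A m1 \<and> marks m1 \<inter> {..<L} = {}"
            and "agree False (d + 3) m1 m2 \<and> m2 (2 * (d + 3)) = g xs (\<lambda>i. m1 (2 * i))"
          then have m2: "A m2" "marks m2 \<inter> {..<L} = {}" "m2 (2 * (d + 3)) = t"
            using A_agree[of m1 m2] at(2)[of m1] by (auto simp: A_def)
          show "runs_to xs (array_set (d + 3) 0 (d + 5) ;; c2 ;; array_set (d + 3) 1 (d + 5) ;; ?sweeps ;;
            Do (Copy (2 * p) (2 * (d + 1))) ;; Do (Copy (2 * q) (2 * (d + 2))) ;;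
            c3 ;; array_get (d + 3) (d + 5) ;; ?output) m2
            (5 + (B2 (length xs) + (5 + (?Bs (length xs) +
            (1 + (1 + (B3 (length xs) + (4 + (1 + 2))))))))) ?Q"
          proof (rule runs_to_Seq[OF set[OF m2(1)]], rule runs_to_Seq[OF computesD[OF 2(2)]])
            fix m3 m4
            assume m3: "A m3 \<and> marks m3 = (if (0::nat) = 0 then marks m2 - {m2 (2 * (d + 3))}
                else insert (m2 (2 * (d + 3))) (marks m2))"
              and m4': "agree False (d + 3) m3 m4 \<and> m4 (2 * (d + 3)) = f xs (\<lambda>i. m3 (2 * i))"
            then have m4: "A m4" "marks m4 \<inter> {..<L} = {}" "t \<notin> marks m4" "m4 (2 * (d + 3)) = a"
              using A_agree[of m3 m4] at(1)[of m3] m2 by (auto simp: A_def)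
            show "runs_to xs (array_set (d + 3) 1 (d + 5) ;; ?sweeps ;;
              Do (Copy (2 * p) (2 * (d + 1))) ;; Do (Copy (2 * q) (2 * (d + 2))) ;;
              c3 ;; array_get (d + 3) (d + 5) ;; ?output) m4
              (5 + (?Bs (length xs) + (1 + (1 + (B3 (length xs) + (4 + (1 + 2))))))) ?Q"
            proof (rule runs_to_Seq[OF set[OF m4(1)]], rule runs_to_Seq[OF sweeps])
              fix m5 assume m5: "A m5 \<and> marks m5 = (if (1::nat) = 0 then marks m4 - {m4 (2 * (d + 3))}
                else insert (m4 (2 * (d + 3))) (marks m4))"
              then show "A m5" by simp
              show "M m5" using m5 m4 by (auto simp: M_def)
            next
              fix m5 m6 assume m6: "St m6 \<and> (t \<in> marks m6 \<longleftrightarrow> (a, t) \<in> R\<^sup>*)"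
              let ?m = "m6(2 * p := m6 (2 * (d + 1)), 2 * q := m6 (2 * (d + 2)))"
              have "marks ?m = marks m6" unfolding marks_even ..
              moreover have "\<forall>i<d. ?m (2 * i) = m (2 * i)" using m6 d by (auto simp: St_def)
              ultimately have ans: "runs_to xs (c3 ;; array_get (d + 3) (d + 5) ;; ?output) ?m
                  (B3 (length xs) + (4 + (1 + 2))) ?Q"
                using m6 by (intro answer) simp_all
              have "snd (exec_instr xs (Copy (2 * q) (2 * (d + 2)))
                  (0, snd (exec_instr xs (Copy (2 * p) (2 * (d + 1))) (0, m6)))) = ?m"
                using d by simp
              with ans show "runs_to xs (Do (Copy (2 * p) (2 * (d + 1))) ;; Do (Copy (2 * q) (2 * (d + 2))) ;;
                c3 ;; array_get (d + 3) (d + 5) ;; ?output) m6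
                (1 + (1 + (B3 (length xs) + (4 + (1 + 2))))) ?Q"
                by (intro runs_to_chain) (simp_all only: is_jump.simps not_False_eq_True)
            qed
          qed
        qed
      qed simp_all
    qed
    moreover have "poly_bounded ?B" using 1(1) 2(1) 3(1) by (intro poly_bounded_intros)
    ultimately show ?thesis by (intro exI conjI)
  qed
  moreover have "?h xs e = ?h xs e'" if "\<forall>i<d0. e i = e' i" for xs e e'
  proof -
    have le: "d1 \<le> d0" "d2 \<le> d0" "d3 \<le> d0" by (auto simp: d0_def)
    have "P xs (e(p := i, q := j)) = P xs (e'(p := i, q := j))" for i j
      by (rule dP) (use that le in auto)
    moreover have "f xs e = f xs e'" by (rule d2) (use that le in auto)
    moreover have "g xs e = g xs e'" by (rule d3) (use that le in auto)
    ultimately show ?thesis by simp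
  qed
  ultimately show ?thesis unfolding computable_def by blast
qed

section \<open>Flows and cuts\<close>

definition net :: "'v set \<Rightarrow> ('v \<Rightarrow> 'v \<Rightarrow> nat) \<Rightarrow> 'v \<Rightarrow> int" where
  "net V f u = (\<Sum>v\<in>V. int (f u v)) - (\<Sum>v\<in>V. int (f v u))"

definition cut :: "'v set \<Rightarrow> ('v \<Rightarrow> 'v \<Rightarrow> nat) \<Rightarrow> 'v set \<Rightarrow> nat" where
  "cut V c S = (\<Sum>u\<in>S. \<Sum>v\<in>V - S. c u v)"

text \<open>Flow between two vertices of \<open>S\<close> is counted once with each sign and
  cancels.\<close>

lemma sum_net_eq:
  assumes "finite V" "S \<subseteq> V"
  shows "(\<Sum>u\<in>S. net V f u) = int (\<Sum>u\<in>S. \<Sum>v\<in>V - S. f u v) - int (\<Sum>u\<in>S. \<Sum>v\<in>V - S. f v u)"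
proof -
  have split: "(\<Sum>v\<in>V. g v) = (\<Sum>v\<in>S. g v) + (\<Sum>v\<in>V - S. g v)" for g :: "'a \<Rightarrow> int"
    using sum.subset_diff[OF assms(2,1), of g] by simp
  have "(\<Sum>u\<in>S. \<Sum>v\<in>S. int (f u v)) = (\<Sum>u\<in>S. \<Sum>v\<in>S. int (f v u))"
    by (rule sum.swap)
  then show ?thesis
    unfolding net_def split sum_subtractf sum.distrib by simp
qed

lemma net_source_eq:
  assumes "finite V" "S \<subseteq> V" "s \<in> S" "t \<notin> S" "\<And>u. u \<in> V - {s, t} \<Longrightarrow> net V f u = 0"
  shows "net V f s = int (\<Sum>u\<in>S. \<Sum>v\<in>V - S. f u v) - int (\<Sum>u\<in>S. \<Sum>v\<in>V - S. f v u)"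
proof -
  have "finite S" using assms(1,2) finite_subset by blast
  have "(\<Sum>u\<in>S. net V f u) = (\<Sum>u\<in>{s}. net V f u)"
    using assms \<open>finite S\<close> by (intro sum.mono_neutral_right) auto
  then show ?thesis using sum_net_eq[OF assms(1,2), of f] by simp
qed

lemma net_source_le:
  assumes "finite V" "S \<subseteq> V" "s \<in> S" "t \<notin> S" "\<And>u. u \<in> V - {s, t} \<Longrightarrow> net V f u = 0"
  shows "net V f s \<le> int (\<Sum>u\<in>S. \<Sum>v\<in>V - S. f u v)"
  unfolding net_source_eq[OF assms, simplified] by (simp add: sum_nonneg)

definition residual :: "('v \<Rightarrow> 'v \<Rightarrow> nat) \<Rightarrow> ('v \<Rightarrow> 'v \<Rightarrow> nat) \<Rightarrow> 'v \<Rightarrow> 'v \<Rightarrow> bool" where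
  "residual c f u v \<longleftrightarrow> f u v < c u v \<or> f v u > 0"

text \<open>A unit is added on the arc or cancelled on the opposite one. Only entries involving
  \<open>u\<close> change; the last conclusion records this for \<open>push_path\<close>.\<close>

lemma push_arc:
  assumes "finite V" "u \<in> V" "w \<in> V" "u \<noteq> w" "\<And>a b. f a b \<le> c a b" "residual c f u w"
  obtains f' where "\<And>a b. f' a b \<le> c a b"
    "\<And>x. x \<in> V \<Longrightarrow> net V f' x = net V f x + of_bool (x = u) - of_bool (x = w)"
    "\<And>a b. a \<noteq> u \<Longrightarrow> b \<noteq> u \<Longrightarrow> f' a b = f a b"
proof (cases "f u w < c u w")
  case True
  define f' where "f' = (\<lambda>a b. f a b + of_bool (a = u \<and> b = w))"
  have int_f': "int (f' a b) = int (f a b) + of_bool (a = u \<and> b = w)" for a b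
    by (simp add: f'_def)
  have "net V f' x = net V f x + of_bool (x = u) - of_bool (x = w)" if "x \<in> V" for x
    using assms(1-4) that unfolding net_def int_f' sum.distrib
    by (cases "x = u"; cases "x = w") (auto simp: of_bool_conj sum.delta sum_distrib_left[symmetric])
  moreover have "f' a b \<le> c a b" for a b using assms(5) True by (auto simp: f'_def)
  ultimately show ?thesis using that[of f'] by (simp add: f'_def)
next
  case False
  then have pos: "f w u > 0" using assms(6) by (simp add: residual_def)
  define f' where "f' = (\<lambda>a b. f a b - of_bool (a = w \<and> b = u))"
  have int_f': "int (f' a b) = int (f a b) - of_bool (a = w \<and> b = u)" for a b
    using pos by (auto simp: f'_def)
  have "net V f' x = net V f x + of_bool (x = u) - of_bool (x = w)" if "x \<in> V" for x
    using assms(1-4) that unfolding net_def int_f' sum_subtractf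
    by (cases "x = u"; cases "x = w") (auto simp: of_bool_conj sum.delta sum_distrib_left[symmetric])
  moreover have "f' a b \<le> c a b" for a b using assms(5)[of a b] by (simp add: f'_def)
  ultimately show ?thesis using that[of f'] by (simp add: f'_def)
qed

text \<open>A path without repetition never returns to \<open>u\<close>, so pushing over its first
  arc leaves the later residual arcs as they were.\<close>

lemma push_path:
  assumes "finite V" "distinct (u # ps)" "set (u # ps) \<subseteq> V" "successively (residual c f) (u # ps)"
    "\<And>a b. f a b \<le> c a b"
  shows "\<exists>f'. (\<forall>a b. f' a b \<le> c a b) \<and>
    (\<forall>x\<in>V. net V f' x = net V f x + of_bool (x = u) - of_bool (x = last (u # ps)))"
  using assms(2-)
proof (induction ps arbitrary: u f)
  case Nil
  then show ?case by (intro exI[of _ f]) auto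
next
  case (Cons w ps)
  obtain f1 where f1: "\<And>a b. f1 a b \<le> c a b"
    "\<And>x. x \<in> V \<Longrightarrow> net V f1 x = net V f x + of_bool (x = u) - of_bool (x = w)"
    "\<And>a b. a \<noteq> u \<Longrightarrow> b \<noteq> u \<Longrightarrow> f1 a b = f a b"
    using push_arc[of V u w f c] assms(1) Cons.prems by auto
  have "successively (residual c f1) (w # ps)"
  proof (rule successively_mono)
    show "successively (residual c f) (w # ps)" using Cons.prems(3) by simp
    show "residual c f1 a b" if "a \<in> set (w # ps)" "b \<in> set (w # ps)" "residual c f a b" for a b
    proof -
      have "a \<noteq> u" "b \<noteq> u" using that Cons.prems(1) by auto
      then show ?thesis using that(3) f1(3) by (simp add: residual_def)
    qed
  qed
  then obtain f' where "\<forall>a b. f' a b \<le> c a b"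
    "\<forall>x\<in>V. net V f' x = net V f1 x + of_bool (x = w) - of_bool (x = last (w # ps))"
    using Cons.IH[of w f1] Cons.prems f1(1) by auto
  then show ?case using f1(2) by (intro exI[of _ f']) auto
qed

lemma rtrancl_path_successively:
  "rtrancl_path r x xs y \<Longrightarrow> successively r (x # xs) \<and> last (x # xs) = y"
  by (induction rule: rtrancl_path.induct) (auto simp: successively_Cons)

text \<open>The value is raised to \<open>K\<close> one unit at a time, which avoids any argument
  about maximality. If a flow of value \<open>j < K\<close> had no augmenting path, the vertices
  residually reachable from \<open>s\<close> would form a cut of capacity \<open>j\<close>.\<close>

theorem max_flow_min_cut:
  assumes V: "finite V" "s \<in> V" "s \<noteq> t"
    and cut: "\<And>S. S \<subseteq> V \<Longrightarrow> s \<in> S \<Longrightarrow> t \<notin> S \<Longrightarrow> K \<le> cut V c S"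
  shows "\<exists>f. (\<forall>u v. f u v \<le> c u v) \<and> (\<forall>u\<in>V - {s, t}. net V f u = 0) \<and> net V f s = int K"
proof -
  have "\<exists>f. (\<forall>u v. f u v \<le> c u v) \<and> (\<forall>u\<in>V - {s, t}. net V f u = 0) \<and> net V f s = int j" if "j \<le> K" for j
    using that
  proof (induction j)
    case 0
    then show ?case by (intro exI[of _ "\<lambda>_ _. 0"]) (simp add: net_def)
  next
    case (Suc j)
    then obtain f where f: "\<And>u v. f u v \<le> c u v" "\<And>u. u \<in> V - {s, t} \<Longrightarrow> net V f u = 0"
      "net V f s = int j" by auto
    let ?r = "\<lambda>u v. residual c f u v \<and> v \<in> V"
    define S where "S = {u. ?r\<^sup>*\<^sup>* s u}"
    have S: "S \<subseteq> V" "s \<in> S"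
      using V(2) by (auto simp: S_def elim: rtranclp.cases)
    have "t \<in> S"
    proof (rule ccontr)
      assume "t \<notin> S"
      have sat: "f u v = c u v" "f v u = 0" if "u \<in> S" "v \<in> V - S" for u v
      proof -
        have "\<not> residual c f u v" using that by (auto simp: S_def dest: rtranclp.rtrancl_into_rtrancl)
        then show "f u v = c u v" "f v u = 0" using f(1)[of u v] by (auto simp: residual_def)
      qed
      have "net V f s = int (\<Sum>u\<in>S. \<Sum>v\<in>V - S. f u v) - int (\<Sum>u\<in>S. \<Sum>v\<in>V - S. f v u)"
        by (rule net_source_eq[OF V(1) S \<open>t \<notin> S\<close> f(2)])
      also have "(\<Sum>u\<in>S. \<Sum>v\<in>V - S. f u v) = cut V c S"
        unfolding cut_def by (intro sum.cong refl sat)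
      also have "(\<Sum>u\<in>S. \<Sum>v\<in>V - S. f v u) = 0"
        by (intro sum.neutral ballI) (use sat in auto)
      finally show False using cut[OF S \<open>t \<notin> S\<close>] f(3) Suc.prems by simp
    qed
    then obtain ps0 where ps0: "rtrancl_path ?r s ps0 t"
      unfolding S_def mem_Collect_eq rtranclp_eq_rtrancl_path by (elim exE)
    obtain ps where ps: "rtrancl_path ?r s ps t" "distinct (s # ps)"
      by (rule rtrancl_path_distinct[OF ps0])
    have "set ps \<subseteq> V" using rtrancl_path_Range[OF ps(1)] by auto
    moreover have r: "successively ?r (s # ps)" "last (s # ps) = t"
      using rtrancl_path_successively[OF ps(1)] by blast+
    moreover have "successively (residual c f) (s # ps)"
      by (rule successively_mono[OF r(1)]) simp
    ultimately obtain f' where "\<forall>a b. f' a b \<le> c a b"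
      "\<forall>x\<in>V. net V f' x = net V f x + of_bool (x = s) - of_bool (x = t)"
      using push_path[of V s ps c f] V ps(2) f(1) by auto
    then show ?case using f(2,3) V(2,3) by (intro exI[of _ f']) auto
  qed
  then show ?thesis by blast
qed

text \<open>
  A vertex \<open>u\<close> is split into \<open>(u, False)\<close> and \<open>(u, True)\<close>.  Of the flow that enters \<open>(u, False)\<close>,
  at most \<open>\<kappa> u\<close> units continue through \<open>(u, True)\<close> and the arcs of capacity \<open>c\<close>; the rest
  takes the arcs of capacity \<open>d\<close>.
\<close>

lemma node_capacitated_flow:
  assumes V: "finite V" "s \<in> V" "s \<noteq> t"
    and cut: "\<And>A B. A \<subseteq> V \<Longrightarrow> B \<subseteq> V \<Longrightarrow> s \<in> A \<Longrightarrow> t \<notin> A \<Longrightarrow>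
      K \<le> (\<Sum>u\<in>A - B. \<kappa> u) + (\<Sum>u\<in>A. \<Sum>w\<in>V - A. d u w) + (\<Sum>u\<in>B. \<Sum>w\<in>V - A. c u w)"
  obtains y z where "\<And>u w. y u w \<le> c u w" "\<And>u w. z u w \<le> d u w"
    "\<And>u. u \<in> V \<Longrightarrow> (\<Sum>w\<in>V. y u w) \<le> \<kappa> u"
    "\<And>u. u \<in> V - {s, t} \<Longrightarrow> net V (\<lambda>u w. y u w + z u w) u = 0"
    "net V (\<lambda>u w. y u w + z u w) s = int K"
proof -
  define W where "W = V \<times> (UNIV :: bool set)"
  define cc where "cc p q = (if snd q then (if \<not> snd p \<and> fst p = fst q then \<kappa> (fst p) else 0)
    else if snd p then c (fst p) (fst q) else d (fst p) (fst q))" for p q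
  have sum_W: "(\<Sum>q\<in>W. g q) = (\<Sum>v\<in>V. g (v, False)) + (\<Sum>v\<in>V. g (v, True))"
    for g :: "_ \<Rightarrow> 'b :: comm_monoid_add"
  proof -
    have "(\<Sum>q\<in>W. g q) = (\<Sum>v\<in>V. \<Sum>b\<in>UNIV. g (v, b))"
      unfolding W_def by (simp add: sum.cartesian_product)
    then show ?thesis by (simp add: UNIV_bool sum.distrib)
  qed
  have "\<exists>f. (\<forall>u v. f u v \<le> cc u v) \<and> (\<forall>u\<in>W - {(s, False), (t, False)}. net W f u = 0) \<and>
    net W f (s, False) = int K"
  proof (rule max_flow_min_cut)
    show "finite W" "(s, False) \<in> W" "(s, False) \<noteq> (t, False)"
      using V by (auto simp: W_def)
    fix S assume S: "S \<subseteq> W" "(s, False) \<in> S" "(t, False) \<notin> S"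
    \<comment> \<open>\<open>A\<close> collects the entrances and \<open>B\<close> the exits in
      \<open>S\<close>. The arcs leaving \<open>S\<close> are the passages through vertices of
      \<open>A - B\<close>, the arcs with capacity \<open>d\<close> from \<open>A\<close>, and those
      with capacity \<open>c\<close> from \<open>B\<close>, the latter two ending in
      \<open>V - A\<close>.\<close>
    define A where "A = {v. (v, False) \<in> S}"
    define B where "B = {v. (v, True) \<in> S}"
    have AB: "A \<subseteq> V" "B \<subseteq> V" "s \<in> A" "t \<notin> A" using S by (auto simp: A_def B_def W_def)
    then have fin: "finite A" "finite B" using V(1) finite_subset by auto
    have eqS: "S = (\<lambda>v. (v, False)) ` A \<union> (\<lambda>v. (v, True)) ` B"
      by (auto simp: A_def B_def image_iff) (metis (full_types))
    have eqW: "W - S = (\<lambda>v. (v, False)) ` (V - A) \<union> (\<lambda>v. (v, True)) ` (V - B)"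
      by (auto simp: A_def B_def W_def image_iff) (metis (full_types))
    have sum_S: "(\<Sum>q\<in>S. g q) = (\<Sum>v\<in>A. g (v, False)) + (\<Sum>v\<in>B. g (v, True))" for g :: "_ \<Rightarrow> nat"
      unfolding eqS using fin by (subst sum.union_disjoint) (auto simp: sum.reindex inj_on_def)
    have sum_WS: "(\<Sum>q\<in>W - S. g q) = (\<Sum>v\<in>V - A. g (v, False)) + (\<Sum>v\<in>V - B. g (v, True))"
      for g :: "_ \<Rightarrow> nat"
      unfolding eqW using V(1) by (subst sum.union_disjoint) (auto simp: sum.reindex inj_on_def)
    have "(\<Sum>u\<in>A. \<Sum>v\<in>V - B. if u = v then \<kappa> u else 0) = (\<Sum>u\<in>A. if u \<in> V - B then \<kappa> u else 0)"
      using V(1) by (intro sum.cong refl) (simp add: sum.delta)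
    also have "\<dots> = (\<Sum>u\<in>A - B. \<kappa> u)"
      using fin AB by (subst sum.inter_restrict[symmetric]) (auto intro!: sum.cong)
    finally have "cut W cc S = (\<Sum>u\<in>A - B. \<kappa> u) + (\<Sum>u\<in>A. \<Sum>w\<in>V - A. d u w) + (\<Sum>u\<in>B. \<Sum>w\<in>V - A. c u w)"
      unfolding cut_def sum_S sum_WS by (simp add: cc_def sum.distrib cong: if_cong)
    with cut[OF AB] show "K \<le> cut W cc S" by simp
  qed
  then obtain f where f: "\<And>p q. f p q \<le> cc p q"
    "\<And>p. p \<in> W - {(s, False), (t, False)} \<Longrightarrow> net W f p = 0" "net W f (s, False) = int K" by blast
  define y where "y u w = f (u, True) (w, False)" for u w
  define z where "z u w = f (u, False) (w, False)" for u w
  have f0: "f (u, b) (w, True) = 0" if "b \<or> u \<noteq> w" for u w b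
    using f(1)[of "(u, b)" "(w, True)"] that by (auto simp: cc_def)
  have diag: "(\<Sum>w\<in>V. int (f (u, False) (w, True))) = int (f (u, False) (u, True))"
    "(\<Sum>w\<in>V. int (f (w, False) (u, True))) = int (f (u, False) (u, True))" if "u \<in> V" for u
  proof -
    let ?X = "int (f (u, False) (u, True))"
    have "(\<Sum>w\<in>V. int (f (u, False) (w, True))) = (\<Sum>w\<in>V. if w = u then ?X else 0)"
      "(\<Sum>w\<in>V. int (f (w, False) (u, True))) = (\<Sum>w\<in>V. if w = u then ?X else 0)"
      using f0[of False u] f0[of False _ u] by (intro sum.cong refl; auto)+
    then show "(\<Sum>w\<in>V. int (f (u, False) (w, True))) = ?X"
      "(\<Sum>w\<in>V. int (f (w, False) (u, True))) = ?X"
      using that V(1) by (simp_all add: sum.delta)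
  qed
  have out: "(\<Sum>w\<in>V. int (y u w)) = int (f (u, False) (u, True))" if "u \<in> V" for u
  proof -
    have "net W f (u, True) = 0" using that by (intro f(2)) (auto simp: W_def)
    then show ?thesis
      unfolding net_def sum_W using diag(2)[OF that] f0 by (simp add: y_def)
  qed
  have net: "net V (\<lambda>u w. y u w + z u w) u = net W f (u, False)" if "u \<in> V" for u
    unfolding net_def sum_W using diag(1)[OF that] out[OF that]
    by (simp add: sum.distrib) (simp add: y_def z_def)
  show thesis
  proof (rule that[of y z])
    show "y u w \<le> c u w" "z u w \<le> d u w" for u w
      using f(1)[of "(u, True)" "(w, False)"] f(1)[of "(u, False)" "(w, False)"]
      by (auto simp: cc_def y_def z_def)
    show "(\<Sum>w\<in>V. y u w) \<le> \<kappa> u" if "u \<in> V" for u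
    proof -
      have "int (\<Sum>w\<in>V. y u w) = int (f (u, False) (u, True))"
        using out[OF that] by (simp only: of_nat_sum)
      then have "(\<Sum>w\<in>V. y u w) = f (u, False) (u, True)" by (simp only: of_nat_eq_iff)
      then show ?thesis using f(1)[of "(u, False)" "(u, True)"] by (simp add: cc_def)
    qed
    show "net V (\<lambda>u w. y u w + z u w) u = 0" if "u \<in> V - {s, t}" for u
      using net[of u] f(2)[of "(u, False)"] that by (auto simp: W_def)
    show "net V (\<lambda>u w. y u w + z u w) s = int K" using net[OF V(2)] f(3) by simp
  qed
qed

section \<open>Flows with few arcs leaving each vertex\<close>

definition bounded_flow ::
  "'v set \<Rightarrow> ('v \<Rightarrow> 'v \<Rightarrow> nat) \<Rightarrow> 'v \<Rightarrow> 'v \<Rightarrow> nat \<Rightarrow> ('v \<Rightarrow> 'v \<Rightarrow> nat) \<Rightarrow> bool" where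
  "bounded_flow V c s t k x \<longleftrightarrow> (\<forall>u v. x u v \<le> c u v) \<and> (\<forall>u\<in>V - {s, t}. net V x u = 0) \<and>
     int (k + 1) \<le> net V x s \<and> (\<forall>u\<in>V. card {v\<in>V. x u v > 0} \<le> k)"

text \<open>The vertex becomes isolated but stays in \<open>V\<close>, so all sums and cuts refer to
  the same vertex set.\<close>

definition delete_vertex :: "'v \<Rightarrow> ('v \<Rightarrow> 'v \<Rightarrow> nat) \<Rightarrow> 'v \<Rightarrow> 'v \<Rightarrow> nat" where
  "delete_vertex v c p q = (if p = v \<or> q = v then 0 else c p q)"

definition arcs_above :: "nat \<Rightarrow> 'v set \<Rightarrow> ('v \<Rightarrow> 'v \<Rightarrow> nat) \<Rightarrow> ('v \<times> 'v) set" where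
  "arcs_above m V c = {(p, q). p \<in> V \<and> q \<in> V \<and> m < c p q}"

lemma rtrancl_exit:
  assumes "(a, b) \<in> r\<^sup>*" "a \<in> S" "b \<notin> S"
  obtains p q where "(p, q) \<in> r" "p \<in> S" "q \<notin> S"
proof -
  from assms have "\<exists>p q. (p, q) \<in> r \<and> p \<in> S \<and> q \<notin> S"
    by (induction rule: rtrancl_induct) blast+
  then show ?thesis using that by blast
qed

lemma arcs_above_rtrancl_subset: "a \<in> V \<Longrightarrow> (arcs_above m V c)\<^sup>* `` {a} \<subseteq> V"
  by (auto simp: arcs_above_def elim: rtrancl.cases)

text \<open>No arc of positive capacity leaves the set of vertices reachable from \<open>a\<close>,
  so this set has a cut of capacity 0.\<close>

lemma cut_pos_imp_reachable:
  assumes V: "finite V" "a \<in> V" "\<And>S. S \<subseteq> V \<Longrightarrow> a \<in> S \<Longrightarrow> b \<notin> S \<Longrightarrow> 0 < cut V c S"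
  shows "(a, b) \<in> (arcs_above 0 V c)\<^sup>*"
proof (rule ccontr)
  let ?S = "(arcs_above 0 V c)\<^sup>* `` {a}"
  assume "(a, b) \<notin> (arcs_above 0 V c)\<^sup>*"
  then have "0 < cut V c ?S" using arcs_above_rtrancl_subset[OF V(2)] by (intro V(3)) auto
  then obtain p q where "p \<in> ?S" "q \<in> V - ?S" "c p q > 0"
    unfolding cut_def by (metis (no_types, lifting) bot_nat_0.not_eq_extremum sum.neutral)
  moreover have "p \<in> V" using \<open>p \<in> ?S\<close> arcs_above_rtrancl_subset[OF V(2)] by blast
  ultimately have "(p, q) \<in> arcs_above 0 V c" by (simp add: arcs_above_def)
  with \<open>p \<in> ?S\<close> \<open>q \<in> V - ?S\<close> show False by (auto dest: rtrancl_into_rtrancl)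
qed

lemma sum_UNION_le:
  fixes g :: "'b \<Rightarrow> nat"
  assumes "finite I" "\<And>i. i \<in> I \<Longrightarrow> finite (S i)"
  shows "(\<Sum>x\<in>(\<Union>i\<in>I. S i). g x) \<le> (\<Sum>i\<in>I. \<Sum>x\<in>S i. g x)"
  using assms
proof (induction I rule: finite_induct)
  case (insert i I)
  have "(\<Sum>x\<in>S i \<union> (\<Union>i\<in>I. S i). g x) \<le> (\<Sum>x\<in>S i. g x) + (\<Sum>x\<in>(\<Union>i\<in>I. S i). g x)"
    using insert by (subst sum_Un_nat) auto
  then show ?case using insert by fastforce
qed simp

lemma bounded_flow_cut:
  assumes "finite V" "bounded_flow V c s t k x" "S \<subseteq> V" "s \<in> S" "t \<notin> S"
  shows "k < cut V c S"
proof -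
  have "int (k + 1) \<le> net V x s" using assms(2) by (simp add: bounded_flow_def)
  also have "\<dots> \<le> int (\<Sum>u\<in>S. \<Sum>v\<in>V - S. x u v)"
    using assms by (intro net_source_le) (auto simp: bounded_flow_def)
  also have "\<dots> \<le> int (cut V c S)"
    unfolding cut_def using assms(2) by (intro of_nat_mono sum_mono) (auto simp: bounded_flow_def)
  finally show ?thesis by simp
qed

text \<open>
  If all the flow passes through \<open>v\<close>, then it leaves \<open>v\<close> along an arc carrying two units.  Were each
  head \<open>w\<close> of such an arc separated from \<open>t\<close> by a single unit, then at most \<open>k\<close> units would leave
  the union of the separating sets, \<open>v\<close>, and the vertices reachable from \<open>s\<close> without \<open>v\<close>.
\<close>

lemma bounded_flow_cut_vertex:
  assumes V: "finite V" "s \<in> V" and x: "bounded_flow V c s t k x"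
    and v: "v \<in> V" "v \<noteq> t" "(s, t) \<notin> (arcs_above 0 V (delete_vertex v c))\<^sup>*"
  shows "\<exists>w\<in>V. 2 \<le> c v w \<and> (\<forall>S\<subseteq>V. w \<in> S \<longrightarrow> t \<notin> S \<longrightarrow> 1 < cut V (delete_vertex v c) S)"
proof (rule ccontr)
  assume neg: "\<not> ?thesis"
  let ?c = "delete_vertex v c"
  have xc: "x p q \<le> c p q" for p q using x by (simp add: bounded_flow_def)
  define W where "W = {w\<in>V. 2 \<le> x v w}"
  define N where "N = {w\<in>V. x v w > 0}"
  have "\<exists>S\<subseteq>V. w \<in> S \<and> t \<notin> S \<and> cut V ?c S \<le> 1" if "w \<in> W" for w
    using neg that order_trans[OF _ xc[of v w], of 2] by (auto simp: W_def not_less)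
  then obtain S where S: "\<And>w. w \<in> W \<Longrightarrow> S w \<subseteq> V \<and> w \<in> S w \<and> t \<notin> S w \<and> cut V ?c (S w) \<le> 1"
    by metis
  have fin: "finite W" "finite N" "W \<subseteq> N" using V by (auto simp: W_def N_def)
  have finS: "finite (S w)" if "w \<in> W" for w using S[OF that] V(1) finite_subset by blast
  define X where "X = (arcs_above 0 V ?c)\<^sup>* `` {s} - {v}"
  define U where "U = insert v (X \<union> (\<Union>w\<in>W. S w))"
  have X: "X \<subseteq> V" using arcs_above_rtrancl_subset[OF V(2)] by (auto simp: X_def)
  have U: "U \<subseteq> V" "s \<in> U" "t \<notin> U" using X S v by (auto simp: U_def X_def)
  \<comment> \<open>\<open>g p\<close> is what \<open>p\<close> sends out of \<open>U\<close>:
    nothing for \<open>p\<close> in \<open>X\<close>, whose positive arcs lead to \<open>X\<close>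
    or \<open>v\<close>; at most one unit in total for each \<open>S w\<close> without
    \<open>v\<close>; and for \<open>v\<close> at most one unit per head in \<open>N - W\<close>,
    since \<open>W\<close> lies inside \<open>U\<close>. Together this is at most
    \<open>card N\<close>, hence at most \<open>k\<close>.\<close>
  define g where "g p = (\<Sum>q\<in>V - U. x p q)" for p
  have gX: "g p = 0" if "p \<in> X" for p
    unfolding g_def
  proof (intro sum.neutral ballI)
    fix q assume q: "q \<in> V - U"
    have "(p, q) \<notin> arcs_above 0 V ?c"
    proof
      assume "(p, q) \<in> arcs_above 0 V ?c"
      then have "q \<in> insert v X" using that by (auto simp: X_def dest: rtrancl_into_rtrancl)
      then show False using q by (auto simp: U_def)
    qed
    moreover have "p \<in> V" "q \<in> V" "p \<noteq> v" "q \<noteq> v" using that q X by (auto simp: X_def U_def)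
    ultimately show "x p q = 0" using xc[of p q] by (auto simp: arcs_above_def delete_vertex_def)
  qed
  have gS: "(\<Sum>p\<in>S w - {v}. g p) \<le> 1" if "w \<in> W" for w
  proof -
    have "(\<Sum>p\<in>S w - {v}. g p) \<le> (\<Sum>p\<in>S w - {v}. \<Sum>q\<in>V - S w. ?c p q)"
    proof (rule sum_mono)
      fix p assume p: "p \<in> S w - {v}"
      have "g p \<le> (\<Sum>q\<in>V - U. ?c p q)"
        unfolding g_def using p xc by (intro sum_mono) (auto simp: delete_vertex_def U_def)
      also have "\<dots> \<le> (\<Sum>q\<in>V - S w. ?c p q)"
        using that V(1) by (intro sum_mono2) (auto simp: U_def)
      finally show "g p \<le> (\<Sum>q\<in>V - S w. ?c p q)" .
    qed
    also have "\<dots> \<le> cut V ?c (S w)"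
      unfolding cut_def using finS[OF that] by (intro sum_mono2) auto
    finally show ?thesis using S[OF that] by simp
  qed
  have gv: "g v \<le> card (N - W)"
  proof -
    have "x v q \<le> of_bool (q \<in> N - W)" if "q \<in> V - U" for q
    proof -
      have "q \<notin> W" using that S by (auto simp: U_def)
      then show ?thesis using that by (auto simp: W_def N_def not_le)
    qed
    then have "g v \<le> (\<Sum>q\<in>V - U. of_bool (q \<in> N - W))" unfolding g_def by (rule sum_mono)
    also have "\<dots> = card ((V - U) \<inter> {q. q \<in> N - W})"
      using V(1) by (simp only: sum_of_bool_eq finite_Diff of_nat_id)
    also have "\<dots> \<le> card (N - W)" using fin by (intro card_mono) auto
    finally show ?thesis .
  qed
  let ?D = "\<Union>w\<in>W. S w - {v}"
  have "U = insert v (X \<union> ?D)" by (auto simp: U_def)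
  have finXD: "finite X" "finite ?D" using X V(1) finite_subset fin(1) finS by auto
  have "v \<notin> X \<union> ?D" by (auto simp: X_def)
  then have "(\<Sum>p\<in>U. g p) = g v + (\<Sum>p\<in>X \<union> ?D. g p)"
    unfolding \<open>U = insert v (X \<union> ?D)\<close> using finXD by simp
  also have "(\<Sum>p\<in>X \<union> ?D. g p) \<le> (\<Sum>p\<in>X. g p) + (\<Sum>p\<in>?D. g p)"
    using finXD by (subst sum_Un_nat) auto
  also have "(\<Sum>p\<in>X. g p) = 0" using gX by simp
  also have "(\<Sum>p\<in>?D. g p) \<le> (\<Sum>w\<in>W. \<Sum>p\<in>S w - {v}. g p)"
    using fin finS by (intro sum_UNION_le) auto
  also have "\<dots> \<le> (\<Sum>w\<in>W. 1)" using gS by (rule sum_mono)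
  also have "g v + (0 + (\<Sum>w\<in>W. 1)) \<le> card (N - W) + card W" using gv by simp
  also have "\<dots> = card N" using fin by (simp add: card_Diff_subset finite_subset card_mono)
  also have "\<dots> \<le> k" using x v(1) by (simp add: bounded_flow_def N_def)
  finally have "(\<Sum>p\<in>U. g p) \<le> k" by simp
  moreover have "int (k + 1) \<le> int (\<Sum>p\<in>U. g p)"
    using net_source_le[OF V(1) U, of x] x unfolding g_def by (auto simp: bounded_flow_def)
  ultimately show False by simp
qed

text \<open>Suppose that each of \<open>u\<close>, \<open>v\<close> reaches \<open>t\<close> without
  the other. Then \<open>s\<close> reaches neither of them without the other, as this would give a
  path from \<open>s\<close> to \<open>t\<close> missing a cut vertex. But whichever comes first on
  a path from \<open>s\<close> is reached without the other, so no path from \<open>s\<close> meets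
  either, contrary to \<open>u\<close> being a cut vertex.\<close>

lemma cut_vertices_ordered:
  assumes st: "(s, t) \<in> (arcs_above 0 V c)\<^sup>*" and "u \<noteq> v"
    and u: "(s, t) \<notin> (arcs_above 0 V (delete_vertex u c))\<^sup>*"
    and v: "(s, t) \<notin> (arcs_above 0 V (delete_vertex v c))\<^sup>*"
  shows "(u, t) \<notin> (arcs_above 0 V (delete_vertex v c))\<^sup>* \<or>
    (v, t) \<notin> (arcs_above 0 V (delete_vertex u c))\<^sup>*"
proof (rule ccontr)
  let ?Eu = "arcs_above 0 V (delete_vertex u c)" and ?Ev = "arcs_above 0 V (delete_vertex v c)"
  assume "\<not> ?thesis"
  then have su: "(s, u) \<notin> ?Ev\<^sup>*" and sv: "(s, v) \<notin> ?Eu\<^sup>*"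
    using u v by (auto dest: rtrancl_trans)
  define F where "F = ?Eu \<inter> ?Ev"
  have F: "(s, y) \<in> ?Eu\<^sup>* \<and> (s, y) \<in> ?Ev\<^sup>*" if "(s, y) \<in> F\<^sup>*" for y
    using that rtrancl_mono[of F ?Eu] rtrancl_mono[of F ?Ev] by (auto simp: F_def)
  have "(s, y) \<in> F\<^sup>*" if "(s, y) \<in> (arcs_above 0 V c)\<^sup>*" for y
    using that
  proof (induction rule: rtrancl_induct)
    case (step y z)
    from F[OF step.IH] have y: "(s, y) \<in> ?Eu\<^sup>*" "(s, y) \<in> ?Ev\<^sup>*" by auto
    with su sv have "y \<noteq> u" "y \<noteq> v" by auto
    have "z \<noteq> u"
    proof
      assume "z = u"
      with step \<open>y \<noteq> v\<close> \<open>u \<noteq> v\<close> have "(y, z) \<in> ?Ev" by (auto simp: arcs_above_def delete_vertex_def)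
      with y(2) su \<open>z = u\<close> show False by (auto dest: rtrancl_into_rtrancl)
    qed
    moreover have "z \<noteq> v"
    proof
      assume "z = v"
      with step \<open>y \<noteq> u\<close> \<open>u \<noteq> v\<close> have "(y, z) \<in> ?Eu" by (auto simp: arcs_above_def delete_vertex_def)
      with y(1) sv \<open>z = v\<close> show False by (auto dest: rtrancl_into_rtrancl)
    qed
    ultimately have "(y, z) \<in> F"
      using step \<open>y \<noteq> u\<close> \<open>y \<noteq> v\<close> by (auto simp: F_def arcs_above_def delete_vertex_def)
    with step.IH show ?case by (rule rtrancl_into_rtrancl)
  qed simp
  with st F u show False by blast
qed

text \<open>Every vertex on a path to \<open>t\<close> reaches \<open>t\<close> along the rest of
  the path, so \<open>u\<close> is not on it.\<close>

lemma rtrancl_avoiding: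
  assumes "(a, t) \<in> (arcs_above 0 V (delete_vertex v c))\<^sup>*"
    and "(u, t) \<notin> (arcs_above 0 V (delete_vertex v c))\<^sup>*"
  shows "(a, t) \<in> (arcs_above 0 V (delete_vertex u (delete_vertex v c)))\<^sup>*"
  using assms(1)
proof (induction rule: converse_rtrancl_induct)
  case (step y z)
  then have "y \<noteq> u" "z \<noteq> u" using assms(2) by (auto dest: converse_rtrancl_into_rtrancl)
  with step(1) have "(y, z) \<in> arcs_above 0 V (delete_vertex u (delete_vertex v c))"
    by (auto simp: arcs_above_def delete_vertex_def)
  with step.IH show ?case by (rule converse_rtrancl_into_rtrancl[rotated])
qed simp

lemma bounded_flow_exists:
  assumes V: "finite V" "s \<in> V" "s \<noteq> t" and k: "k \<ge> 2"
    and cut: "\<And>S. S \<subseteq> V \<Longrightarrow> s \<in> S \<Longrightarrow> t \<notin> S \<Longrightarrow> k < cut V c S"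
    and cut_vertex: "\<And>v. v \<in> V \<Longrightarrow> v \<noteq> t \<Longrightarrow> (s, t) \<notin> (arcs_above 0 V (delete_vertex v c))\<^sup>* \<Longrightarrow>
      \<exists>w\<in>V. 2 \<le> c v w \<and> (\<forall>S\<subseteq>V. w \<in> S \<longrightarrow> t \<notin> S \<longrightarrow> 1 < cut V (delete_vertex v c) S)"
  shows "\<exists>x. bounded_flow V c s t k x"
proof -
  define C where "C = {v\<in>V. v \<noteq> t \<and> (s, t) \<notin> (arcs_above 0 V (delete_vertex v c))\<^sup>*}"
  obtain h where h: "\<And>v. v \<in> C \<Longrightarrow> h v \<in> V \<and> 2 \<le> c v (h v) \<and>
      (\<forall>S\<subseteq>V. h v \<in> S \<longrightarrow> t \<notin> S \<longrightarrow> 1 < cut V (delete_vertex v c) S)"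
    using cut_vertex unfolding C_def by (simp only: mem_Collect_eq) metis
  \<comment> \<open>The arc to \<open>h v\<close> takes one of the \<open>k\<close> arcs allowed at
    a cut vertex, which leaves \<open>k - 1\<close> for the other units.\<close>
  define \<kappa> where "\<kappa> v = (if v \<in> C then k - 1 else k)" for v
  define d where "d v w = (if v \<in> C \<and> w = h v then 2 else 0 :: nat)" for v w
  have dc: "d v w \<le> c v w" for v w using h[of v] by (auto simp: d_def)
  have st: "(s, t) \<in> (arcs_above 0 V c)\<^sup>*"
    by (rule cut_pos_imp_reachable[OF V(1,2)]) (rule le_less_trans[OF le0 cut])
  have h_reach: "(h v, t) \<in> (arcs_above 0 V (delete_vertex v c))\<^sup>*" if "v \<in> C" for v
  proof (rule cut_pos_imp_reachable[OF V(1)])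
    show "h v \<in> V" using h[OF that] by blast
    fix S assume "S \<subseteq> V" "h v \<in> S" "t \<notin> S"
    then have "1 < cut V (delete_vertex v c) S" using h[OF that] by blast
    then show "0 < cut V (delete_vertex v c) S" by simp
  qed
  obtain y z where yz: "\<And>u w. y u w \<le> c u w - d u w" "\<And>u w. z u w \<le> d u w"
    "\<And>u. u \<in> V \<Longrightarrow> (\<Sum>w\<in>V. y u w) \<le> \<kappa> u"
    "\<And>u. u \<in> V - {s, t} \<Longrightarrow> net V (\<lambda>u w. y u w + z u w) u = 0"
    "net V (\<lambda>u w. y u w + z u w) s = int (k + 1)"
  proof (rule node_capacitated_flow[OF V])
    fix A B assume AB: "A \<subseteq> V" "B \<subseteq> V" "s \<in> A" "t \<notin> A"
    let ?out = "\<lambda>p. \<Sum>q\<in>V - A. c p q"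
    \<comment> \<open>\<open>g p\<close> is the share of \<open>p\<close> in the capacity of the
      cut. A vertex of \<open>B\<close> pays for its arcs leaving \<open>A\<close>; any other pays
      its own capacity and its reserved arc if that leaves \<open>A\<close>.\<close>
    define g where "g p = (if p \<in> B then ?out p else \<kappa> p + (\<Sum>q\<in>V - A. d p q))" for p
    have fin: "finite A" "finite B" using AB V(1) finite_subset by auto
    have total: "(\<Sum>p\<in>A. g p) \<le> (\<Sum>u\<in>A - B. \<kappa> u) + (\<Sum>u\<in>A. \<Sum>w\<in>V - A. d u w) +
        (\<Sum>u\<in>B. \<Sum>w\<in>V - A. c u w - d u w)"
    proof -
      have "(\<Sum>p\<in>A. g p) = (\<Sum>p\<in>A. (if p \<in> A - B then \<kappa> p else 0) + (\<Sum>q\<in>V - A. d p q) +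
          (if p \<in> A \<inter> B then \<Sum>q\<in>V - A. c p q - d p q else 0))"
      proof (rule sum.cong[OF refl])
        fix p assume "p \<in> A"
        have "?out p = (\<Sum>q\<in>V - A. d p q) + (\<Sum>q\<in>V - A. c p q - d p q)"
          unfolding sum.distrib[symmetric] using dc by simp
        with \<open>p \<in> A\<close> show "g p = (if p \<in> A - B then \<kappa> p else 0) + (\<Sum>q\<in>V - A. d p q) +
          (if p \<in> A \<inter> B then \<Sum>q\<in>V - A. c p q - d p q else 0)"
          by (simp add: g_def)
      qed
      also have "\<dots> = (\<Sum>p\<in>A - B. \<kappa> p) + (\<Sum>p\<in>A. \<Sum>q\<in>V - A. d p q) +
          (\<Sum>p\<in>A \<inter> B. \<Sum>q\<in>V - A. c p q - d p q)"
      proof -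
        have "(\<Sum>p\<in>A. if p \<in> A - B then \<kappa> p else 0) = (\<Sum>p\<in>A - B. \<kappa> p)"
          using fin by (intro sum.mono_neutral_cong_right) auto
        moreover have "(\<Sum>p\<in>A. if p \<in> A \<inter> B then \<Sum>q\<in>V - A. c p q - d p q else 0) =
            (\<Sum>p\<in>A \<inter> B. \<Sum>q\<in>V - A. c p q - d p q)"
          using fin by (intro sum.mono_neutral_cong_right) auto
        ultimately show ?thesis unfolding sum.distrib by (simp only:)
      qed
      also have "(\<Sum>p\<in>A \<inter> B. \<Sum>q\<in>V - A. c p q - d p q) \<le> (\<Sum>p\<in>B. \<Sum>q\<in>V - A. c p q - d p q)"
        using fin by (intro sum_mono2) auto
      finally show ?thesis by simp
    qed
    have g_B: "g p = ?out p" if "p \<in> B" for p using that by (simp add: g_def)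
    have g_notC: "k \<le> g p" if "p \<notin> B" "p \<notin> C" for p using that by (simp add: g_def \<kappa>_def)
    have g_C: "k - 1 \<le> g p" if "p \<notin> B" for p using that by (auto simp: g_def \<kappa>_def)
    have g_h: "k + 1 \<le> g p" if "p \<notin> B" "p \<in> C" "h p \<notin> A" for p
    proof -
      have "d p (h p) \<le> (\<Sum>q\<in>V - A. d p q)" using V(1) h that by (intro member_le_sum) auto
      then show ?thesis using that k by (simp add: g_def \<kappa>_def d_def)
    qed
    have g_arc: "1 \<le> g p" if "q \<in> V - A" "c p q > 0" for p q
    proof (cases "p \<in> B")
      case True
      have "c p q \<le> ?out p" using V(1) that by (intro member_le_sum) auto
      then show ?thesis using that True by (simp add: g_def)
    next
      case False
      then show ?thesis using g_C[of p] k by simp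
    qed
    have g_sub: "(\<Sum>p\<in>P. g p) \<le> (\<Sum>p\<in>A. g p)" if "P \<subseteq> A" for P
      using that fin by (intro sum_mono2) auto
    have "k + 1 \<le> (\<Sum>p\<in>A. g p)"
    proof (cases "A \<subseteq> B")
      case True
      then have "(\<Sum>p\<in>A. g p) = cut V c A" unfolding cut_def by (intro sum.cong) (auto simp: g_B)
      then show ?thesis using cut[OF AB(1,3,4)] by simp
    next
      case notsub: False
      show ?thesis
      proof (cases "A - B \<subseteq> C")
        case False
        \<comment> \<open>This vertex pays \<open>k\<close>, and a path that avoids it leaves
          \<open>A\<close> at another vertex, which pays the missing unit.\<close>
        then obtain u where u: "u \<in> A" "u \<notin> B" "u \<notin> C" by blast
        then have "(s, t) \<in> (arcs_above 0 V (delete_vertex u c))\<^sup>*"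
          using AB by (auto simp: C_def)
        then obtain p q where pq: "(p, q) \<in> arcs_above 0 V (delete_vertex u c)" "p \<in> A" "q \<notin> A"
          using AB(3,4) by (rule rtrancl_exit)
        then have "p \<noteq> u" "c p q > 0" "q \<in> V - A"
          by (auto simp: arcs_above_def delete_vertex_def split: if_splits)
        with g_arc[of q p] g_notC[of u] u g_sub[of "{u, p}"] pq show ?thesis by simp
      next
        case True
        show ?thesis
        proof (cases "\<exists>u\<in>A - B. h u \<notin> A")
          case True
          then obtain u where u: "u \<in> A" "u \<notin> B" "h u \<notin> A" by blast
          with \<open>A - B \<subseteq> C\<close> g_h[of u] g_sub[of "{u}"] show ?thesis by auto
        next
          case False
          then have hA: "h u \<in> A" if "u \<in> A - B" for u using that by blast
          from notsub obtain u where u: "u \<in> A" "u \<notin> B" by blast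
          then have uC: "u \<in> C" using True by blast
          show ?thesis
          proof (cases "A - B = {u}")
            case one: True
            \<comment> \<open>All vertices of \<open>A\<close> other than \<open>u\<close> belong to
              \<open>B\<close> and pay their full arcs. As \<open>h u\<close> lies in
              \<open>A\<close>, these arcs carry the two units that \<open>u\<close> lacks.\<close>
            have "1 < cut V (delete_vertex u c) A" using h[OF uC] hA[of u] u AB by blast
            also have "\<dots> = (\<Sum>p\<in>A - {u}. \<Sum>q\<in>V - A. delete_vertex u c p q)"
              unfolding cut_def using fin
              by (intro sum.mono_neutral_right) (auto simp: delete_vertex_def)
            also have "\<dots> \<le> (\<Sum>p\<in>A - {u}. g p)"
            proof (rule sum_mono)
              fix p assume "p \<in> A - {u}"
              then have "p \<in> B" using one by blast
              then show "(\<Sum>q\<in>V - A. delete_vertex u c p q) \<le> g p"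
                unfolding g_B[OF \<open>p \<in> B\<close>] by (intro sum_mono) (simp add: delete_vertex_def)
            qed
            also have "(\<Sum>p\<in>A. g p) = g u + (\<Sum>p\<in>A - {u}. g p)"
              using fin u by (simp add: sum.remove)
            ultimately show ?thesis using g_C[OF u(2)] k by linarith
          next
            case False
            then obtain v where v: "v \<in> A" "v \<notin> B" "v \<noteq> u" using u by blast
            then have vC: "v \<in> C" using True by blast
            \<comment> \<open>The two cut vertices pay \<open>2 * (k - 1)\<close>, which falls short
              of \<open>k + 1\<close> by at most one unit since \<open>k \<ge> 2\<close>.\<close>
            have third: ?thesis if "p \<in> A" "p \<noteq> u" "p \<noteq> v" "1 \<le> g p" for p
            proof -
              have "g u + (g v + g p) \<le> (\<Sum>p\<in>A. g p)"
                using g_sub[of "{u, v, p}"] u v that by simp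
              then show ?thesis using g_C[OF u(2)] g_C[OF v(2)] that(4) k by linarith
            qed
            \<comment> \<open>A path from \<open>h a\<close> to \<open>t\<close> without
              \<open>a\<close> cannot use \<open>b\<close>, as \<open>b\<close> does not reach
              \<open>t\<close> without \<open>a\<close>. It starts in \<open>A\<close> and leaves it
              at a third vertex.\<close>
            have exit: ?thesis if a: "a \<in> {u, v}" "b \<in> {u, v}" "a \<noteq> b" "a \<in> C" "a \<in> A - B"
              and "(b, t) \<notin> (arcs_above 0 V (delete_vertex a c))\<^sup>*" for a b
            proof -
              have "(h a, t) \<in> (arcs_above 0 V (delete_vertex b (delete_vertex a c)))\<^sup>*"
                by (rule rtrancl_avoiding[OF h_reach]) (use that in auto)
              then obtain p q where pq: "(p, q) \<in> arcs_above 0 V (delete_vertex b (delete_vertex a c))"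
                "p \<in> A" "q \<notin> A"
                using hA[OF a(5)] AB(4) by (rule rtrancl_exit)
              then have "p \<noteq> a" "p \<noteq> b" "c p q > 0" "q \<in> V - A"
                by (auto simp: arcs_above_def delete_vertex_def split: if_splits)
              then show ?thesis using a(1-3) pq(2) g_arc[of q p] by (intro third[of p]) auto
            qed
            have "(u, t) \<notin> (arcs_above 0 V (delete_vertex v c))\<^sup>* \<or>
              (v, t) \<notin> (arcs_above 0 V (delete_vertex u c))\<^sup>*"
              using cut_vertices_ordered[OF st] uC vC v(3) by (auto simp: C_def)
            then show ?thesis using exit[of v u] exit[of u v] u v uC vC by auto
          qed
        qed
      qed
    qed
    with total show "k + 1 \<le> (\<Sum>u\<in>A - B. \<kappa> u) + (\<Sum>u\<in>A. \<Sum>w\<in>V - A. d u w) +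
        (\<Sum>u\<in>B. \<Sum>w\<in>V - A. c u w - d u w)" by linarith
  qed blast
  let ?x = "\<lambda>u w. y u w + z u w"
  have "?x u w \<le> c u w" for u w using yz(1)[of u w] yz(2)[of u w] dc[of u w] by linarith
  moreover have "card {w\<in>V. ?x u w > 0} \<le> k" if "u \<in> V" for u
  proof -
    \<comment> \<open>Each used arc carries at least one unit, so the bound on the units bounds the
      number of arcs.\<close>
    have "card {w\<in>V. y u w > 0} = (\<Sum>w\<in>{w\<in>V. y u w > 0}. 1)" by simp
    also have "\<dots> \<le> (\<Sum>w\<in>{w\<in>V. y u w > 0}. y u w)" by (intro sum_mono) auto
    also have "\<dots> \<le> (\<Sum>w\<in>V. y u w)" using V(1) by (intro sum_mono2) auto
    finally have y: "card {w\<in>V. y u w > 0} \<le> \<kappa> u" using yz(3)[OF that] by linarith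
    show ?thesis
    proof (cases "u \<in> C")
      case True
      have "{w\<in>V. ?x u w > 0} \<subseteq> insert (h u) {w\<in>V. y u w > 0}"
      proof
        fix w assume w: "w \<in> {w\<in>V. ?x u w > 0}"
        show "w \<in> insert (h u) {w\<in>V. y u w > 0}"
        proof (cases "w = h u")
          case False
          then have "z u w = 0" using yz(2)[of u w] by (simp add: d_def)
          then show ?thesis using w by simp
        qed simp
      qed
      then have "card {w\<in>V. ?x u w > 0} \<le> card (insert (h u) {w\<in>V. y u w > 0})"
        using V(1) by (intro card_mono) auto
      also have "\<dots> \<le> Suc (card {w\<in>V. y u w > 0})" by (rule card_insert_le_m1) auto
      finally show ?thesis using y True k by (simp add: \<kappa>_def)
    next
      case False
      then have "z u w = 0" for w using yz(2)[of u w] by (simp add: d_def)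
      then show ?thesis using y False by (simp add: \<kappa>_def)
    qed
  qed
  ultimately have "bounded_flow V c s t k ?x"
    using yz(4,5) unfolding bounded_flow_def by simp
  then show ?thesis by blast
qed

text \<open>With one arc per vertex, a vertex other than \<open>t\<close> that receives two units
  sends at least two along a single arc. If \<open>t\<close> is not reached by such arcs from
  \<open>s\<close>, the vertices that are reached keep all their flow among themselves, contrary to
  the value. Conversely, a unit flow for the halved capacities with vertex capacity 1 uses at most
  one arc per vertex and can be doubled.\<close>

lemma bounded_flow_1_iff:
  assumes V: "finite V" "s \<in> V" "s \<noteq> t"
  shows "(\<exists>x. bounded_flow V c s t 1 x) \<longleftrightarrow> (s, t) \<in> (arcs_above 1 V c)\<^sup>*"
proof
  assume "\<exists>x. bounded_flow V c s t 1 x"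
  then obtain x where "bounded_flow V c s t 1 x" ..
  then have x: "\<And>u v. x u v \<le> c u v" "\<And>u. u \<in> V - {s, t} \<Longrightarrow> net V x u = 0"
    "2 \<le> net V x s" "\<And>u. u \<in> V \<Longrightarrow> card {v\<in>V. x u v > 0} \<le> 1"
    by (auto simp: bounded_flow_def)
  show "(s, t) \<in> (arcs_above 1 V c)\<^sup>*"
  proof (rule ccontr)
    assume t: "(s, t) \<notin> (arcs_above 1 V c)\<^sup>*"
    have only: "x p r = 0" if "p \<in> V" "q \<in> V" "x p q > 0" "r \<in> V" "r \<noteq> q" for p q r
    proof (rule ccontr)
      assume "x p r \<noteq> 0"
      then have "{q, r} \<subseteq> {v\<in>V. x p v > 0}" using that by auto
      then have "card {q, r} \<le> card {v\<in>V. x p v > 0}" using V(1) by (intro card_mono) auto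
      then have "card {q, r} \<le> 1" using x(4)[OF that(1)] by linarith
      then show False using that(5) by simp
    qed
    have next_ex: "\<exists>q\<in>V. 2 \<le> x p q" if p: "p \<in> V" "2 \<le> (\<Sum>q\<in>V. x p q)" for p
    proof -
      obtain q where q: "q \<in> V" "x p q > 0"
        using p(2) by (metis (no_types, lifting) gr0I not_numeral_le_zero sum.neutral)
      have "(\<Sum>q\<in>V. x p q) = (\<Sum>q\<in>{q}. x p q)"
        using V(1) q only[OF p(1) q] by (intro sum.mono_neutral_right) auto
      then show ?thesis using p(2) q by auto
    qed
    have out: "2 \<le> (\<Sum>q\<in>V. x p q)" if "(s, p) \<in> (arcs_above 1 V x)\<^sup>*" for p
      using that
    proof (cases rule: rtrancl.cases)
      case rtrancl_refl
      then show ?thesis using x(3) unfolding net_def by (simp flip: of_nat_sum)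
    next
      case (rtrancl_into_rtrancl a)
      show ?thesis
      proof (cases "p = s")
        case True
        then show ?thesis using x(3) unfolding net_def by (simp flip: of_nat_sum)
      next
        case False
        have "(s, p) \<in> (arcs_above 1 V c)\<^sup>*"
          using that x(1) by (elim rtrancl_mono[THEN subsetD, rotated])
            (auto simp: arcs_above_def intro: less_le_trans)
        then have "p \<noteq> t" using t by blast
        have ap: "a \<in> V" "p \<in> V" "2 \<le> x a p" using rtrancl_into_rtrancl by (auto simp: arcs_above_def)
        have "x a p \<le> (\<Sum>q\<in>V. x q p)" using V(1) ap by (intro member_le_sum) auto
        moreover have "net V x p = 0" using x(2) ap False \<open>p \<noteq> t\<close> by auto
        ultimately show ?thesis using ap(3) unfolding net_def by (simp flip: of_nat_sum)
      qed
    qed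
    define S where "S = (arcs_above 1 V x)\<^sup>* `` {s}"
    have S: "S \<subseteq> V" "s \<in> S" using arcs_above_rtrancl_subset[OF V(2)] by (auto simp: S_def)
    have "arcs_above 1 V x \<subseteq> arcs_above 1 V c"
      using x(1) by (auto simp: arcs_above_def intro: less_le_trans)
    then have "t \<notin> S" using t rtrancl_mono by (auto simp: S_def)
    have "x p r = 0" if p: "p \<in> S" and r: "r \<in> V - S" for p r
    proof -
      have "p \<in> V" using p S by blast
      then obtain q where q: "q \<in> V" "2 \<le> x p q" using next_ex out p by (auto simp: S_def)
      then have "(p, q) \<in> arcs_above 1 V x" using \<open>p \<in> V\<close> by (simp add: arcs_above_def)
      then have "q \<in> S" using p by (auto simp: S_def intro: rtrancl_into_rtrancl)
      then have "r \<noteq> q" using r by blast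
      then show ?thesis using only[OF \<open>p \<in> V\<close> q(1)] q(2) r by simp
    qed
    then have "net V x s \<le> 0"
      using net_source_le[OF V(1) S \<open>t \<notin> S\<close>, of x] x(2) by simp
    then show False using x(3) by simp
  qed
next
  assume st: "(s, t) \<in> (arcs_above 1 V c)\<^sup>*"
  obtain y z where yz: "\<And>u w. y u w \<le> c u w div 2" "\<And>u w. z u w \<le> (0::nat)"
    "\<And>u. u \<in> V \<Longrightarrow> (\<Sum>w\<in>V. y u w) \<le> (1::nat)"
    "\<And>u. u \<in> V - {s, t} \<Longrightarrow> net V (\<lambda>u w. y u w + z u w) u = 0"
    "net V (\<lambda>u w. y u w + z u w) s = int 1"
  proof (rule node_capacitated_flow[OF V])
    fix A B assume AB: "A \<subseteq> V" "B \<subseteq> V" "s \<in> A" "t \<notin> A"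
    have fin: "finite A" "finite B" using AB V(1) finite_subset by auto
    obtain p q where pq: "(p, q) \<in> arcs_above 1 V c" "p \<in> A" "q \<notin> A"
      using rtrancl_exit[OF st AB(3,4)] .
    then have q: "q \<in> V - A" "1 \<le> c p q div 2" by (auto simp: arcs_above_def)
    show "1 \<le> (\<Sum>u\<in>A - B. 1) + (\<Sum>u\<in>A. \<Sum>w\<in>V - A. 0) + (\<Sum>u\<in>B. \<Sum>w\<in>V - A. c u w div 2)"
    proof (cases "p \<in> B")
      case True
      have "c p q div 2 \<le> (\<Sum>w\<in>V - A. c p w div 2)" using V(1) q by (intro member_le_sum) auto
      also have "\<dots> \<le> (\<Sum>u\<in>B. \<Sum>w\<in>V - A. c u w div 2)"
        using fin True by (intro member_le_sum) auto
      finally show ?thesis using q by linarith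
    next
      case False
      then have "0 < card (A - B)" using pq fin by (auto simp: card_gt_0_iff)
      then show ?thesis by simp
    qed
  qed blast
  let ?x = "\<lambda>u w. 2 * y u w"
  have z: "z = (\<lambda>_ _. 0)" using yz(2) by auto
  have net: "net V ?x u = 2 * net V (\<lambda>u w. y u w + z u w) u" for u
    by (simp add: net_def z sum_distrib_left[symmetric])
  have "?x u w \<le> c u w" for u w using yz(1)[of u w] by linarith
  moreover have "card {w\<in>V. ?x u w > 0} \<le> 1" if "u \<in> V" for u
  proof -
    have "card {w\<in>V. ?x u w > 0} = (\<Sum>w\<in>{w\<in>V. y u w > 0}. 1)" by simp
    also have "\<dots> \<le> (\<Sum>w\<in>{w\<in>V. y u w > 0}. y u w)" by (intro sum_mono) auto
    also have "\<dots> \<le> (\<Sum>w\<in>V. y u w)" using V(1) by (intro sum_mono2) auto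
    finally show ?thesis using yz(3)[OF that] by linarith
  qed
  ultimately have "bounded_flow V c s t 1 ?x"
    using yz(4,5) unfolding bounded_flow_def net by simp
  then show "\<exists>x. bounded_flow V c s t 1 x" by blast
qed

section \<open>Cuts of bounded capacity as reachability\<close>

text \<open>
  \<open>F\<close> lists \<open>j\<close> units of capacity to be deleted: an arc disappears when it is listed as often as its
  capacity says.
\<close>

lemma cut_gt_imp_reachable:
  assumes V: "finite V" "a \<in> V" and cut: "\<forall>S\<subseteq>V. a \<in> S \<longrightarrow> b \<notin> S \<longrightarrow> j < cut V c S"
  shows "(a, b) \<in> {(p, q). p \<in> V \<and> q \<in> V \<and> card {i. i < j \<and> F i = (p, q)} < c p q}\<^sup>*"
    (is "_ \<in> ?R\<^sup>*")
proof (rule ccontr)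
  define S where "S = ?R\<^sup>* `` {a}"
  assume "(a, b) \<notin> ?R\<^sup>*"
  moreover have S: "S \<subseteq> V" using V(2) by (auto simp: S_def elim: rtrancl.cases)
  ultimately have "j < cut V c S" using cut by (auto simp: S_def)
  \<comment> \<open>Every arc leaving \<open>S\<close> is exhausted by the list, so the cut has at
    most as many units as the list has positions.\<close>
  have "cut V c S \<le> (\<Sum>p\<in>S. \<Sum>q\<in>V - S. card {i. i < j \<and> F i = (p, q)})"
    unfolding cut_def
  proof (intro sum_mono)
    fix p q assume "p \<in> S" "q \<in> V - S"
    then have "(p, q) \<notin> ?R" by (auto simp: S_def dest: rtrancl_into_rtrancl)
    then show "c p q \<le> card {i. i < j \<and> F i = (p, q)}" using \<open>p \<in> S\<close> \<open>q \<in> V - S\<close> S by auto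
  qed
  also have "\<dots> = (\<Sum>e\<in>S \<times> (V - S). card {i. i < j \<and> F i = e})"
    by (simp add: sum.cartesian_product case_prod_unfold)
  also have "\<dots> = card (\<Union>e\<in>S \<times> (V - S). {i. i < j \<and> F i = e})"
    using V(1) S finite_subset by (intro card_UN_disjoint[symmetric]) auto
  also have "\<dots> \<le> card {..<j}" by (intro card_mono) auto
  finally show False using \<open>j < cut V c S\<close> by simp
qed

text \<open>The arcs of a cut of capacity at most \<open>j\<close> can be listed with their
  capacities as multiplicities; deleting these units leaves no way out of \<open>S\<close>.\<close>

lemma reachable_imp_cut_gt:
  fixes c :: "'v \<Rightarrow> 'v \<Rightarrow> nat"
  assumes V: "finite V" "a \<in> V"
    and reach: "\<And>F :: nat \<Rightarrow> 'v \<times> 'v. (\<And>i. F i \<in> V \<times> V) \<Longrightarrow>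
      (a, b) \<in> {(p, q). p \<in> V \<and> q \<in> V \<and> card {i. i < j \<and> F i = (p, q)} < c p q}\<^sup>*"
    and S: "S \<subseteq> V" "a \<in> S" "b \<notin> S"
  shows "j < cut V c S"
proof (rule ccontr)
  assume "\<not> j < cut V c S"
  define X where "X = S \<times> (V - S)"
  have X: "finite X" "X \<subseteq> V \<times> V"
    using V(1) S finite_subset[of S V] by (auto simp: X_def)
  define M where "M = (\<Sum>e\<in>X. replicate_mset (case_prod c e) e)"
  obtain l where l: "mset l = M" using ex_mset by blast
  have "length l = size M" by (simp flip: l)
  also have "\<dots> = (\<Sum>e\<in>X. case_prod c e)" by (simp add: M_def size_multiset_sum)
  also have "\<dots> = cut V c S" by (simp add: cut_def X_def sum.cartesian_product)
  finally have len: "length l \<le> j" using \<open>\<not> j < cut V c S\<close> by simp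
  have set_l: "set l \<subseteq> X"
  proof -
    have "set_mset M \<subseteq> X" using X(1) by (auto simp: M_def set_mset_sum split: if_splits)
    then show ?thesis by (simp flip: l)
  qed
  \<comment> \<open>A shorter list is padded with \<open>(a, a)\<close>, which lies in
    \<open>V \<times> V\<close> and is not an arc of the cut.\<close>
  define F where "F i = (if i < length l then l ! i else (a, a))" for i
  have "F i \<in> V \<times> V" for i
    using subsetD[OF X(2) subsetD[OF set_l nth_mem[of i l]]] V(2) by (auto simp: F_def)
  then have "(a, b) \<in> {(p, q). p \<in> V \<and> q \<in> V \<and> card {i. i < j \<and> F i = (p, q)} < c p q}\<^sup>*"
    using reach by blast
  then obtain p q where pq: "p \<in> V" "q \<in> V" "card {i. i < j \<and> F i = (p, q)} < c p q" "p \<in> S" "q \<notin> S"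
    using S(2,3) by (rule rtrancl_exit) auto
  have "c p q = count M (p, q)"
    using X(1) pq by (simp add: M_def count_sum X_def sum.delta)
  also have "\<dots> = length (filter ((=) (p, q)) l)"
    by (simp flip: l add: count_mset count_list_eq_length_filter)
  also have "\<dots> = card {i. i < length l \<and> (p, q) = l ! i}" by (rule length_filter_conv_card)
  also have "\<dots> \<le> card {i. i < j \<and> F i = (p, q)}"
    using len by (intro card_mono) (auto simp: F_def)
  finally show False using pq(3) by simp
qed

section \<open>Deciding properties of networks\<close>

subsection \<open>The coded network\<close>

abbreviation size_code :: "nat list \<Rightarrow> nat" where
  "size_code xs \<equiv> input_at xs 0"

abbreviation src_code :: "nat list \<Rightarrow> nat" where
  "src_code xs \<equiv> input_at xs 1"

abbreviation snk_code :: "nat list \<Rightarrow> nat" where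
  "snk_code xs \<equiv> input_at xs 2"

text \<open>
  On the code of a network, the minimum is the number of vertices; its role is to make
  \<open>entry\<close> computable with \<open>computable_mult\<close> on all sequences.
\<close>

definition entry :: "nat list \<Rightarrow> nat \<Rightarrow> nat \<Rightarrow> nat" where
  "entry xs u v = input_at xs (3 + (min (length xs) (size_code xs) * u + v))"

definition cap :: "nat list \<Rightarrow> nat \<Rightarrow> nat \<Rightarrow> nat" where
  "cap xs u v = (if u < size_code xs \<and> v < size_code xs then entry xs u v - 1 else 0)"

text \<open>Arbitrary sequences have to be judged, hence the product and the quantifier occur in the
  bounded form in which they are computable. The zero diagonal excludes loops.\<close>

definition valid :: "nat list \<Rightarrow> bool" where
  "valid xs \<longleftrightarrow> length xs = min (length xs) (size_code xs) * size_code xs + 3 \<and>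
     src_code xs < size_code xs \<and> snk_code xs < size_code xs \<and> src_code xs \<noteq> snk_code xs \<and>
     (\<forall>u<length xs. u < size_code xs \<longrightarrow> entry xs u u = 0)"

definition arc_cap :: "'a flow_network \<Rightarrow> 'a \<Rightarrow> 'a \<Rightarrow> nat" where
  "arc_cap N u v = (if (u, v) \<in> parcs (dgraph N) then capacity N (u, v) else 0)"

text \<open>For a size beyond the length, the minimum would be the length, and the right-hand side
  of the length equation would be too large.\<close>

lemma valid_size_le:
  assumes "valid xs"
  shows "size_code xs \<le> length xs" "length xs = size_code xs * size_code xs + 3"
proof -
  let ?n = "size_code xs"
  have eq: "length xs = min (length xs) ?n * ?n + 3" using assms by (simp add: valid_def)
  show le: "?n \<le> length xs"
  proof (rule ccontr)
    assume "\<not> ?n \<le> length xs"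
    then have "min (length xs) ?n = length xs" "?n \<ge> 1" by auto
    then have "length xs * 1 \<le> min (length xs) ?n * ?n" by simp
    then show False using eq by linarith
  qed
  then have "min (length xs) ?n = ?n" by simp
  then show "length xs = ?n * ?n + 3" using eq by metis
qed

lemma concat_matrix:
  "length (concat (map (\<lambda>u. map (g u) [0..<n]) [0..<m])) = m * n"
  "u < m \<Longrightarrow> v < n \<Longrightarrow> concat (map (\<lambda>u. map (g u) [0..<n]) [0..<m]) ! (u * n + v) = g u v"
proof (induction m)
  case (Suc m)
  {
    case 1
    then show ?case using Suc.IH(1) by simp
  next
    case 2
    show ?case
    proof (cases "u = m")
      case True
      then show ?thesis using 2 Suc.IH(1) by (simp add: nth_append)
    next
      case False
      then have "u < m" using 2 by simp
      have "u * n + v < m * n"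
      proof -
        have "Suc u * n \<le> m * n" using \<open>u < m\<close> by (intro mult_le_mono1) simp
        then show ?thesis using 2(2) by simp
      qed
      then show ?thesis using Suc.IH 2 \<open>u < m\<close> by (simp add: nth_append)
    qed
  }
qed auto

lemma encode_network_simps:
  fixes N :: "nat flow_network"
  defines "n \<equiv> card (pverts (dgraph N))" and "xs \<equiv> encode_network N"
  shows "length xs = n * n + 3" "size_code xs = n" "src_code xs = src N" "snk_code xs = snk N"
    "u < n \<Longrightarrow> v < n \<Longrightarrow> input_at xs (3 + (n * u + v)) = arc_code N (u, v)"
proof -
  let ?M = "concat (map (\<lambda>u. map (\<lambda>v. arc_code N (u, v)) [0..<n]) [0..<n])"
  have xs: "xs = [n, src N, snk N] @ ?M"
    unfolding xs_def encode_network_def Let_def n_def ..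
  have len: "length ?M = n * n" by (rule concat_matrix(1))
  show "length xs = n * n + 3" unfolding xs length_append len by simp
  show "size_code xs = n" "src_code xs = src N" "snk_code xs = snk N"
    unfolding xs by (simp_all add: input_at_def)
  assume uv: "u < n" "v < n"
  have "Suc u * n \<le> n * n" using uv by (intro mult_le_mono1) simp
  then have "u * n + v < n * n" using uv(2) by simp
  then show "input_at xs (3 + (n * u + v)) = arc_code N (u, v)"
    unfolding input_at_def xs length_append len using concat_matrix(2)[OF uv, of "\<lambda>u v. arc_code N (u, v)"]
    by (simp add: mult.commute)
qed

lemma encode_network_valid:
  assumes N: "input_network N"
  defines "xs \<equiv> encode_network N"
  shows "valid xs" "cap xs = arc_cap N" "{..<size_code xs} = pverts (dgraph N)"
    "src_code xs = src N" "snk_code xs = snk N"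
proof -
  define n where "n = card (pverts (dgraph N))"
  note enc = encode_network_simps[where N = N, folded n_def xs_def]
  have verts: "pverts (dgraph N) = {..<n}" using N by (simp add: input_network_def n_def)
  then show "{..<size_code xs} = pverts (dgraph N)" using enc(2) by simp
  show "src_code xs = src N" "snk_code xs = snk N" by (fact enc)+
  have dig: "pair_wf_digraph (dgraph N)" "pair_loopfree_digraph (dgraph N)"
    using N unfolding input_network_def flow_network_def pair_digraph_def pair_fin_digraph_def by blast+
  have arc: "u < n \<and> v < n \<and> u \<noteq> v" if "(u, v) \<in> parcs (dgraph N)" for u v
    using pair_wf_digraph.in_arcsD1[OF dig(1) that] pair_wf_digraph.in_arcsD2[OF dig(1) that]
      pair_loopfree_digraph.pair_no_loops[OF dig(2) that] verts by simp
  have "n \<le> n * n" by simp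
  then have "n \<le> length xs" using enc(1) by linarith
  then have min: "min (length xs) n = n" by (rule min_absorb2)
  have entry: "entry xs u v = arc_code N (u, v)" if "u < n" "v < n" for u v
    unfolding entry_def enc(2) min using enc(5)[OF that] .
  have "src N < n" "snk N < n" "src N \<noteq> snk N"
    using N verts by (auto simp: input_network_def flow_network_def)
  then show "valid xs"
    unfolding valid_def enc(2-4) min using entry arc by (auto simp: enc(1) arc_code_def)
  show "cap xs = arc_cap N"
  proof (intro ext)
    fix u v
    show "cap xs u v = arc_cap N u v"
      using entry[of u v] arc[of u v] by (auto simp: cap_def arc_cap_def enc(2) arc_code_def)
  qed
qed

text \<open>Reading entry 0 as a missing arc and any other entry as capacity plus 1 inverts the
  coding, so \<open>valid\<close> singles out exactly the codes.\<close>

lemma valid_encode_network: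
  assumes "valid xs"
  obtains N where "input_network N" "xs = encode_network N"
proof -
  define n where "n = size_code xs"
  have len: "length xs = n * n + 3" "n \<le> length xs"
    using valid_size_le[OF assms] by (simp_all add: n_def)
  have entry: "entry xs u v = input_at xs (3 + (n * u + v))" for u v
    using len(2) by (simp add: entry_def n_def[symmetric] min_def)
  define A where "A = {(u, v). u < n \<and> v < n \<and> entry xs u v > 0}"
  define N where "N = \<lparr>dgraph = \<lparr>pverts = {..<n}, parcs = A\<rparr>, src = src_code xs, snk = snk_code xs,
    capacity = (\<lambda>(u, v). entry xs u v - 1)\<rparr>"
  have "A \<subseteq> {..<n} \<times> {..<n}" by (auto simp: A_def)
  then have "finite A" using finite_subset by blast
  have loops: "u \<noteq> v" if "(u, v) \<in> A" for u v
    using that assms len(2) by (auto simp: A_def valid_def n_def[symmetric])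
  have "pair_digraph (dgraph N)"
    by unfold_locales (use \<open>finite A\<close> loops in \<open>auto simp: N_def A_def\<close>)
  then have N: "input_network N"
    using assms by (auto simp: input_network_def flow_network_def N_def valid_def n_def)
  have card: "card (pverts (dgraph N)) = n" by (simp add: N_def)
  note enc = encode_network_simps[where N = N, unfolded card]
  have "xs = encode_network N"
  proof (rule nth_equalityI)
    show "length xs = length (encode_network N)" using enc(1) len by simp
    fix i assume i: "i < length xs"
    have "input_at xs i = input_at (encode_network N) i"
    proof (cases "i < 3")
      case True
      then have "i = 0 \<or> i = 1 \<or> i = 2" by auto
      then show ?thesis using enc(2-4) by (auto simp: N_def n_def)
    next
      case False
      define u where "u = (i - 3) div n"
      define v where "v = (i - 3) mod n"
      have "i - 3 < n * n" using i False len by simp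
      then have uv: "u < n" "v < n"
        using less_mult_imp_div_less by (cases n; simp add: u_def v_def)+
      have i3: "i = 3 + (n * u + v)" using False by (simp add: u_def v_def)
      show ?thesis
        unfolding i3 enc(5)[OF uv] unfolding entry[symmetric] using uv
        by (auto simp: arc_code_def N_def A_def)
    qed
    then show "xs ! i = encode_network N ! i" using i enc(1) len by (simp add: input_at_def)
  qed
  with N that show ?thesis by blast
qed

subsection \<open>Flows on networks\<close>

lemma network_sums:
  assumes N: "flow_network N"
    and f: "\<And>u v. f u v = (if (u, v) \<in> parcs (dgraph N) then x (u, v) else 0)"
  shows "outflow N x v = (\<Sum>w\<in>pverts (dgraph N). f v w)"
    "inflow N x v = (\<Sum>w\<in>pverts (dgraph N). f w v)"
    "out_degree (with_proj (support_digraph N x)) v = card {w\<in>pverts (dgraph N). f v w > 0}"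
proof -
  let ?V = "pverts (dgraph N)" and ?A = "parcs (dgraph N)"
  have "pair_fin_digraph (dgraph N)"
    using N by (simp add: flow_network_def pair_digraph_def)
  then have fin: "finite ?V" "finite ?A" and wf: "pair_wf_digraph (dgraph N)"
    by (simp_all add: pair_fin_digraph_def pair_fin_digraph_axioms_def)
  have arc: "u \<in> ?V \<and> w \<in> ?V" if "(u, w) \<in> ?A" for u w
    using pair_wf_digraph.in_arcsD1[OF wf that] pair_wf_digraph.in_arcsD2[OF wf that] by blast
  have "outflow N x v = (\<Sum>w\<in>{w\<in>?V. (v, w) \<in> ?A}. x (v, w))"
    unfolding outflow_def out_arcs_def with_proj_simps
    by (rule sum.reindex_bij_witness[of _ "\<lambda>w. (v, w)" snd]) (auto dest: arc)
  also have "\<dots> = (\<Sum>w\<in>?V. f v w)"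
    using fin by (intro sum.mono_neutral_cong_left) (auto simp: f)
  finally show "outflow N x v = (\<Sum>w\<in>?V. f v w)" .
  have "inflow N x v = (\<Sum>w\<in>{w\<in>?V. (w, v) \<in> ?A}. x (w, v))"
    unfolding inflow_def in_arcs_def with_proj_simps
    by (rule sum.reindex_bij_witness[of _ "\<lambda>w. (w, v)" fst]) (auto dest: arc)
  also have "\<dots> = (\<Sum>w\<in>?V. f w v)"
    using fin by (intro sum.mono_neutral_cong_left) (auto simp: f)
  finally show "inflow N x v = (\<Sum>w\<in>?V. f w v)" .
  have "bij_betw snd {e \<in> parcs (support_digraph N x). fst e = v} {w\<in>?V. f v w > 0}"
    by (rule bij_betw_byWitness[where f' = "\<lambda>w. (v, w)"])
      (auto simp: support_digraph_def f dest: arc split: if_splits)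
  then show "out_degree (with_proj (support_digraph N x)) v = card {w\<in>?V. f v w > 0}"
    unfolding out_degree_def out_arcs_def with_proj_simps by (rule bij_betw_same_card)
qed

text \<open>\<open>x\<close> is arbitrary off the arcs, whereas \<open>arc_cap\<close> forces a
  matrix to vanish there; extension by 0 translates between the two.\<close>

lemma network_flow_iff_bounded_flow:
  assumes N: "flow_network N"
  shows "(\<exists>x. st_flow N x \<and> flow_value N x \<ge> int (k + 1) \<and>
      max_out_degree (with_proj (support_digraph N x)) \<le> k) \<longleftrightarrow>
    (\<exists>f. bounded_flow (pverts (dgraph N)) (arc_cap N) (src N) (snk N) k f)"
proof -
  let ?V = "pverts (dgraph N)" and ?A = "parcs (dgraph N)"
  have V: "finite ?V" "src N \<in> ?V"
    using N by (simp_all add: flow_network_def pair_digraph_def pair_fin_digraph_def pair_fin_digraph_axioms_def)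
  have eq: "st_flow N x \<and> flow_value N x \<ge> int (k + 1) \<and>
      max_out_degree (with_proj (support_digraph N x)) \<le> k \<longleftrightarrow>
      bounded_flow ?V (arc_cap N) (src N) (snk N) k f"
    if f: "\<And>u v. f u v = (if (u, v) \<in> ?A then x (u, v) else 0)" for x f
  proof -
    note sums = network_sums[OF N f]
    have net: "net ?V f v = int (outflow N x v) - int (inflow N x v)" for v
      by (simp add: net_def sums)
    have "inflow N x v = outflow N x v \<longleftrightarrow> net ?V f v = 0" for v by (auto simp: net)
    moreover have "flow_value N x = net ?V f (src N)" by (simp add: net flow_value_def)
    moreover have "max_out_degree (with_proj (support_digraph N x)) \<le> k \<longleftrightarrow>
        (\<forall>v\<in>?V. card {w\<in>?V. f v w > 0} \<le> k)"
    proof -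
      have "verts (with_proj (support_digraph N x)) = ?V" by (simp add: support_digraph_def)
      then show ?thesis unfolding max_out_degree_def using V by (subst Max_le_iff) (auto simp: sums(3))
    qed
    moreover have "(\<forall>e\<in>?A. x e \<le> capacity N e) \<longleftrightarrow> (\<forall>u v. f u v \<le> arc_cap N u v)"
      by (auto simp: f arc_cap_def)
    ultimately show ?thesis
      unfolding st_flow_def bounded_flow_def by (simp only: conj_assoc)
  qed
  show ?thesis
  proof
    assume "\<exists>x. st_flow N x \<and> flow_value N x \<ge> int (k + 1) \<and>
      max_out_degree (with_proj (support_digraph N x)) \<le> k"
    then show "\<exists>f. bounded_flow ?V (arc_cap N) (src N) (snk N) k f"
      using eq[of "\<lambda>u v. if (u, v) \<in> ?A then _ (u, v) else 0"] by blast
  next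
    assume "\<exists>f. bounded_flow ?V (arc_cap N) (src N) (snk N) k f"
    then obtain f where f: "bounded_flow ?V (arc_cap N) (src N) (snk N) k f" ..
    have "f u v = (if (u, v) \<in> ?A then case_prod f (u, v) else 0)" for u v
    proof -
      have "f u v \<le> arc_cap N u v" using f by (simp add: bounded_flow_def)
      then show ?thesis by (simp add: arc_cap_def split: if_splits)
    qed
    from eq[OF this] f show "\<exists>x. st_flow N x \<and> flow_value N x \<ge> int (k + 1) \<and>
      max_out_degree (with_proj (support_digraph N x)) \<le> k" by blast
  qed
qed

subsection \<open>The decision procedure\<close>

text \<open>The initial memory is the assignment of 0 to all variables; the result is moved from
  variable \<open>d\<close> to register 0.\<close>

lemma computable_pred_polynomial_time:
  assumes "computable_pred True (\<lambda>xs e. P xs e)"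
  shows "polynomial_time_decidable {xs. P xs (\<lambda>_. 0)}"
proof -
  obtain d c B where B: "poly_bounded B" "computes True d (\<lambda>xs e. of_bool (P xs e)) c B"
    using assms unfolding computable_def by blast
  have "poly_bounded (\<lambda>n. B n + 1)" using B(1) by (intro poly_bounded_intros)
  then obtain K where K: "\<And>n. B n + 1 \<le> (n + 2) ^ K" unfolding poly_bounded_def by blast
  have "\<exists>T m. big_step xs (c ;; Do (Copy 0 (2 * d))) (\<lambda>_. 0) T m \<and> T \<le> (length xs + 2) ^ K \<and>
      (m 0 \<noteq> 0 \<longleftrightarrow> xs \<in> {xs. P xs (\<lambda>_. 0)})" for xs
  proof -
    have "runs_to xs (c ;; Do (Copy 0 (2 * d))) (\<lambda>_. 0) (B (length xs) + 1)
        (\<lambda>m. m 0 \<noteq> 0 \<longleftrightarrow> xs \<in> {xs. P xs (\<lambda>_. 0)})"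
      by (rule runs_to_Seq[OF computesD[OF B(2)]], rule runs_to_Do) auto
    then show ?thesis unfolding runs_to_def using K[of "length xs"] order_trans by blast
  qed
  then show ?thesis by (rule polynomial_time_decidableI)
qed

section \<open>Formulas about coded networks\<close>

fun all_vars :: "nat list \<Rightarrow> (nat list \<Rightarrow> (nat \<Rightarrow> nat) \<Rightarrow> bool) \<Rightarrow> nat list \<Rightarrow> (nat \<Rightarrow> nat) \<Rightarrow> bool" where
  "all_vars [] P = P"
| "all_vars (v # vs) P = (\<lambda>xs e. \<forall>i<length xs. all_vars vs P xs (e(v := i)))"

lemma computable_pred_all_vars: "computable_pred b P \<Longrightarrow> computable_pred b (all_vars vs P)"
  by (induction vs) (auto intro: computable_pred_all)

lemma all_vars_iff:
  "all_vars vs P xs e \<longleftrightarrow>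
     (\<forall>g. (\<forall>v\<in>set vs. g v < length xs) \<longrightarrow> P xs (\<lambda>i. if i \<in> set vs then g i else e i))"
proof (induction vs arbitrary: e)
  case (Cons v vs)
  show ?case
  proof
    assume l: "all_vars (v # vs) P xs e"
    show "\<forall>g. (\<forall>w\<in>set (v # vs). g w < length xs) \<longrightarrow>
        P xs (\<lambda>i. if i \<in> set (v # vs) then g i else e i)"
    proof (intro allI impI)
      fix g assume g: "\<forall>w\<in>set (v # vs). g w < length xs"
      then have "all_vars vs P xs (e(v := g v))" using l by simp
      then have "P xs (\<lambda>i. if i \<in> set vs then g i else (e(v := g v)) i)"
        using g unfolding Cons.IH by (elim allE[of _ g] impE) simp_all
      moreover have "(\<lambda>i. if i \<in> set vs then g i else (e(v := g v)) i) =
          (\<lambda>i. if i \<in> set (v # vs) then g i else e i)" by auto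
      ultimately show "P xs (\<lambda>i. if i \<in> set (v # vs) then g i else e i)" by simp
    qed
  next
    assume r: "\<forall>g. (\<forall>w\<in>set (v # vs). g w < length xs) \<longrightarrow>
        P xs (\<lambda>i. if i \<in> set (v # vs) then g i else e i)"
    have "P xs (\<lambda>i. if i \<in> set vs then g i else (e(v := j)) i)"
      if j: "j < length xs" and g: "\<forall>w\<in>set vs. g w < length xs" for j g
    proof -
      let ?g = "\<lambda>i. if i \<in> set vs then g i else j"
      have "P xs (\<lambda>i. if i \<in> set (v # vs) then ?g i else e i)"
        by (rule mp[OF spec[OF r, of ?g]]) (use j g in simp)
      moreover have "(\<lambda>i. if i \<in> set (v # vs) then ?g i else e i) =
          (\<lambda>i. if i \<in> set vs then g i else (e(v := j)) i)" by auto
      ultimately show ?thesis by simp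
    qed
    then show "all_vars (v # vs) P xs e" unfolding all_vars.simps Cons.IH by blast
  qed
qed simp

lemma computable_input: "computable b (\<lambda>xs e. input_at xs n)"
  by (intro computable_read computable_const)

lemma computable_entry:
  assumes "computable b f" "computable b g"
  shows "computable b (\<lambda>xs e. entry xs (f xs e) (g xs e))"
  unfolding entry_def
  by (intro computable_read computable_add computable_mult computable_const assms)

lemma computable_cap:
  assumes "computable b f" "computable b g"
  shows "computable b (\<lambda>xs e. cap xs (f xs e) (g xs e))"
proof -
  have "computable b (\<lambda>xs e. if of_bool (f xs e < size_code xs \<and> g xs e < size_code xs) \<noteq> (0::nat)
      then entry xs (f xs e) (g xs e) - 1 else 0)"
    by (intro computable_if computable_pred_and computable_pred_less computable_input computable_diff
        computable_entry computable_const assms)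
  then show ?thesis by (rule computable_cong) (simp add: cap_def)
qed

lemma computable_valid: "computable_pred b (\<lambda>xs e. valid xs)"
proof -
  have "computable_pred b (\<lambda>xs e. length xs = min (length xs) (size_code xs) * size_code xs + 3 \<and>
     src_code xs < size_code xs \<and> snk_code xs < size_code xs \<and> \<not> src_code xs = snk_code xs \<and>
     (\<forall>u<length xs. (e(0 := u)) 0 < size_code xs \<longrightarrow> entry xs ((e(0 := u)) 0) ((e(0 := u)) 0) = 0))"
    by (intro computable_pred_and computable_pred_eq computable_pred_less computable_pred_not
        computable_pred_all computable_pred_imp computable_entry computable_add computable_mult
        computable_length computable_input computable_const computable_var)
  then show ?thesis by (rule computable_cong) (simp add: valid_def)
qed

text \<open>
  Variables 0 and 1 hold the ends of an arc, 2 and 3 the vertices \<open>v\<close> and \<open>w\<close> of the criterion,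
  and those from 4 on the deleted arcs.
\<close>

definition count_deleted :: "nat \<Rightarrow> (nat \<Rightarrow> nat) \<Rightarrow> nat" where
  "count_deleted j e = card {i. i < j \<and> (e (4 + 2 * i), e (5 + 2 * i)) = (e 0, e 1)}"

lemma computable_count_deleted: "computable b (\<lambda>xs e. count_deleted j e)"
proof (induction j)
  case 0
  then show ?case using computable_const[of b 0] by (simp add: count_deleted_def)
next
  case (Suc j)
  \<comment> \<open>\<open>j\<close> belongs to the program and not to the input, so the count is
    unrolled into \<open>j\<close> comparisons.\<close>
  let ?P = "\<lambda>e. e (4 + 2 * j) = e 0 \<and> e (5 + 2 * j) = (e 1 :: nat)"
  have "computable b (\<lambda>xs e. count_deleted j e + of_bool (?P e))"
    by (intro computable_add Suc computable_pred_and computable_pred_eq computable_var)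
  then show ?case
  proof (rule computable_cong)
    fix e
    have "{i. i < Suc j \<and> (e (4 + 2 * i), e (5 + 2 * i)) = (e 0, e 1)} =
        {i. i < j \<and> (e (4 + 2 * i), e (5 + 2 * i)) = (e 0, e 1)} \<union> (if ?P e then {j} else {})"
      by (auto simp: less_Suc_eq)
    then show "count_deleted j e + of_bool (?P e) = count_deleted (Suc j) e"
      by (auto simp: count_deleted_def)
  qed
qed

text \<open>The quantifier over the exponentially many sets \<open>S\<close> is traded for
  \<open>2 * j\<close> variables naming the deleted arcs. By the congruence assumptions,
  \<open>C\<close> and \<open>a\<close> are not affected when arcs are stored in the other
  variables.\<close>

lemma computable_cut_gt:
  fixes j :: nat
  assumes cap: "computable False (\<lambda>xs e. C xs e (e 0) (e 1))"
    and C_cong: "\<And>xs e e'. (\<And>i. i \<in> {2, 3} \<Longrightarrow> e i = e' i) \<Longrightarrow> C xs e = C xs e'"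
    and a: "computable False a"
    and a_cong: "\<And>xs e e'. (\<And>i. i \<in> {2, 3} \<Longrightarrow> e i = e' i) \<Longrightarrow> a xs e = a xs e'"
  obtains Q where "computable_pred True Q"
    "\<And>xs e. size_code xs \<le> length xs \<Longrightarrow> a xs e < size_code xs \<Longrightarrow> Q xs e \<longleftrightarrow>
      (\<forall>S\<subseteq>{..<size_code xs}. a xs e \<in> S \<longrightarrow> snk_code xs \<notin> S \<longrightarrow> j < cut {..<size_code xs} (C xs e) S)"
proof -
  define P where "P xs e \<longleftrightarrow> e 0 < size_code xs \<and> e 1 < size_code xs \<and>
    count_deleted j e < C xs e (e 0) (e 1)" for xs and e :: "nat \<Rightarrow> nat"
  define reach where "reach xs e \<longleftrightarrow> (a xs e, snk_code xs) \<in>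
    {(p, q). p < length xs \<and> q < length xs \<and> P xs (e(0 := p, 1 := q))}\<^sup>*" for xs e
  define vs where "vs = [4..<4 + 2 * j]"
  have "computable_pred False P"
    unfolding P_def
    by (intro computable_pred_and computable_pred_less computable_var computable_input
        computable_count_deleted cap)
  then have "computable_pred True reach"
    unfolding reach_def by (intro computable_pred_reachable a computable_input) auto
  then have "computable_pred True (all_vars vs reach)" by (rule computable_pred_all_vars)
  moreover have "all_vars vs reach xs e \<longleftrightarrow>
      (\<forall>S\<subseteq>{..<size_code xs}. a xs e \<in> S \<longrightarrow> snk_code xs \<notin> S \<longrightarrow> j < cut {..<size_code xs} (C xs e) S)"
    if le: "size_code xs \<le> length xs" and a_lt: "a xs e < size_code xs" for xs e
  proof -
    let ?V = "{..<size_code xs}" and ?t = "snk_code xs"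
    let ?e = "\<lambda>g i. if i \<in> set vs then g i else e i"
    define R where "R F = {(p, q). p \<in> ?V \<and> q \<in> ?V \<and>
      card {i. i < j \<and> F i = (p, q)} < C xs e p q}" for F :: "nat \<Rightarrow> nat \<times> nat"
    have reach: "reach xs (?e g) \<longleftrightarrow> (a xs e, ?t) \<in> (R (\<lambda>i. (g (4 + 2 * i), g (5 + 2 * i))))\<^sup>*" for g
    proof -
      have "C xs ((?e g)(0 := p, 1 := q)) = C xs e" for p q
        by (rule C_cong) (auto simp: vs_def)
      moreover have "count_deleted j ((?e g)(0 := p, 1 := q)) =
          card {i. i < j \<and> (g (4 + 2 * i), g (5 + 2 * i)) = (p, q)}" for p q
        unfolding count_deleted_def by (intro arg_cong[of _ _ card] Collect_cong) (auto simp: vs_def)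
      ultimately have "{(p, q). p < length xs \<and> q < length xs \<and> P xs ((?e g)(0 := p, 1 := q))} =
          R (\<lambda>i. (g (4 + 2 * i), g (5 + 2 * i)))"
        unfolding P_def R_def using le by auto
      moreover have "a xs (?e g) = a xs e" by (rule a_cong) (auto simp: vs_def)
      ultimately show ?thesis by (simp add: reach_def)
    qed
    show ?thesis
    proof
      assume l: "all_vars vs reach xs e"
      show "\<forall>S\<subseteq>?V. a xs e \<in> S \<longrightarrow> ?t \<notin> S \<longrightarrow> j < cut ?V (C xs e) S"
      proof (intro allI impI, rule reachable_imp_cut_gt)
        fix F :: "nat \<Rightarrow> nat \<times> nat"
        assume F: "\<And>i. F i \<in> ?V \<times> ?V"
        \<comment> \<open>Arc \<open>i\<close> of the list is stored in variables
          \<open>4 + 2 * i\<close> and \<open>5 + 2 * i\<close>, hence the shift by 2 after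
          halving.\<close>
        define g where "g i = (if even i then fst (F (i div 2 - 2)) else snd (F (i div 2 - 2)))" for i
        have "g i < length xs" for i
          using F[of "i div 2 - 2"] le by (auto simp: g_def mem_Times_iff)
        then have "reach xs (?e g)" using l unfolding all_vars_iff by blast
        then have "(a xs e, ?t) \<in> (R (\<lambda>i. (g (4 + 2 * i), g (5 + 2 * i))))\<^sup>*" unfolding reach .
        also have "(\<lambda>i. (g (4 + 2 * i), g (5 + 2 * i))) = F"
        proof
          fix i :: nat
          have "(5 + 2 * i) div 2 = i + 2" "(4 + 2 * i) div 2 = i + 2" by presburger+
          then show "(g (4 + 2 * i), g (5 + 2 * i)) = F i" by (simp add: g_def)
        qed
        finally show "(a xs e, ?t) \<in> {(p, q). p \<in> ?V \<and> q \<in> ?V \<and>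
            card {i. i < j \<and> F i = (p, q)} < C xs e p q}\<^sup>*"
          unfolding R_def .
      qed (use a_lt in auto)
    next
      assume r: "\<forall>S\<subseteq>?V. a xs e \<in> S \<longrightarrow> ?t \<notin> S \<longrightarrow> j < cut ?V (C xs e) S"
      \<comment> \<open>The variables may name positions that are no vertices;
        \<open>cut_gt_imp_reachable\<close> allows any list.\<close>
      show "all_vars vs reach xs e"
        unfolding all_vars_iff reach R_def
        by (intro allI impI cut_gt_imp_reachable[OF _ _ r]) (use a_lt in auto)
    qed
  qed
  ultimately show ?thesis using that by blast
qed

lemma computable_arcs_above:
  assumes cap: "computable False (\<lambda>xs e. C xs e (e 0) (e 1))"
    and C_cong: "\<And>xs e e'. (\<And>i. i \<in> {2, 3} \<Longrightarrow> e i = e' i) \<Longrightarrow> C xs e = C xs e'"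
  obtains Q where "computable_pred True Q"
    "\<And>xs e. size_code xs \<le> length xs \<Longrightarrow>
      Q xs e \<longleftrightarrow> (src_code xs, snk_code xs) \<in> (arcs_above m {..<size_code xs} (C xs e))\<^sup>*"
proof -
  define P where "P xs e \<longleftrightarrow> e 0 < size_code xs \<and> e 1 < size_code xs \<and> m < C xs e (e 0) (e 1)"
    for xs and e :: "nat \<Rightarrow> nat"
  let ?Q = "\<lambda>xs e. (src_code xs, snk_code xs) \<in>
    {(p, q). p < length xs \<and> q < length xs \<and> P xs (e(0 := p, 1 := q))}\<^sup>*"
  have "computable_pred False P"
    unfolding P_def
    by (intro computable_pred_and computable_pred_less computable_var computable_input computable_const cap)
  then have "computable_pred True ?Q" by (intro computable_pred_reachable computable_input) auto
  moreover have "{(p, q). p < length xs \<and> q < length xs \<and> P xs (e(0 := p, 1 := q))} =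
      arcs_above m {..<size_code xs} (C xs e)" if "size_code xs \<le> length xs" for xs e
  proof -
    have "C xs (e(0 := p, 1 := q)) = C xs e" for p q by (rule C_cong) auto
    then show ?thesis using that by (auto simp: P_def arcs_above_def)
  qed
  ultimately show ?thesis using that[of ?Q] by simp
qed

lemma computable_bounded_flow:
  assumes "k \<ge> 1"
  obtains Q where "computable_pred True Q"
    "\<And>xs e. valid xs \<Longrightarrow> Q xs e \<longleftrightarrow>
      (\<exists>f. bounded_flow {..<size_code xs} (cap xs) (src_code xs) (snk_code xs) k f)"
proof (cases "k = 1")
  case True
  obtain Q where Q: "computable_pred True Q" "\<And>xs e. size_code xs \<le> length xs \<Longrightarrow>
      Q xs e \<longleftrightarrow> (src_code xs, snk_code xs) \<in> (arcs_above 1 {..<size_code xs} (cap xs))\<^sup>*"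
    by (rule computable_arcs_above[of "\<lambda>xs e. cap xs" 1])
      (auto intro: computable_cap computable_var)
  have "Q xs e \<longleftrightarrow> (\<exists>f. bounded_flow {..<size_code xs} (cap xs) (src_code xs) (snk_code xs) k f)"
    if "valid xs" for xs e
    unfolding True Q(2)[OF valid_size_le(1)[OF that]]
    by (rule bounded_flow_1_iff[symmetric]) (use that in \<open>auto simp: valid_def\<close>)
  with Q(1) that show ?thesis by blast
next
  case False
  then have k: "k \<ge> 2" using assms by simp
  have del: "computable False (\<lambda>xs e. delete_vertex (e 2) (cap xs) (e 0) (e 1))"
  proof -
    have "computable False (\<lambda>xs e. if of_bool (\<not> e 0 = e 2 \<and> \<not> e 1 = e 2) \<noteq> (0::nat)
        then cap xs (e 0) (e 1) else 0)"
      by (intro computable_if computable_pred_and computable_pred_not computable_pred_eq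
          computable_cap computable_var computable_const)
    then show ?thesis by (rule computable_cong) (simp add: delete_vertex_def)
  qed
  obtain QA where QA: "computable_pred True QA"
    "\<And>xs e. size_code xs \<le> length xs \<Longrightarrow> src_code xs < size_code xs \<Longrightarrow> QA xs e \<longleftrightarrow>
      (\<forall>S\<subseteq>{..<size_code xs}. src_code xs \<in> S \<longrightarrow> snk_code xs \<notin> S \<longrightarrow> k < cut {..<size_code xs} (cap xs) S)"
    by (rule computable_cut_gt[of "\<lambda>xs e. cap xs" "\<lambda>xs e. src_code xs" k])
      (auto intro: computable_cap computable_var computable_input)
  obtain QC where QC: "computable_pred True QC" "\<And>xs e. size_code xs \<le> length xs \<Longrightarrow>
      QC xs e \<longleftrightarrow> (src_code xs, snk_code xs) \<in>
        (arcs_above 0 {..<size_code xs} (delete_vertex (e 2) (cap xs)))\<^sup>*"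
    by (rule computable_arcs_above[of "\<lambda>xs e. delete_vertex (e 2) (cap xs)" 0]) (use del in auto)
  obtain QB where QB: "computable_pred True QB"
    "\<And>xs e. size_code xs \<le> length xs \<Longrightarrow> e 3 < size_code xs \<Longrightarrow> QB xs e \<longleftrightarrow>
      (\<forall>S\<subseteq>{..<size_code xs}. e 3 \<in> S \<longrightarrow> snk_code xs \<notin> S \<longrightarrow>
        1 < cut {..<size_code xs} (delete_vertex (e 2) (cap xs)) S)"
    by (rule computable_cut_gt[of "\<lambda>xs e. delete_vertex (e 2) (cap xs)" "\<lambda>xs e. e 3" 1])
      (use del in \<open>auto intro: computable_var\<close>)
  \<comment> \<open>These formulas spell out the criterion. Their reachability queries stand below
    connectives and quantifiers only, so all of them can reuse the one array.\<close>
  define Q1 where "Q1 xs e \<longleftrightarrow> e 3 < size_code xs \<and> 1 < cap xs (e 2) (e 3) \<and> QB xs e"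
    for xs and e :: "nat \<Rightarrow> nat"
  define Q2 where "Q2 xs e \<longleftrightarrow> e 2 < size_code xs \<and> \<not> e 2 = snk_code xs \<and> \<not> QC xs e \<longrightarrow>
    (\<exists>w<length xs. Q1 xs (e(3 := w)))" for xs and e :: "nat \<Rightarrow> nat"
  define Q where "Q xs e \<longleftrightarrow> QA xs e \<and> (\<forall>v<length xs. Q2 xs (e(2 := v)))" for xs and e :: "nat \<Rightarrow> nat"
  have "computable_pred True Q1"
    unfolding Q1_def
    by (intro computable_pred_and computable_pred_less computable_cap computable_var computable_input
        computable_const QB(1))
  then have "computable_pred True Q2"
    unfolding Q2_def
    by (intro computable_pred_imp computable_pred_and computable_pred_not computable_pred_ex
        computable_pred_less computable_pred_eq computable_var computable_input QC(1))
  then have "computable_pred True Q"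
    unfolding Q_def by (intro computable_pred_and computable_pred_all QA(1))
  moreover have "Q xs e \<longleftrightarrow> (\<exists>f. bounded_flow {..<size_code xs} (cap xs) (src_code xs) (snk_code xs) k f)"
    if valid: "valid xs" for xs e
  proof -
    let ?V = "{..<size_code xs}" and ?c = "cap xs" and ?s = "src_code xs" and ?t = "snk_code xs"
    have le: "size_code xs \<le> length xs" by (rule valid_size_le(1)[OF valid])
    have st: "?s < size_code xs" "?s \<noteq> ?t" using valid by (auto simp: valid_def)
    have A: "QA xs e \<longleftrightarrow> (\<forall>S\<subseteq>?V. ?s \<in> S \<longrightarrow> ?t \<notin> S \<longrightarrow> k < cut ?V ?c S)"
      by (rule QA(2)[OF le st(1)])
    have Q1: "Q1 xs (e(2 := v, 3 := w)) \<longleftrightarrow> w \<in> ?V \<and> 2 \<le> ?c v w \<and>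
        (\<forall>S\<subseteq>?V. w \<in> S \<longrightarrow> ?t \<notin> S \<longrightarrow> 1 < cut ?V (delete_vertex v ?c) S)" for v w
      using QB(2)[OF le, of "e(2 := v, 3 := w)"] by (auto simp: Q1_def)
    have Q2: "Q2 xs (e(2 := v)) \<longleftrightarrow> (v \<in> ?V \<longrightarrow> v \<noteq> ?t \<longrightarrow>
        (?s, ?t) \<notin> (arcs_above 0 ?V (delete_vertex v ?c))\<^sup>* \<longrightarrow>
        (\<exists>w\<in>?V. 2 \<le> ?c v w \<and> (\<forall>S\<subseteq>?V. w \<in> S \<longrightarrow> ?t \<notin> S \<longrightarrow> 1 < cut ?V (delete_vertex v ?c) S)))" for v
    proof -
      have "(\<exists>w<length xs. Q1 xs (e(2 := v, 3 := w))) \<longleftrightarrow>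
        (\<exists>w\<in>?V. 2 \<le> ?c v w \<and> (\<forall>S\<subseteq>?V. w \<in> S \<longrightarrow> ?t \<notin> S \<longrightarrow> 1 < cut ?V (delete_vertex v ?c) S))"
        unfolding Q1 using le by (meson lessThan_iff less_le_trans)
      then show ?thesis unfolding Q2_def QC(2)[OF le] by (simp add: imp_conjL)
    qed
    show ?thesis
    proof
      assume "Q xs e"
      then show "\<exists>f. bounded_flow ?V ?c ?s ?t k f"
        using A Q2 le st k unfolding Q_def by (intro bounded_flow_exists) (auto dest: less_le_trans)
    next
      assume "\<exists>f. bounded_flow ?V ?c ?s ?t k f"
      then obtain f where f: "bounded_flow ?V ?c ?s ?t k f" ..
      have "QA xs e" unfolding A using bounded_flow_cut[OF _ f] by blast
      moreover have "Q2 xs (e(2 := v))" for v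
        unfolding Q2 using bounded_flow_cut_vertex[OF _ _ f] st(1) by blast
      ultimately show "Q xs e" by (simp add: Q_def)
    qed
  qed
  ultimately show ?thesis using that by blast
qed

theorem theorem3p4:
  fixes k :: nat
  assumes "k \<ge> 1"
  shows "polynomial_time_decidable
    {encode_network N | N. input_network N \<and>
       (\<exists>x. st_flow N x \<and> flow_value N x \<ge> int (k + 1) \<and>
            max_out_degree (with_proj (support_digraph N x)) \<le> k)}"
proof -
  obtain Q where Q: "computable_pred True Q"
    "\<And>xs e. valid xs \<Longrightarrow> Q xs e \<longleftrightarrow>
      (\<exists>f. bounded_flow {..<size_code xs} (cap xs) (src_code xs) (snk_code xs) k f)"
    using computable_bounded_flow[OF assms] by blast
  have enc: "Q (encode_network N) e \<longleftrightarrow> (\<exists>x. st_flow N x \<and> flow_value N x \<ge> int (k + 1) \<and>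
      max_out_degree (with_proj (support_digraph N x)) \<le> k)" if N: "input_network N" for N e
    unfolding Q(2)[OF encode_network_valid(1)[OF N]] encode_network_valid(2-)[OF N]
    by (rule network_flow_iff_bounded_flow[symmetric]) (use N in \<open>simp add: input_network_def\<close>)
  \<comment> \<open>\<open>Q\<close> is specified on valid sequences alone; the first conjunct
    rejects all others, on which the evaluation still halts in time.\<close>
  have "computable_pred True (\<lambda>xs e. valid xs \<and> Q xs e)"
    by (intro computable_pred_and computable_valid Q(1))
  then have "polynomial_time_decidable {xs. valid xs \<and> Q xs (\<lambda>_. 0)}"
    by (rule computable_pred_polynomial_time)
  also have "{xs. valid xs \<and> Q xs (\<lambda>_. 0)} = {encode_network N | N. input_network N \<and>
       (\<exists>x. st_flow N x \<and> flow_value N x \<ge> int (k + 1) \<and>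
            max_out_degree (with_proj (support_digraph N x)) \<le> k)}"
    using enc encode_network_valid(1) by (auto elim!: valid_encode_network)
  finally show ?thesis .
qed

end
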